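(* Let $r\in(0,\infty)$. Let $P=(p_{ij})_{N\times N}$, $(c_{ij})_{N\times N}$, the cylinder sets $J_\sigma\subset\mathbb{R}^t$ and the probability vector $(\chi_i)_{i=1}^N$ be as in the context; in particular assume that $\mathrm{card}(\{1\le j\le N: p_{ij}>0\})\ge 2$ for all $1\le i\le N$, and that there is a constant $t_0\in(0,1)$ such that $$d(J_{\sigma\ast i_1},J_{\sigma\ast i_2})\ge t_0\max\{|J_{\sigma\ast i_1}|,|J_{\sigma\ast i_2}|\}$$ for every $\sigma\in\Omega^*$ and all distinct $i_1,i_2\in\Omega_1$ with $(\sigma_{|\sigma|},i_l)\in\Omega_2$, $l=1,2$. Let $\mu$ be the associated Markov-type measure, let $e_{n,r}(\mu)$ be its $n$th quantization error of order $r$, and let $s_r$ and $T_r$ be the numbers defined in the context. Then $$e_{n,r}^r(\mu)\asymp n^{-\frac{r}{s_r}}\cdot(\log n)^{(T_r-1)\left(1+\frac{r}{s_r}\right)},$$ that is, there is a constant $B\ge 1$ such that for all integers $n\ge 2$, $$B^{-1}n^{-\frac{r}{s_r}}(\log n)^{(T_r-1)(1+\frac{r}{s_r})}\le e_{n,r}^r(\mu)\le B\,n^{-\frac{r}{s_r}}(\log n)^{(T_r-1)(1+\frac{r}{s_r})}.$$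
   Context: **Words.** $P=(p_{ij})_{N\times N}$ is a row-stochastic matrix ($p_{ij}\ge0$, $\sum_{j}p_{ij}=1$ for each $i$) and $(c_{ij})_{N\times N}$ is a matrix with $c_{ij}\in[0,1)$ and $c_{ij}>0$ if and only if $p_{ij}>0$. Let $\theta$ be the empty word, $\Omega_0=\{\theta\}$, $\Omega_1=\{1,\dots,N\}$, $\Omega_k=\{\sigma\in\Omega_1^k:\prod_{h=1}^{k-1}p_{\sigma_h\sigma_{h+1}}>0\}$ for $k\ge2$, $\Omega^*=\bigcup_{k\ge0}\Omega_k$, and $\Omega_\infty=\{\sigma\in\Omega_1^{\mathbb N}:p_{\sigma_h\sigma_{h+1}}>0\text{ for all }h\ge1\}$. For $\sigma\in\Omega_k$ write $|\sigma|=k$; $\sigma|_k$ denotes the initial segment of length $k$; $\sigma\ast\omega$ denotes concatenation, defined if $(\sigma_{|\sigma|},\omega_1)\in\Omega_2$. For $\sigma=\theta$ the condition $(\sigma_{|\sigma|},i)\in\Omega_2$ is regarded as void and $\theta\ast i=i$. **Cylinder sets.** Let $d$ be the metric on $\mathbb{R}^t$ induced by a norm; $|A|$ is the diameter of $A\subset\mathbb{R}^t$, and $d(A,B)=\inf\{d(a,b):a\in A,b\in B\}$. The sets $J_i$, $1\le i\le N$, are non-empty compact subsets of $\mathbb{R}^t$ with $J_i=\overline{\mathrm{int}(J_i)}$ and $|J_i|=1$. Inductively, for each $k\ge1$ and $\sigma\in\Omega_k$, the sets $J_{\sigma\ast i}$ with $\sigma\ast i\in\Omega_{k+1}$ are non-overlapping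 subsets of $J_\sigma$ such that $J_{\sigma\ast i}$ is geometrically similar to $J_i$ and $|J_{\sigma\ast i}|/|J_\sigma|=c_{\sigma_{|\sigma|}i}$. Put $E=\bigcap_{k\ge1}\bigcup_{\sigma\in\Omega_k}J_\sigma$. **Markov-type measure.** $(\chi_i)_{i=1}^N$ is a probability vector with $\min_i\chi_i>0$. Let $\widetilde\mu$ be the unique probability measure on $\Omega_\infty$ with $\widetilde\mu(\{\omega\in\Omega_\infty:\omega|_k=\sigma\})=\chi_{\sigma_1}p_{\sigma_1\sigma_2}\cdots p_{\sigma_{k-1}\sigma_k}$ for all $k\ge1$, $\sigma\in\Omega_k$. Let $\pi:\Omega_\infty\to E$ be given by $\{\pi(\sigma)\}=\bigcap_{k\ge1}J_{\sigma|_k}$. The Markov-type measure is $\mu=\widetilde\mu\circ\pi^{-1}$; it satisfies $\mu(J_\sigma)=\chi_{\sigma_1}p_{\sigma_1\sigma_2}\cdots p_{\sigma_{k-1}\sigma_k}$ for $\sigma\in\Omega_k$. **Quantization error.** For a Borel probability measure $\nu$ on $\mathbb{R}^t$, $e_{n,r}(\nu)=\left(\inf_{\alpha}\int d(x,\alpha)^r\,d\nu(x)\right)^{1/r}$, where the infimum is over all $\alpha\subset\mathbb{R}^t$ with $1\le\mathrm{card}(\alpha)\le n$ and $d(x,\alpha)=\inf_{a\in\alpha}d(x,a)$. **Graph quantities.** $G$ is the directed graph with vertex set $\{1,\dots,N\}$ having exactly one edge from $i$ to $j$ if $p_{ij}>0$ and none otherwise; elements of $\Omega_k$ are the paths in $G$.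 $\mathrm{SC}(G)$ is the set of strongly connected components (maximal strongly connected subgraphs) of $G$. For $s>0$ let $b_{ij}(s)=(p_{ij}c_{ij}^r)^{\frac{s}{s+r}}$, $A_G(s)=(b_{ij}(s))_{N\times N}$, and for $H\in\mathrm{SC}(G)$ let $A_H(s)=(b_{ij}(s))_{i,j\in H}$. Let $\Psi_G(s),\Psi_H(s)$ be the spectral radii of $A_G(s),A_H(s)$. There is a unique positive number $s_r$ with $\Psi_G(s_r)=1$. Let $s_r(H)$ be the unique positive number with $\Psi_H(s_r(H))=1$ (when such a number exists), and let $\mathcal{M}_r=\{H\in\mathrm{SC}(G):s_r(H)=s_r\}$, i.e. the set of $H\in \mathrm{SC}(G)$ with $\Psi_H(s_r)=1$. For a path $\gamma=\gamma_1\cdots\gamma_{|\gamma|}\in\Omega^*$ let $T_r(\gamma)=\mathrm{card}(\{H\in\mathcal{M}_r:\gamma_i\in H\text{ for some }i\})$, and let $T_r=\max_{\gamma\in\Omega^*}T_r(\gamma)$. *)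

theory Defs
  imports
    "HOL-Analysis.Analysis"
    "HOL-Probability.Probability"
    "Graph_Theory.Digraph_Component"
    "Jordan_Normal_Form.Spectral_Radius"
begin

text \<open>
  The metric on \<open>\<real>\<^sup>t\<close> comes from an arbitrary norm \<open>nrm\<close>. All such norms are equivalent, so
  topological notions (\<open>compact\<close>, \<open>interior\<close>, \<open>borel\<close>) are the library's Euclidean ones;
  diameters, distances and similarity have to be taken with respect to \<open>nrm\<close>.
\<close>

definition is_norm :: "('a::real_vector \<Rightarrow> real) \<Rightarrow> bool" where
  "is_norm nrm \<longleftrightarrow>
     (\<forall>x. 0 \<le> nrm x) \<and> (\<forall>x. nrm x = 0 \<longleftrightarrow> x = 0) \<and>
     (\<forall>a x. nrm (a *\<^sub>R x) = \<bar>a\<bar> * nrm x) \<and>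
     (\<forall>x y. nrm (x + y) \<le> nrm x + nrm y)"

definition norm_diam :: "('a::real_vector \<Rightarrow> real) \<Rightarrow> 'a set \<Rightarrow> real" where
  "norm_diam nrm A = (SUP (x, y) \<in> A \<times> A. nrm (x - y))"

definition norm_setdist :: "('a::real_vector \<Rightarrow> real) \<Rightarrow> 'a set \<Rightarrow> 'a set \<Rightarrow> real" where
  "norm_setdist nrm A B = (INF (a, b) \<in> A \<times> B. nrm (a - b))"

definition norm_infdist :: "('a::real_vector \<Rightarrow> real) \<Rightarrow> 'a \<Rightarrow> 'a set \<Rightarrow> real" where
  "norm_infdist nrm x A = (INF a\<in>A. nrm (x - a))"

definition geom_similar :: "('a::real_vector \<Rightarrow> real) \<Rightarrow> 'a set \<Rightarrow> 'a set \<Rightarrow> bool" where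
  "geom_similar nrm A B \<longleftrightarrow>
     (\<exists>f \<rho>. \<rho> > 0 \<and> (\<forall>x y. nrm (f x - f y) = \<rho> * nrm (x - y)) \<and> A = f ` B)"

text \<open>
  The infimum over non-empty sets of at most \<open>n\<close> points of the \<open>r\<close>-th mean distance. The Bochner
  integral has the intended value whenever \<open>\<nu>\<close> has a finite \<open>r\<close>-th moment, e.g. for compactly
  supported \<open>\<nu>\<close>.
\<close>

definition quantization_error ::
    "(real^'t \<Rightarrow> real) \<Rightarrow> (real^'t) measure \<Rightarrow> nat \<Rightarrow> real \<Rightarrow> real" where
  "quantization_error nrm \<nu> n r =
     (INF \<alpha>\<in>{\<alpha>. finite \<alpha> \<and> 1 \<le> card \<alpha> \<and> card \<alpha> \<le> n}.
        \<integral>x. norm_infdist nrm x \<alpha> powr r \<partial>\<nu>) powr (1 / r)"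

text \<open>
  Words over \<open>{1..N}\<close> are lists. List positions are counted from 0, so \<open>w ! h\<close> is the letter
  \<open>\<sigma>\<^bsub>h+1\<^esub>\<close>. For words of length 0 and 1 the product is empty, hence \<open>words N p 0 = {[]}\<close> and
  \<open>words N p 1\<close> consists of all one-letter words. The concatenation of \<open>\<sigma>\<close> and the letter \<open>i\<close> is
  defined iff \<open>\<sigma> @ [i]\<close> is again a word, which is automatic for \<open>\<sigma> = []\<close>.
\<close>

definition words :: "nat \<Rightarrow> (nat \<Rightarrow> nat \<Rightarrow> real) \<Rightarrow> nat \<Rightarrow> nat list set" where
  "words N p k =
     {w. length w = k \<and> set w \<subseteq> {1..N} \<and> (\<Prod>h<k-1. p (w ! h) (w ! Suc h)) > 0}"

definition all_words :: "nat \<Rightarrow> (nat \<Rightarrow> nat \<Rightarrow> real) \<Rightarrow> nat list set" where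
  "all_words N p = (\<Union>k. words N p k)"

definition inf_words :: "nat \<Rightarrow> (nat \<Rightarrow> nat \<Rightarrow> real) \<Rightarrow> (nat \<Rightarrow> nat) set" where
  "inf_words N p = {\<omega>. (\<forall>h. \<omega> h \<in> {1..N}) \<and> (\<forall>h. p (\<omega> h) (\<omega> (Suc h)) > 0)}"

definition prefix_word :: "(nat \<Rightarrow> nat) \<Rightarrow> nat \<Rightarrow> nat list" where
  "prefix_word \<omega> k = map \<omega> [0..<k]"

definition cylinder :: "nat \<Rightarrow> (nat \<Rightarrow> nat \<Rightarrow> real) \<Rightarrow> nat list \<Rightarrow> (nat \<Rightarrow> nat) set" where
  "cylinder N p \<sigma> = {\<omega> \<in> inf_words N p. prefix_word \<omega> (length \<sigma>) = \<sigma>}"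

text \<open>
  The defining property of the Markov measure on infinite words, with initial
  distribution \<open>q\<close>. The \<open>\<sigma>\<close>-algebra is the one
  generated by the cylinders, i.e. the Borel algebra of the product topology.
\<close>

definition is_markov_measure ::
    "nat \<Rightarrow> (nat \<Rightarrow> nat \<Rightarrow> real) \<Rightarrow> (nat \<Rightarrow> real) \<Rightarrow> (nat \<Rightarrow> nat) measure \<Rightarrow> bool" where
  "is_markov_measure N p q M \<longleftrightarrow>
     prob_space M \<and> space M = inf_words N p \<and>
     sets M = sigma_sets (inf_words N p) {cylinder N p \<sigma> | k \<sigma>. 1 \<le> k \<and> \<sigma> \<in> words N p k} \<and>
     (\<forall>k\<ge>1. \<forall>\<sigma>\<in>words N p k.
        measure M (cylinder N p \<sigma>) = q (\<sigma> ! 0) * (\<Prod>h<k-1. p (\<sigma> ! h) (\<sigma> ! Suc h)))"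

definition coding_map :: "(nat list \<Rightarrow> (real^'t) set) \<Rightarrow> (nat \<Rightarrow> nat) \<Rightarrow> real^'t" where
  "coding_map J \<omega> = the_elem (\<Inter>k\<in>{1..}. J (prefix_word \<omega> k))"

definition markov_type_measure ::
    "(nat list \<Rightarrow> (real^'t) set) \<Rightarrow> (nat \<Rightarrow> nat) measure \<Rightarrow> (real^'t) measure" where
  "markov_type_measure J M = distr M borel (coding_map J)"

text \<open>
  \<open>J []\<close> is irrelevant, and so are the values of \<open>J\<close> outside \<open>all_words N p\<close>.
\<close>

definition is_cylinder_system ::
    "(real^'t \<Rightarrow> real) \<Rightarrow> nat \<Rightarrow> (nat \<Rightarrow> nat \<Rightarrow> real) \<Rightarrow> (nat \<Rightarrow> nat \<Rightarrow> real)
      \<Rightarrow> (nat list \<Rightarrow> (real^'t) set) \<Rightarrow> bool" where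
  "is_cylinder_system nrm N p c J \<longleftrightarrow>
     (\<forall>i\<in>{1..N}. J [i] \<noteq> {} \<and> compact (J [i]) \<and> J [i] = closure (interior (J [i])) \<and>
        norm_diam nrm (J [i]) = 1) \<and>
     (\<forall>k\<ge>1. \<forall>\<sigma>\<in>words N p k.
        (\<forall>i. \<sigma> @ [i] \<in> words N p (k + 1) \<longrightarrow>
           J (\<sigma> @ [i]) \<subseteq> J \<sigma> \<and> geom_similar nrm (J (\<sigma> @ [i])) (J [i]) \<and>
           norm_diam nrm (J (\<sigma> @ [i])) / norm_diam nrm (J \<sigma>) = c (last \<sigma>) i) \<and>
        (\<forall>i j. \<sigma> @ [i] \<in> words N p (k + 1) \<and> \<sigma> @ [j] \<in> words N p (k + 1) \<and> i \<noteq> j \<longrightarrow>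
           interior (J (\<sigma> @ [i])) \<inter> interior (J (\<sigma> @ [j])) = {}))"

definition trans_graph :: "nat \<Rightarrow> (nat \<Rightarrow> nat \<Rightarrow> real) \<Rightarrow> (nat, nat \<times> nat) pre_digraph" where
  "trans_graph N p =
     \<lparr>verts = {1..N}, arcs = {(i, j). i \<in> {1..N} \<and> j \<in> {1..N} \<and> p i j > 0},
      tail = fst, head = snd\<rparr>"

text \<open>
  The square matrix \<open>(b i j)\<close> with \<open>i, j \<in> V\<close>, for a finite set \<open>V\<close> of indices taken in increasing
  order; it is complex-valued because \<^const>\<open>spectral_radius\<close> is defined for complex matrices.
\<close>

definition index_mat :: "nat set \<Rightarrow> (nat \<Rightarrow> nat \<Rightarrow> real) \<Rightarrow> complex mat" where
  "index_mat V b =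
     (let xs = sorted_list_of_set V
      in mat (card V) (card V) (\<lambda>(i, j). complex_of_real (b (xs ! i) (xs ! j))))"

definition b_entry ::
    "(nat \<Rightarrow> nat \<Rightarrow> real) \<Rightarrow> (nat \<Rightarrow> nat \<Rightarrow> real) \<Rightarrow> real \<Rightarrow> real \<Rightarrow> nat \<Rightarrow> nat \<Rightarrow> real" where
  "b_entry p c r s i j = (p i j * c i j powr r) powr (s / (s + r))"

definition Psi ::
    "(nat \<Rightarrow> nat \<Rightarrow> real) \<Rightarrow> (nat \<Rightarrow> nat \<Rightarrow> real) \<Rightarrow> real
      \<Rightarrow> (nat, nat \<times> nat) pre_digraph \<Rightarrow> real \<Rightarrow> real" where
  "Psi p c r H s = spectral_radius (index_mat (verts H) (b_entry p c r s))"

definition s_crit ::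
    "nat \<Rightarrow> (nat \<Rightarrow> nat \<Rightarrow> real) \<Rightarrow> (nat \<Rightarrow> nat \<Rightarrow> real) \<Rightarrow> real \<Rightarrow> real" where
  "s_crit N p c r = (THE s. s > 0 \<and> Psi p c r (trans_graph N p) s = 1)"

text \<open>
  The components \<open>H\<close> with \<open>s\<^sub>r(H) = s\<^sub>r\<close>, where \<open>s\<^sub>r(H)\<close> is the positive solution of \<open>\<Psi>\<^sub>H(s) = 1\<close>.
  A single vertex without a loop counts as a strongly connected component for
  \<^const>\<open>pre_digraph.sccs\<close>; its matrix is zero, so it is never among them.
\<close>

definition crit_sccs ::
    "nat \<Rightarrow> (nat \<Rightarrow> nat \<Rightarrow> real) \<Rightarrow> (nat \<Rightarrow> nat \<Rightarrow> real) \<Rightarrow> real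
      \<Rightarrow> (nat, nat \<times> nat) pre_digraph set" where
  "crit_sccs N p c r =
     {H \<in> pre_digraph.sccs (trans_graph N p). Psi p c r H (s_crit N p c r) = 1}"

definition T_path ::
    "nat \<Rightarrow> (nat \<Rightarrow> nat \<Rightarrow> real) \<Rightarrow> (nat \<Rightarrow> nat \<Rightarrow> real) \<Rightarrow> real \<Rightarrow> nat list \<Rightarrow> nat" where
  "T_path N p c r \<gamma> = card {H \<in> crit_sccs N p c r. \<exists>i<length \<gamma>. \<gamma> ! i \<in> verts H}"

definition T_max ::
    "nat \<Rightarrow> (nat \<Rightarrow> nat \<Rightarrow> real) \<Rightarrow> (nat \<Rightarrow> nat \<Rightarrow> real) \<Rightarrow> real \<Rightarrow> nat" where
  "T_max N p c r = Max (T_path N p c r ` all_words N p)"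

end

theory Submission
  imports Defs "HOL-Library.Sublist" "HOL-Real_Asymp.Real_Asymp"
begin

text \<open>
  Let \<open>a\<^sub>i\<^sub>j = p\<^sub>i\<^sub>j c\<^sub>i\<^sub>j\<^sup>r\<close> and let \<open>a(\<sigma>)\<close> be the product of these numbers along a word. Up to the
  initial probability of the first letter, which is bounded away from 0, \<open>a(\<sigma>)\<close> is \<open>\<mu>(J\<^sub>\<sigma>) |J\<^sub>\<sigma>|\<^sup>r\<close>, the contribution of the cylinder
  \<open>J\<^sub>\<sigma>\<close> to the quantization error when it gets a single point. For \<open>t \<ge> 0\<close> let \<open>\<Gamma>\<^sub>t\<close> be the set of
  words at which \<open>a\<close> drops below \<open>e\<^bsup>-t\<^esup>\<close> for the first time. It is a finite partition of the sequence
  space into cylinders of comparable contribution \<open>e\<^bsup>-t\<^esup>\<close>.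

  One point in each cylinder of \<open>\<Gamma>\<^sub>t\<close> gives \<open>e\<^sub>n\<^sup>r \<le> n e\<^bsup>-t\<^esup>\<close> as soon as \<open>card \<Gamma>\<^sub>t \<le> n\<close>
  (\<open>opt_upper\<close>). Conversely, by the separation condition the neighbourhoods of the cylinders of
  \<open>\<Gamma>\<^sub>t\<close> with radius \<open>t\<^sub>0/2\<close> times their diameter are disjoint, so \<open>n\<close> points serve at most \<open>n\<close> of them; if
  \<open>card \<Gamma>\<^sub>t \<ge> 2n\<close>, the other ones contribute at least a multiple of \<open>n e\<^bsup>-t\<^esup>\<close> (\<open>opt_lower\<close>). Hence everything depends
  on the growth of \<open>card \<Gamma>\<^sub>t\<close>.

  Splitting off the first letter of a word shows that the number \<open>N\<^sub>i(t)\<close> of words of \<open>\<Gamma>\<^sub>t\<close> starting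
  with \<open>i\<close> satisfies \<open>N\<^sub>i(t) = \<Sum>\<^sub>j N\<^sub>j(t - l\<^sub>i\<^sub>j)\<close> with \<open>l\<^sub>i\<^sub>j = -ln a\<^sub>i\<^sub>j\<close>. With \<open>\<delta> = s\<^sub>r/(s\<^sub>r + r)\<close> the functions
  \<open>f\<^sub>i(t) = e\<^bsup>-\<delta>t\<^esup> N\<^sub>i(t)\<close> solve the renewal equation \<open>f\<^sub>i(t) = \<Sum>\<^sub>j b\<^sub>i\<^sub>j f\<^sub>j(t - l\<^sub>i\<^sub>j)\<close>, whose matrix \<open>b\<^sub>i\<^sub>j = a\<^sub>i\<^sub>j\<^sup>\<delta>\<close> is
  \<open>A\<^sub>G(s\<^sub>r)\<close> and has spectral radius 1. Since all \<open>l\<^sub>i\<^sub>j\<close> are positive, solutions obey a maximum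
  principle, and it suffices to find explicit supersolutions and subsolutions. They are built from
  Perron eigenvectors, one strongly connected component at a time, in an order in which the successors of
  a component come first. A component of spectral radius less than 1 preserves the growth
  rate of its successors, a critical one raises it by one power of \<open>t\<close>: its equation
  conserves mass on average, and the successors act as a source that is integrated over time. If
  the successors decay exponentially, a critical component gives a bounded solution. The
  outcome is \<open>f\<^sub>i(t) \<asymp> t\<^bsup>T-1\<^esup>\<close>, where \<open>T \<ge> 1\<close> is the largest number of critical components on a walk starting at
  \<open>i\<close>, and exponential decay if no walk from \<open>i\<close> meets a critical component
  (\<open>renewal_upper_bounds\<close>, \<open>renewal_lower_bounds\<close>), so \<open>card \<Gamma>\<^sub>t \<asymp> e\<^bsup>\<delta>t\<^esup> t\<^bsup>T-1\<^esup>\<close> with \<open>T = T\<^sub>r\<close> (\<open>card_cutset_bounds\<close>).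
  Choosing \<open>t\<close> such that this is comparable to \<open>n\<close> gives the theorem (\<open>invert_counting_bounds\<close>).
\<close>

section \<open>Spectral radii of nonnegative matrices\<close>

lemma sorted_list_nth_bij:
  fixes V :: "nat set"
  assumes "finite V"
  shows "bij_betw (\<lambda>k. sorted_list_of_set V ! k) {..<card V} V"
  using bij_betw_nth[of "sorted_list_of_set V" "{..<card V}" V] assms by simp

lemma sorted_list_position:
  fixes V :: "nat set"
  assumes "finite V" "i \<in> V"
  obtains k where "k < card V" "i = sorted_list_of_set V ! k"
proof -
  have "i \<in> set (sorted_list_of_set V)" using assms by simp
  then obtain k where "k < length (sorted_list_of_set V)" "sorted_list_of_set V ! k = i"
    unfolding in_set_conv_nth by blast
  then show ?thesis using that[of k] assms by simp
qed

lemma index_mat_carrier: "index_mat V b \<in> carrier_mat (card V) (card V)"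
  by (simp add: index_mat_def Let_def)

lemma index_mat_mult_vec:
  assumes "finite V" "i < card V"
  shows "vec_index (index_mat V b *\<^sub>v vec (card V) (\<lambda>k. y (sorted_list_of_set V ! k))) i
    = (\<Sum>j\<in>V. complex_of_real (b (sorted_list_of_set V ! i) j) * y j)"
proof -
  have "vec_index (index_mat V b *\<^sub>v vec (card V) (\<lambda>k. y (sorted_list_of_set V ! k))) i
    = (\<Sum>k<card V. complex_of_real (b (sorted_list_of_set V ! i) (sorted_list_of_set V ! k))
         * y (sorted_list_of_set V ! k))"
    using assms(2)
    by (simp add: index_mat_def Let_def scalar_prod_def lessThan_atLeast0)
  also have "\<dots> = (\<Sum>j\<in>V. complex_of_real (b (sorted_list_of_set V ! i) j) * y j)"
    by (rule sum.reindex_bij_betw[OF sorted_list_nth_bij[OF assms(1)]])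
  finally show ?thesis .
qed

lemma vec_as_function_on_index_set:
  fixes V :: "nat set"
  assumes "finite V" "v \<in> carrier_vec (card V)"
  obtains y where "v = vec (card V) (\<lambda>k. y (sorted_list_of_set V ! k))"
proof -
  let ?g = "\<lambda>k. sorted_list_of_set V ! k"
  have "inj_on ?g {..<card V}"
    using sorted_list_nth_bij[OF assms(1)] by (simp add: bij_betw_def)
  then have "v = vec (card V) (\<lambda>k. (\<lambda>x. vec_index v (the_inv_into {..<card V} ?g x)) (?g k))"
    using assms(2) by (intro eq_vecI) (auto simp: the_inv_into_f_f)
  then show ?thesis by (rule that)
qed

lemma spectral_radius_nonneg:
  assumes "finite V" "V \<noteq> {}"
  shows "0 \<le> spectral_radius (index_mat V b)"
proof -
  have "card V > 0" using assms by (simp add: card_gt_0_iff)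
  from spectral_radius_mem_max(1)[OF index_mat_carrier this, of b]
  show ?thesis by (metis imageE norm_ge_zero)
qed

text \<open>
  Take the moduli of the entries of an eigenvector for an eigenvalue of maximal modulus and use the triangle
  inequality.
\<close>

lemma nonneg_subeigenvector:
  assumes fin: "finite V" and ne: "V \<noteq> {}" and b: "\<And>i j. i \<in> V \<Longrightarrow> j \<in> V \<Longrightarrow> 0 \<le> b i j"
  shows "\<exists>z. (\<forall>i. 0 \<le> z i) \<and> (\<exists>i\<in>V. 0 < z i) \<and>
    (\<forall>i\<in>V. spectral_radius (index_mat V b) * z i \<le> (\<Sum>j\<in>V. b i j * z j))"
proof -
  let ?A = "index_mat V b" and ?n = "card V" and ?g = "\<lambda>k. sorted_list_of_set V ! k"
  have n: "?n > 0" using fin ne by (simp add: card_gt_0_iff)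
  from spectral_radius_mem_max(1)[OF index_mat_carrier n]
  obtain ev where ev: "ev \<in> spectrum ?A" "cmod ev = spectral_radius ?A" by force
  then obtain v where v: "eigenvector ?A v ev"
    by (auto simp: spectrum_def eigenvalue_def)
  then have vc: "v \<in> carrier_vec ?n" and v0: "v \<noteq> 0\<^sub>v ?n" and ve: "?A *\<^sub>v v = ev \<cdot>\<^sub>v v"
    using index_mat_carrier[of V b] by (auto simp: eigenvector_def)
  obtain y where y: "v = vec ?n (\<lambda>k. y (?g k))"
    by (rule vec_as_function_on_index_set[OF fin vc])
  have eq: "ev * y i = (\<Sum>j\<in>V. complex_of_real (b i j) * y j)" if i: "i \<in> V" for i
  proof -
    obtain k where k: "k < ?n" "i = ?g k"
      by (rule sorted_list_position[OF fin i])
    have "vec_index (?A *\<^sub>v v) k = ev * y i"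
      unfolding ve using k y by simp
    then show ?thesis
      using index_mat_mult_vec[OF fin k(1), of b y] k(2) y by simp
  qed
  have "\<exists>i\<in>V. 0 < cmod (y i)"
  proof (rule ccontr)
    assume "\<not> ?thesis"
    then have "\<forall>i\<in>V. y i = 0" by auto
    moreover have "?g k \<in> V" if "k < ?n" for k
      using that sorted_list_nth_bij[OF fin] by (auto simp: bij_betw_def)
    ultimately have "v = 0\<^sub>v ?n" unfolding y by (intro eq_vecI) auto
    with v0 show False by simp
  qed
  moreover have "spectral_radius ?A * cmod (y i) \<le> (\<Sum>j\<in>V. b i j * cmod (y j))" if "i \<in> V" for i
  proof -
    have "spectral_radius ?A * cmod (y i) = cmod (ev * y i)" by (simp add: norm_mult ev(2))
    also have "\<dots> \<le> (\<Sum>j\<in>V. cmod (complex_of_real (b i j) * y j))"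
      unfolding eq[OF that] by (rule norm_sum)
    also have "\<dots> = (\<Sum>j\<in>V. b i j * cmod (y j))"
      using b that by (intro sum.cong) (auto simp: norm_mult)
    finally show ?thesis .
  qed
  ultimately show ?thesis by (intro exI[of _ "\<lambda>i. cmod (y i)"]) simp
qed

text \<open>
  Compare the vector \<open>z\<close> of the previous lemma with \<open>v\<close> at an index where \<open>z\<^sub>i / v\<^sub>i\<close> is largest.
\<close>

lemma spectral_radius_le_of_supersolution:
  assumes fin: "finite V" and ne: "V \<noteq> {}" and b: "\<And>i j. i \<in> V \<Longrightarrow> j \<in> V \<Longrightarrow> 0 \<le> b i j"
    and v: "\<And>i. i \<in> V \<Longrightarrow> 0 < v i"
    and sup: "\<And>i. i \<in> V \<Longrightarrow> (\<Sum>j\<in>V. b i j * v j) \<le> \<theta> * v i"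
  shows "spectral_radius (index_mat V b) \<le> \<theta>"
proof -
  let ?\<rho> = "spectral_radius (index_mat V b)"
  obtain z where z: "\<forall>i. 0 \<le> z i" "\<exists>i\<in>V. 0 < z i"
    "\<forall>i\<in>V. ?\<rho> * z i \<le> (\<Sum>j\<in>V. b i j * z j)"
    using nonneg_subeigenvector[where b = b, OF fin ne b] by metis
  define m where "m = Max ((\<lambda>i. z i / v i) ` V)"
  have "m \<in> (\<lambda>i. z i / v i) ` V" unfolding m_def using fin ne by (intro Max_in) auto
  then obtain i where i: "i \<in> V" "m = z i / v i" by blast
  have le: "z j / v j \<le> m" if "j \<in> V" for j
    unfolding m_def using fin that by simp
  have zle: "z j \<le> m * v j" if "j \<in> V" for j
    using le[OF that] v[OF that] by (simp add: pos_divide_le_eq)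
  have mpos: "m > 0"
  proof -
    obtain j where "j \<in> V" "0 < z j" using z(2) by blast
    with v[of j] le[of j] show ?thesis by (metis divide_pos_pos less_le_trans)
  qed
  have "m * v i = z i" unfolding i(2) using v[OF i(1)] by simp
  then have "?\<rho> * (m * v i) = ?\<rho> * z i" by simp
  also have "\<dots> \<le> (\<Sum>j\<in>V. b i j * z j)" using z(3) i(1) by blast
  also have "\<dots> \<le> (\<Sum>j\<in>V. b i j * (m * v j))"
    using zle b i(1) by (intro sum_mono mult_left_mono) auto
  also have "\<dots> = m * (\<Sum>j\<in>V. b i j * v j)" by (simp add: sum_distrib_left mult_ac)
  also have "\<dots> \<le> m * (\<theta> * v i)" using sup[OF i(1)] mpos by simp
  finally have "?\<rho> * (m * v i) \<le> \<theta> * (m * v i)" by (simp add: mult_ac)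
  moreover have "m * v i > 0" by (rule mult_pos_pos[OF mpos v[OF i(1)]])
  ultimately show ?thesis by (simp only: mult_le_cancel_right_pos)
qed

text \<open>
  Used to scale a matrix to spectral radius below 1.
\<close>

lemma spectral_radius_smult_inverse:
  assumes A: "A \<in> carrier_mat n n" and n: "n > 0" and \<mu>: "\<mu> > 0"
  shows "spectral_radius (complex_of_real (1 / \<mu>) \<cdot>\<^sub>m A) \<le> spectral_radius A / \<mu>"
proof -
  let ?A = "complex_of_real (1 / \<mu>) \<cdot>\<^sub>m A"
  have A': "?A \<in> carrier_mat n n" using A by simp
  obtain ev where ev: "ev \<in> spectrum ?A" "cmod ev = spectral_radius ?A"
    using spectral_radius_mem_max(1)[OF A' n] by force
  then obtain v where v: "eigenvector ?A v ev"
    by (auto simp: spectrum_def eigenvalue_def)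
  then have vc: "v \<in> carrier_vec n" and v0: "v \<noteq> 0\<^sub>v n" and ve: "?A *\<^sub>v v = ev \<cdot>\<^sub>v v"
    using A by (auto simp: eigenvector_def)
  have smult: "(k \<cdot>\<^sub>m B) *\<^sub>v v = k \<cdot>\<^sub>v (B *\<^sub>v v)" if "B \<in> carrier_mat n n" for k B
    using that vc by (intro eq_vecI) auto
  have "complex_of_real \<mu> \<cdot>\<^sub>m ?A = A" using \<mu> by (intro eq_matI) auto
  then have "A *\<^sub>v v = complex_of_real \<mu> \<cdot>\<^sub>v (?A *\<^sub>v v)"
    using smult[OF A', of "complex_of_real \<mu>"] by simp
  then have "A *\<^sub>v v = (complex_of_real \<mu> * ev) \<cdot>\<^sub>v v"
    unfolding ve by (simp add: smult_smult_assoc)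
  then have "complex_of_real \<mu> * ev \<in> spectrum A"
    using vc v0 A by (auto simp: spectrum_def eigenvalue_def eigenvector_def)
  then have "cmod (complex_of_real \<mu> * ev) \<le> spectral_radius A"
    by (intro spectral_radius_mem_max(2)[OF A n] imageI)
  then have "\<mu> * spectral_radius ?A \<le> spectral_radius A"
    using \<mu> ev(2) by (simp add: norm_mult)
  then show ?thesis using \<mu> by (simp add: field_simps)
qed

text \<open>
  If \<open>\<nu>\<close> exceeded the spectral radius, the powers of the matrix divided by some \<open>\<mu> < \<nu>\<close> would stay bounded
  by the Jordan normal form, whereas applied to \<open>w\<close> they grow at least like \<open>(\<nu>/\<mu>)\<^sup>k\<close>.
\<close>

lemma le_spectral_radius_of_subsolution:
  assumes fin: "finite V" and b: "\<And>i j. i \<in> V \<Longrightarrow> j \<in> V \<Longrightarrow> 0 \<le> b i j"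
    and w: "\<And>i. i \<in> V \<Longrightarrow> 0 \<le> w i" and i0: "i0 \<in> V" "0 < w i0"
    and sub: "\<And>i. i \<in> V \<Longrightarrow> \<nu> * w i \<le> (\<Sum>j\<in>V. b i j * w j)"
  shows "\<nu> \<le> spectral_radius (index_mat V b)"
proof (rule ccontr)
  let ?A = "index_mat V b" and ?n = "card V" and ?g = "\<lambda>k. sorted_list_of_set V ! k"
  assume "\<not> ?thesis"
  then obtain \<mu> where \<mu>: "spectral_radius ?A < \<mu>" "\<mu> < \<nu>" using dense not_le by metis
  have ne: "V \<noteq> {}" using i0 by auto
  have n: "?n > 0" using fin ne by (simp add: card_gt_0_iff)
  have \<mu>0: "\<mu> > 0" using spectral_radius_nonneg[OF fin ne, of b] \<mu> by simp
  define A where "A = complex_of_real (1 / \<mu>) \<cdot>\<^sub>m ?A"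
  have Ac: "A \<in> carrier_mat ?n ?n" unfolding A_def using index_mat_carrier[of V b] by simp
  have "spectral_radius A < 1"
    using spectral_radius_smult_inverse[OF index_mat_carrier n \<mu>0, of b] \<mu> \<mu>0
    unfolding A_def by (smt (verit) divide_less_eq_1)
  then obtain C where C: "\<And>k. norm_bound (A ^\<^sub>m k) C"
    using spectral_radius_jnf_norm_bound_less_1_upper_triangular[OF Ac] by blast
  have AA: "A = index_mat V (\<lambda>i j. b i j / \<mu>)"
    unfolding A_def index_mat_def Let_def by (intro eq_matI) (auto simp: field_simps)
  define F where "F = (\<lambda>v i. \<Sum>j\<in>V. b i j / \<mu> * v j)"
  define Y where "Y k = (F ^^ k) w" for k
  define emb where "emb = (\<lambda>v. vec ?n (\<lambda>k. complex_of_real (v (?g k))))"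
  have emb_carrier: "emb v \<in> carrier_vec ?n" for v by (simp add: emb_def)
  have step: "A *\<^sub>v emb v = emb (F v)" for v
  proof (rule eq_vecI)
    show "dim_vec (A *\<^sub>v emb v) = dim_vec (emb (F v))" using Ac by (simp add: emb_def)
    fix l assume "l < dim_vec (emb (F v))"
    then have l: "l < ?n" by (simp add: emb_def)
    show "vec_index (A *\<^sub>v emb v) l = vec_index (emb (F v)) l"
      using index_mat_mult_vec[OF fin l, of "\<lambda>i j. b i j / \<mu>" "\<lambda>j. complex_of_real (v j)"] l
      by (simp add: AA emb_def F_def)
  qed
  have pow: "A ^\<^sub>m k *\<^sub>v emb v = emb ((F ^^ k) v)" for k v
  proof (induction k arbitrary: v)
    case 0
    show ?case using Ac emb_carrier[of v] by simp
  next
    case (Suc k)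
    have "A ^\<^sub>m Suc k *\<^sub>v emb v = A ^\<^sub>m k *\<^sub>v (A *\<^sub>v emb v)"
      using assoc_mult_mat_vec[OF pow_carrier_mat[OF Ac] Ac emb_carrier] by simp
    also have "\<dots> = emb ((F ^^ Suc k) v)" unfolding step Suc by (simp add: funpow_swap1)
    finally show ?case .
  qed
  have nm: "\<nu> / \<mu> > 1" using \<mu> \<mu>0 by simp
  have grow: "(\<nu> / \<mu>) ^ k * w i \<le> Y k i" if "i \<in> V" for i k
    using that
  proof (induction k arbitrary: i)
    case 0
    then show ?case by (simp add: Y_def)
  next
    case (Suc k)
    have "(\<nu> / \<mu>) ^ Suc k * w i = (\<nu> / \<mu>) ^ k / \<mu> * (\<nu> * w i)" by simp
    also have "\<dots> \<le> (\<nu> / \<mu>) ^ k / \<mu> * (\<Sum>j\<in>V. b i j * w j)"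
      using nm \<mu>0 sub[OF Suc.prems] by (intro mult_left_mono) auto
    also have "\<dots> = (\<Sum>j\<in>V. b i j / \<mu> * ((\<nu> / \<mu>) ^ k * w j))"
      by (simp add: sum_distrib_left mult_ac)
    also have "\<dots> \<le> (\<Sum>j\<in>V. b i j / \<mu> * Y k j)"
      using Suc b \<mu>0 by (intro sum_mono mult_left_mono) auto
    finally show ?case by (simp add: Y_def F_def)
  qed
  obtain l0 where l0: "l0 < ?n" "i0 = ?g l0"
    by (rule sorted_list_position[OF fin i0(1)])
  have bdd: "Y k i0 \<le> (\<Sum>l<?n. C * w (?g l))" for k
  proof -
    have "Y k i0 \<le> cmod (vec_index (A ^\<^sub>m k *\<^sub>v emb w) l0)"
      unfolding pow using l0 by (simp add: Y_def emb_def)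
    also have "vec_index (A ^\<^sub>m k *\<^sub>v emb w) l0
        = (\<Sum>l<?n. (A ^\<^sub>m k) $$ (l0, l) * complex_of_real (w (?g l)))"
      using l0 Ac pow_carrier_mat[OF Ac, of k]
      by (simp add: scalar_prod_def emb_def lessThan_atLeast0)
    also have "cmod \<dots> \<le> (\<Sum>l<?n. cmod ((A ^\<^sub>m k) $$ (l0, l) * complex_of_real (w (?g l))))"
      by (rule norm_sum)
    also have "\<dots> \<le> (\<Sum>l<?n. C * w (?g l))"
    proof (rule sum_mono)
      fix l assume l: "l \<in> {..<?n}"
      then have "?g l \<in> V" using sorted_list_nth_bij[OF fin] by (auto simp: bij_betw_def)
      moreover have "cmod ((A ^\<^sub>m k) $$ (l0, l)) \<le> C"
        using C[of k] l l0(1) carrier_matD[OF pow_carrier_mat[OF Ac, of k]]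
        unfolding norm_bound_def by (metis lessThan_iff)
      ultimately show "cmod ((A ^\<^sub>m k) $$ (l0, l) * complex_of_real (w (?g l))) \<le> C * w (?g l)"
        using w by (simp add: norm_mult mult_right_mono)
    qed
    finally show ?thesis .
  qed
  obtain k where "(\<Sum>l<?n. C * w (?g l)) / w i0 < (\<nu> / \<mu>) ^ k"
    using real_arch_pow[OF nm] by blast
  then have "(\<Sum>l<?n. C * w (?g l)) < (\<nu> / \<mu>) ^ k * w i0"
    using i0 by (simp add: pos_divide_less_eq)
  with grow[OF i0(1), of k] bdd[of k] show False by simp
qed


text \<open>
  Reachability is reflexive here, so the zero matrix on a single index counts as irreducible. This makes the
  eigenvector theorem below apply to every strongly connected component, also to a single vertex without
  a loop.
\<close>

definition irreducible_on :: "nat set \<Rightarrow> (nat \<Rightarrow> nat \<Rightarrow> real) \<Rightarrow> bool" where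
  "irreducible_on H b \<longleftrightarrow>
     (\<forall>i\<in>H. \<forall>j\<in>H. (i, j) \<in> {(x, y). x \<in> H \<and> y \<in> H \<and> 0 < b x y}\<^sup>*)"

text \<open>
  The identity added to the matrix keeps positive entries positive, while the matrix itself
  moves positivity one step against the direction of the edges.
\<close>

lemma irreducible_iterates_positive:
  assumes fin: "finite H" and b: "\<And>i j. i \<in> H \<Longrightarrow> j \<in> H \<Longrightarrow> 0 \<le> b i j"
    and irr: "irreducible_on H b"
    and v: "\<And>i. i \<in> H \<Longrightarrow> 0 \<le> v i" and j: "j \<in> H" "0 < v j"
  shows "\<exists>k. \<forall>i\<in>H. 0 < (((\<lambda>v i. v i + (\<Sum>j\<in>H. b i j * v j)) ^^ k) v) i"
proof -
  define T where "T = (\<lambda>v i. v i + (\<Sum>j\<in>H. b i j * v j))"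
  have nn: "0 \<le> (T ^^ k) v i" if "i \<in> H" for k i
    using that
  proof (induction k arbitrary: i)
    case 0 then show ?case using v by simp
  next
    case (Suc k)
    have "0 \<le> (\<Sum>j\<in>H. b i j * (T ^^ k) v j)"
      by (rule sum_nonneg) (use Suc b in auto)
    then show ?case using Suc.IH[OF Suc.prems] by (simp add: T_def)
  qed
  have incr: "(T ^^ k) v i + b i i' * (T ^^ k) v i' \<le> (T ^^ Suc k) v i" if "i \<in> H" "i' \<in> H" for k i i'
  proof -
    have "b i i' * (T ^^ k) v i' \<le> (\<Sum>j\<in>H. b i j * (T ^^ k) v j)"
      by (rule member_le_sum) (use fin nn b that in auto)
    then show ?thesis by (simp add: T_def)
  qed
  have mono: "0 < (T ^^ m) v i" if "i \<in> H" "0 < (T ^^ k) v i" "k \<le> m" for i k m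
    using that(3,2)
  proof (induction m rule: dec_induct)
    case base then show ?case .
  next
    case (step m)
    have "(T ^^ m) v i + b i i * (T ^^ m) v i \<le> (T ^^ Suc m) v i"
      using that(1) by (rule incr) fact
    moreover have "0 \<le> b i i * (T ^^ m) v i" using b nn that(1) by simp
    ultimately show ?case using step by linarith
  qed
  have ex: "\<exists>k. 0 < (T ^^ k) v i" if "i \<in> H" for i
  proof -
    have "(i, j) \<in> {(x, y). x \<in> H \<and> y \<in> H \<and> 0 < b x y}\<^sup>*"
      using irr that j unfolding irreducible_on_def by blast
    then show ?thesis
    proof (induction rule: converse_rtrancl_induct)
      case base
      show ?case using j by (intro exI[of _ 0]) simp
    next
      case (step i i')
      then obtain k where "0 < (T ^^ k) v i'" by blast
      then have "0 < b i i' * (T ^^ k) v i'" using step by simp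
      moreover have "0 \<le> (T ^^ k) v i" using nn step by simp
      ultimately have "0 < (T ^^ Suc k) v i"
        using incr[of i i' k]
          step by auto
      then show ?case by blast
    qed
  qed
  then obtain K where K: "\<forall>i\<in>H. 0 < (T ^^ K i) v i" by metis
  have "\<forall>i\<in>H. 0 < (T ^^ Max (K ` H)) v i"
    using K mono fin by (metis Max_ge finite_imageI imageI)
  then show ?thesis unfolding T_def by blast
qed

text \<open>
  Perron's theorem. The vector \<open>z\<close> of \<open>nonneg_subeigenvector\<close> satisfies \<open>Bz \<ge> \<rho>z\<close>. If this were not an
  equality, a high power of \<open>I + B\<close>, which commutes with \<open>B\<close>, would turn \<open>z\<close> into a vector \<open>w\<close> with
  \<open>Bw > \<rho>w\<close> in every entry, and then the spectral radius would be larger than \<open>\<rho>\<close>.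
\<close>

theorem perron_eigenvector:
  assumes fin: "finite H" and ne: "H \<noteq> {}" and b: "\<And>i j. i \<in> H \<Longrightarrow> j \<in> H \<Longrightarrow> 0 \<le> b i j"
    and irr: "irreducible_on H b"
  shows "\<exists>u. (\<forall>i\<in>H. 0 < u i) \<and>
    (\<forall>i\<in>H. (\<Sum>j\<in>H. b i j * u j) = spectral_radius (index_mat H b) * u i)"
proof -
  let ?\<rho> = "spectral_radius (index_mat H b)"
  obtain z where z: "\<forall>i. 0 \<le> z i" "\<exists>i\<in>H. 0 < z i"
    "\<forall>i\<in>H. ?\<rho> * z i \<le> (\<Sum>j\<in>H. b i j * z j)"
    using nonneg_subeigenvector[where b = b, OF fin ne b] by metis
  obtain i0 where i0: "i0 \<in> H" "0 < z i0" using z by blast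
  have \<rho>0: "0 \<le> ?\<rho>" by (rule spectral_radius_nonneg[OF fin ne])
  define T where "T = (\<lambda>v i. v i + (\<Sum>j\<in>H. b i j * v j))"
  define B where "B = (\<lambda>v i. (\<Sum>j\<in>H. b i j * v j) - ?\<rho> * v i)"
  have comm: "(T ^^ k) (B v) = B ((T ^^ k) v)" for k v
  proof (induction k)
    case 0 show ?case by simp
  next
    case (Suc k)
    have "T (B w) = B (T w)" for w
      by (rule ext) (simp add: T_def B_def algebra_simps sum.distrib sum_subtractf sum_distrib_left)
    then show ?case using Suc by simp
  qed
  have nn: "z i \<le> (T ^^ k) z i \<and> 0 \<le> (T ^^ k) z i" if "i \<in> H" for k i
    using that
  proof (induction k arbitrary: i)
    case 0 then show ?case using z by simp
  next
    case (Suc k)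
    have "0 \<le> (\<Sum>j\<in>H. b i j * (T ^^ k) z j)"
      by (rule sum_nonneg) (use Suc b in auto)
    then show ?case using Suc.IH[OF Suc.prems] by (simp add: T_def)
  qed
  have eq: "B z i = 0" if iH: "i \<in> H" for i
  proof (rule ccontr)
    assume "B z i \<noteq> 0"
    then have "0 < B z i" using z iH by (force simp: B_def)
    then obtain k where k: "\<forall>i\<in>H. 0 < (T ^^ k) (B z) i"
      using irreducible_iterates_positive[where b = b and v = "B z", OF fin b irr _ iH] z(3)
      unfolding T_def B_def by auto
    define w where "w = (T ^^ k) z"
    define Y where "Y = (T ^^ k) (B z)"
    have Y: "Y i = (\<Sum>j\<in>H. b i j * w j) - ?\<rho> * w i" for i
      unfolding Y_def comm w_def by (simp add: B_def)
    \<comment> \<open>The summand 1 avoids a division by zero and only makes the gain \<open>e\<close> smaller.\<close>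
    define e where "e = Min ((\<lambda>i. Y i / (w i + 1)) ` H)"
    have w0: "0 \<le> w i" if "i \<in> H" for i using nn[OF that] by (simp add: w_def)
    have "e > 0" unfolding e_def using fin ne k w0
      by (subst Min_gr_iff) (auto simp: Y_def add_nonneg_pos)
    have "(?\<rho> + e) * w i \<le> (\<Sum>j\<in>H. b i j * w j)" if i: "i \<in> H" for i
    proof -
      have Yi: "0 < Y i" using k i by (simp add: Y_def)
      have "e \<le> Y i / (w i + 1)" unfolding e_def using fin i by simp
      then have "e * w i \<le> Y i / (w i + 1) * w i" using w0[OF i] by (rule mult_right_mono)
      also have "\<dots> \<le> Y i" using w0[OF i] Yi by (simp add: field_simps)
      finally show ?thesis unfolding Y by (simp add: algebra_simps)
    qed
    moreover have "0 < w i0" using nn[OF i0(1), of k] i0 by (simp add: w_def)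
    ultimately have "?\<rho> + e \<le> ?\<rho>"
      by (intro le_spectral_radius_of_subsolution[where b = b and w = w, OF fin b w0 i0(1)])
    with \<open>e > 0\<close> show False by simp
  qed
  have Tz: "(T ^^ k) z i = (1 + ?\<rho>) ^ k * z i" if "i \<in> H" for k i
    using that
  proof (induction k arbitrary: i)
    case 0 show ?case by simp
  next
    case (Suc k)
    have "(\<Sum>j\<in>H. b i j * (T ^^ k) z j) = (1 + ?\<rho>) ^ k * (\<Sum>j\<in>H. b i j * z j)"
      using Suc.IH by (simp add: sum_distrib_left mult_ac)
    also have "\<dots> = (1 + ?\<rho>) ^ k * (?\<rho> * z i)" using eq[OF Suc.prems] by (simp add: B_def)
    finally show ?case using Suc by (simp add: T_def algebra_simps)
  qed
  obtain k where k: "\<forall>i\<in>H. 0 < (T ^^ k) z i"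
    using irreducible_iterates_positive[where b = b and v = z, OF fin b irr _ i0] z
    unfolding T_def by auto
  have "0 < z i" if "i \<in> H" for i
  proof -
    have "0 < (1 + ?\<rho>) ^ k * z i" using k Tz[OF that] that by metis
    moreover have "0 \<le> z i" using z by simp
    ultimately show ?thesis by (metis less_eq_real_def mult_zero_right order_less_irrefl)
  qed
  then show ?thesis using eq by (intro exI[of _ z]) (auto simp: B_def)
qed

section \<open>Renewal equations on a directed graph\<close>

lemma finite_uniform_bound:
  fixes f :: "'a \<Rightarrow> 'b \<Rightarrow> real"
  assumes "finite X" "\<forall>j\<in>X. \<exists>K. \<forall>t\<in>S. f j t \<le> K * g t" "\<forall>t\<in>S. 0 \<le> g t"
  shows "\<exists>K\<ge>0. \<forall>j\<in>X. \<forall>t\<in>S. f j t \<le> K * g t"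
proof -
  obtain K where K: "\<forall>j\<in>X. \<forall>t\<in>S. f j t \<le> K j * g t" using assms(2) by metis
  have "f j t \<le> (\<Sum>j\<in>X. \<bar>K j\<bar>) * g t" if "j \<in> X" "t \<in> S" for j t
  proof -
    have "K j \<le> (\<Sum>j\<in>X. \<bar>K j\<bar>)"
      using member_le_sum[of j X "\<lambda>j. \<bar>K j\<bar>"] that(1) assms(1) by simp
    then have "K j * g t \<le> (\<Sum>j\<in>X. \<bar>K j\<bar>) * g t"
      using assms(3) that(2) by (simp add: mult_right_mono)
    then show ?thesis using K that by fastforce
  qed
  then show ?thesis by (intro exI[of _ "\<Sum>j\<in>X. \<bar>K j\<bar>"]) (auto intro: sum_nonneg)
qed

text \<open>
  The origin of the exponential is shifted to \<open>-a\<close> so that on the whole half-line a smaller rate gives a weaker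
  bound.
\<close>

lemma finite_uniform_exp_bound:
  fixes f :: "'a \<Rightarrow> real \<Rightarrow> real"
  assumes fin: "finite X"
    and ex: "\<forall>j\<in>X. \<exists>K \<kappa>. 0 < \<kappa> \<and> (\<forall>t\<ge>-a. f j t \<le> K * exp (- \<kappa> * (t + a)))"
  shows "\<exists>K\<ge>0. \<exists>\<kappa>>0. \<forall>j\<in>X. \<forall>t\<ge>-a. f j t \<le> K * exp (- \<kappa> * (t + a))"
proof -
  obtain K \<kappa> where K: "\<forall>j\<in>X. 0 < \<kappa> j \<and> (\<forall>t\<ge>-a. f j t \<le> K j * exp (- \<kappa> j * (t + a)))"
    using ex by metis
  define k where "k = Min (insert 1 (\<kappa> ` X))"
  have k: "0 < k" "\<And>j. j \<in> X \<Longrightarrow> k \<le> \<kappa> j"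
    unfolding k_def using fin K by auto
  have "\<exists>K. \<forall>t\<in>{-a..}. f j t \<le> K * exp (- k * (t + a))" if j: "j \<in> X" for j
  proof (intro exI ballI)
    fix t assume t: "t \<in> {-a..}"
    have "f j t \<le> K j * exp (- \<kappa> j * (t + a))" using K j t by simp
    also have "\<dots> \<le> \<bar>K j\<bar> * exp (- \<kappa> j * (t + a))" by (intro mult_right_mono) auto
    also have "\<dots> \<le> \<bar>K j\<bar> * exp (- k * (t + a))"
      using k(2)[OF j] t by (intro mult_left_mono) (auto intro: mult_right_mono)
    finally show "f j t \<le> \<bar>K j\<bar> * exp (- k * (t + a))" .
  qed
  then have "\<exists>K\<ge>0. \<forall>j\<in>X. \<forall>t\<in>{-a..}. f j t \<le> K * exp (- k * (t + a))"
    by (intro finite_uniform_bound[OF fin]) auto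
  then show ?thesis using k(1) by (auto simp: Ball_def)
qed

text \<open>
  A system of delay equations: the pairs with \<open>b i j > 0\<close> are the edges of a graph, and \<open>l i j\<close> is the delay along an
  edge. Because the delays are positive, the functions are determined by their values on \<open>[-lmax, 0)\<close>.
\<close>

locale renewal =
  fixes V :: "nat set" and b l :: "nat \<Rightarrow> nat \<Rightarrow> real" and f :: "nat \<Rightarrow> real \<Rightarrow> real"
    and lmin lmax D :: real
  assumes fin: "finite V"
    and b_nonneg: "\<And>i j. i \<in> V \<Longrightarrow> j \<in> V \<Longrightarrow> 0 \<le> b i j"
    and lmin: "0 < lmin" "lmin \<le> lmax"
    and l: "\<And>i j. i \<in> V \<Longrightarrow> j \<in> V \<Longrightarrow> 0 < b i j \<Longrightarrow> lmin \<le> l i j \<and> l i j \<le> lmax"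
    and recurrence: "\<And>i t. i \<in> V \<Longrightarrow> 0 \<le> t \<Longrightarrow> f i t = (\<Sum>j\<in>V. b i j * f j (t - l i j))"
    and init: "\<And>i t. i \<in> V \<Longrightarrow> -lmax \<le> t \<Longrightarrow> t < 0 \<Longrightarrow> 1 \<le> f i t \<and> f i t \<le> D"
    and radius: "spectral_radius (index_mat V b) = 1"
begin

definition "rad H = spectral_radius (index_mat H b)"
definition "E = {(i, j). i \<in> V \<and> j \<in> V \<and> 0 < b i j}"
definition "scc i = {j \<in> V. (i, j) \<in> E\<^sup>* \<and> (j, i) \<in> E\<^sup>*}"
definition "critical = {H. H \<in> scc ` V \<and> rad H = 1}"
definition "walk \<gamma> \<longleftrightarrow> \<gamma> \<noteq> [] \<and> set \<gamma> \<subseteq> V \<and> successively (\<lambda>i j. (i, j) \<in> E) \<gamma>"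
definition "crit_count \<gamma> = card {H \<in> critical. \<exists>x\<in>set \<gamma>. x \<in> H}"

lemma scc_subset: "scc i \<subseteq> V" by (auto simp: scc_def)
lemma finite_scc: "finite (scc i)" by (rule finite_subset[OF scc_subset fin])
lemma self_in_scc: "i \<in> V \<Longrightarrow> i \<in> scc i" by (auto simp: scc_def)
lemma scc_eq: "j \<in> scc i \<Longrightarrow> scc j = scc i"
  by (auto simp: scc_def intro: rtrancl_trans)
lemma finite_critical: "finite critical" using fin by (auto simp: critical_def)

lemma mem_critical_eq_scc: "H \<in> critical \<Longrightarrow> x \<in> H \<Longrightarrow> H = scc x"
  using scc_eq by (auto simp: critical_def)

lemma E_in_V: "(i, j) \<in> E\<^sup>* \<Longrightarrow> i \<in> V \<Longrightarrow> j \<in> V"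
  by (induction rule: rtrancl_induct) (auto simp: E_def)

text \<open>
  A walk between two vertices of a component never leaves the component.
\<close>

lemma irreducible_scc:
  assumes "i \<in> V"
  shows "irreducible_on (scc i) b"
  unfolding irreducible_on_def
proof (intro ballI)
  fix x y assume x: "x \<in> scc i" and y: "y \<in> scc i"
  then have "(x, y) \<in> E\<^sup>*" by (auto simp: scc_def intro: rtrancl_trans)
  then show "(x, y) \<in> {(x, y). x \<in> scc i \<and> y \<in> scc i \<and> 0 < b x y}\<^sup>*"
    using x
  proof (induction rule: converse_rtrancl_induct)
    case base then show ?case by simp
  next
    case (step x z)
    have "(z, i) \<in> E\<^sup>*" using step(2) y by (auto simp: scc_def intro: rtrancl_trans)
    moreover have "(i, z) \<in> E\<^sup>*"
      using step(1,4) by (auto simp: scc_def intro: rtrancl_into_rtrancl)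
    ultimately have "z \<in> scc i" using step(1) by (auto simp: scc_def E_def)
    with step show ?case
      by (intro converse_rtrancl_into_rtrancl[of x z]) (auto simp: E_def)
  qed
qed

lemma perron_scc:
  assumes "i \<in> V"
  shows "\<exists>u. (\<forall>k\<in>scc i. 0 < u k) \<and> (\<forall>k\<in>scc i. (\<Sum>j\<in>scc i. b k j * u j) = rad (scc i) * u k)"
  unfolding rad_def
proof (rule perron_eigenvector)
  show "finite (scc i)" by (rule finite_scc)
  show "scc i \<noteq> {}" using self_in_scc[OF assms] by auto
  show "irreducible_on (scc i) b" by (rule irreducible_scc[OF assms])
  show "0 \<le> b x y" if "x \<in> scc i" "y \<in> scc i" for x y
    using that scc_subset b_nonneg by blast
qed

lemma rad_nonneg: "i \<in> V \<Longrightarrow> 0 \<le> rad (scc i)"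
  unfolding rad_def using self_in_scc by (intro spectral_radius_nonneg finite_scc) auto

text \<open>
  The Perron eigenvector of a component, extended by zero, is a subsolution for the whole matrix.
\<close>

lemma rad_scc_le_1:
  assumes i: "i \<in> V"
  shows "rad (scc i) \<le> 1"
proof -
  obtain u where u: "\<forall>k\<in>scc i. 0 < u k"
    "\<forall>k\<in>scc i. (\<Sum>j\<in>scc i. b k j * u j) = rad (scc i) * u k"
    using perron_scc[OF i] by blast
  define w where "w = (\<lambda>j. if j \<in> scc i then u j else 0)"
  have w: "0 \<le> w k" for k using u by (auto simp: w_def intro: less_imp_le)
  have "rad (scc i) * w k \<le> (\<Sum>j\<in>V. b k j * w j)" if k: "k \<in> V" for k
  proof (cases "k \<in> scc i")
    case True
    have "(\<Sum>j\<in>V. b k j * w j) = (\<Sum>j\<in>scc i. b k j * w j)"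
      by (rule sum.mono_neutral_right) (use fin scc_subset in \<open>auto simp: w_def\<close>)
    also have "\<dots> = (\<Sum>j\<in>scc i. b k j * u j)" by (simp add: w_def)
    finally show ?thesis using u(2) True by (simp add: w_def)
  next
    case False
    have "0 \<le> (\<Sum>j\<in>V. b k j * w j)" by (rule sum_nonneg) (use b_nonneg k w in auto)
    then show ?thesis using False by (simp add: w_def)
  qed
  moreover have "0 < w i" using u self_in_scc[OF i] by (simp add: w_def)
  ultimately have "rad (scc i) \<le> spectral_radius (index_mat V b)"
    by (intro le_spectral_radius_of_subsolution[where b = b and w = w, OF fin b_nonneg w i])
  then show ?thesis using radius by simp
qed

text \<open>
  The values at time \<open>t\<close> are bounded below by values at times at most \<open>t - lmin\<close>, so nonnegativity
  spreads in time steps of length \<open>lmin\<close>.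
\<close>

lemma maximum_principle:
  assumes H: "H \<subseteq> V"
    and step: "\<And>i t. i \<in> H \<Longrightarrow> 0 \<le> t \<Longrightarrow> (\<Sum>j\<in>H. b i j * h j (t - l i j)) \<le> h i t"
    and base: "\<And>i t. i \<in> H \<Longrightarrow> -lmax \<le> t \<Longrightarrow> t < 0 \<Longrightarrow> 0 \<le> h i t"
    and i: "i \<in> H" and t: "-lmax \<le> t"
  shows "0 \<le> h i t"
proof -
  have "\<forall>i\<in>H. \<forall>t. -lmax \<le> t \<longrightarrow> t < real n * lmin \<longrightarrow> 0 \<le> h i t" for n
  proof (induction n)
    case 0 then show ?case using base by auto
  next
    case (Suc n)
    show ?case
    proof (intro ballI allI impI)
      fix i t assume i: "i \<in> H" and t: "-lmax \<le> t" "t < real (Suc n) * lmin"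
      show "0 \<le> h i t"
      proof (cases "t < 0")
        case True then show ?thesis using base i t by simp
      next
        case False
        have "0 \<le> b i j * h j (t - l i j)" if j: "j \<in> H" for j
        proof (cases "b i j = 0")
          case False
          have ij: "i \<in> V" "j \<in> V" using i j H by auto
          then have "0 < b i j" using False b_nonneg[of i j] by simp
          then have "0 \<le> h j (t - l i j)"
            using l[OF ij] Suc j t \<open>\<not> t < 0\<close> by (auto simp: algebra_simps)
          then show ?thesis using b_nonneg[OF ij] by simp
        qed simp
        then have "0 \<le> (\<Sum>j\<in>H. b i j * h j (t - l i j))" by (rule sum_nonneg)
        also have "\<dots> \<le> h i t" using step i False by simp
        finally show ?thesis .
      qed
    qed
  qed
  moreover obtain n where "t / lmin < real n" using reals_Archimedean2 by blast
  ultimately show ?thesis using i t lmin by (auto simp: pos_divide_less_eq)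
qed

lemma f_nonneg:
  assumes "i \<in> V" "-lmax \<le> t"
  shows "0 \<le> f i t"
proof (rule maximum_principle[where H = V and h = f])
  show "(\<Sum>j\<in>V. b i j * f j (t - l i j)) \<le> f i t" if "i \<in> V" "0 \<le> t" for i t
    using recurrence[OF that] by simp
  show "0 \<le> f i t" if "i \<in> V" "-lmax \<le> t" "t < 0" for i t
    using init[OF that] by simp
qed (use assms in auto)

lemma recurrence_term_nonneg:
  assumes "i \<in> V" "j \<in> V" "0 \<le> t"
  shows "0 \<le> b i j * f j (t - l i j)"
proof (cases "b i j = 0")
  case False
  then have "0 < b i j" using b_nonneg[of i j] assms by simp
  moreover have "l i j \<le> lmax" using l[of i j] calculation assms by simp
  ultimately show ?thesis using f_nonneg[of j "t - l i j"] assms by simp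
qed simp

text \<open>
  From inside a set \<open>H\<close> of vertices, the edges that leave \<open>H\<close> act as a source term of the renewal equation.
\<close>

definition "exit_sum H k t = (\<Sum>j\<in>V - H. b k j * f j (t - l k j))"

lemma recurrence_split:
  assumes "H \<subseteq> V" "k \<in> H" "0 \<le> t"
  shows "f k t = (\<Sum>j\<in>H. b k j * f j (t - l k j)) + exit_sum H k t"
  using recurrence[of k t] assms fin unfolding exit_sum_def
  by (simp add: sum.subset_diff[of H V] subset_iff)

lemma solution_le_supersolution:
  assumes H: "H \<subseteq> V"
    and step: "\<And>k t. k \<in> H \<Longrightarrow> 0 \<le> t \<Longrightarrow>
        (\<Sum>j\<in>H. b k j * g j (t - l k j)) + exit_sum H k t \<le> g k t"
    and base: "\<And>k t. k \<in> H \<Longrightarrow> -lmax \<le> t \<Longrightarrow> t < 0 \<Longrightarrow> D \<le> g k t"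
    and k: "k \<in> H" and t: "-lmax \<le> t"
  shows "f k t \<le> g k t"
proof -
  have "0 \<le> g k t - f k t"
  proof (rule maximum_principle[where H = H and h = "\<lambda>k t. g k t - f k t"])
    fix i t assume i: "i \<in> H" "0 \<le> (t::real)"
    show "(\<Sum>j\<in>H. b i j * (g j (t - l i j) - f j (t - l i j))) \<le> g i t - f i t"
      using step[OF i] recurrence_split[OF H i] by (simp add: right_diff_distrib sum_subtractf)
  next
    fix i t assume i: "i \<in> H" "-lmax \<le> t" "t < (0::real)"
    show "0 \<le> g i t - f i t" using base[OF i] init[of i t] i H by force
  qed (use assms in auto)
  then show ?thesis by simp
qed

lemma subsolution_le_solution:
  assumes H: "H \<subseteq> V"
    and step: "\<And>k t. k \<in> H \<Longrightarrow> 0 \<le> t \<Longrightarrow>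
        g k t \<le> (\<Sum>j\<in>H. b k j * g j (t - l k j)) + exit_sum H k t"
    and base: "\<And>k t. k \<in> H \<Longrightarrow> -lmax \<le> t \<Longrightarrow> t < 0 \<Longrightarrow> g k t \<le> 1"
    and k: "k \<in> H" and t: "-lmax \<le> t"
  shows "g k t \<le> f k t"
proof -
  have "0 \<le> f k t - g k t"
  proof (rule maximum_principle[where H = H and h = "\<lambda>k t. f k t - g k t"])
    fix i t assume i: "i \<in> H" "0 \<le> (t::real)"
    show "(\<Sum>j\<in>H. b i j * (f j (t - l i j) - g j (t - l i j))) \<le> f i t - g i t"
      using step[OF i] recurrence_split[OF H i] by (simp add: right_diff_distrib sum_subtractf)
  next
    fix i t assume i: "i \<in> H" "-lmax \<le> t" "t < (0::real)"
    show "0 \<le> f i t - g i t" using base[OF i] init[of i t] i H by force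
  qed (use assms in auto)
  then show ?thesis by simp
qed

lemma exit_sum_bound:
  assumes H: "H \<subseteq> V" and K: "0 \<le> K"
    and bd: "\<And>k j t. k \<in> H \<Longrightarrow> j \<in> V - H \<Longrightarrow> 0 < b k j \<Longrightarrow> 0 \<le> t \<Longrightarrow> f j (t - l k j) \<le> K * g t"
    and g: "\<And>t. 0 \<le> t \<Longrightarrow> 0 \<le> g t"
  shows "\<exists>A\<ge>0. \<forall>k\<in>H. \<forall>t\<ge>0. exit_sum H k t \<le> A * g t"
proof -
  have "\<exists>A\<ge>0. \<forall>k\<in>H. \<forall>t\<in>{0..}. exit_sum H k t \<le> A * g t"
  proof (rule finite_uniform_bound)
    show "finite H" using H fin by (rule finite_subset)
    show "\<forall>t\<in>{0..}. 0 \<le> g t" using g by simp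
    show "\<forall>k\<in>H. \<exists>A. \<forall>t\<in>{0..}. exit_sum H k t \<le> A * g t"
    proof (intro ballI exI)
      fix k t assume k: "k \<in> H" and t: "t \<in> {0::real..}"
      have "exit_sum H k t \<le> (\<Sum>j\<in>V - H. b k j * (K * g t))"
        unfolding exit_sum_def
      proof (rule sum_mono)
        fix j assume j: "j \<in> V - H"
        show "b k j * f j (t - l k j) \<le> b k j * (K * g t)"
          using bd[OF k j] t b_nonneg[of k j] j k H
          by (cases "b k j = 0") (auto intro!: mult_left_mono)
      qed
      also have "\<dots> = ((\<Sum>j\<in>V - H. b k j) * K) * g t" by (simp add: sum_distrib_right mult.assoc)
      finally show "exit_sum H k t \<le> ((\<Sum>j\<in>V - H. b k j) * K) * g t" .
    qed
  qed
  then show ?thesis by (auto simp: Ball_def)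
qed


lemma weighted_sum_le:
  assumes H: "H \<subseteq> V" and k: "k \<in> H" and eig: "(\<Sum>j\<in>H. b k j * u j) = \<rho> * u k"
    and X: "\<And>j. j \<in> H \<Longrightarrow> 0 < b k j \<Longrightarrow> X j \<le> u j * m"
  shows "(\<Sum>j\<in>H. b k j * X j) \<le> u k * (\<rho> * m)"
proof -
  have "(\<Sum>j\<in>H. b k j * X j) \<le> (\<Sum>j\<in>H. b k j * (u j * m))"
  proof (rule sum_mono)
    fix j assume j: "j \<in> H"
    show "b k j * X j \<le> b k j * (u j * m)"
    proof (cases "b k j = 0")
      case False
      have "0 \<le> b k j" using b_nonneg j k H by blast
      then show ?thesis using X[OF j] False by (intro mult_left_mono) auto
    qed simp
  qed
  also have "\<dots> = (\<Sum>j\<in>H. b k j * u j) * m" by (simp add: sum_distrib_right mult.assoc)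
  finally show ?thesis unfolding eig by (simp add: mult_ac)
qed

lemma positive_bounds:
  assumes "H \<subseteq> V" "\<forall>k\<in>H. 0 < u k"
  shows "\<exists>m>0. \<exists>M. \<forall>k\<in>H. m \<le> u k \<and> u k \<le> (M::real)"
proof -
  have fH: "finite H" using assms(1) fin by (rule finite_subset)
  show ?thesis
    by (rule exI[of _ "Min (insert 1 (u ` H))"], intro conjI exI[of _ "Max (insert 1 (u ` H))"])
      (use fH assms(2) in auto)
qed

section \<open>Upper bounds for renewal solutions\<close>

text \<open>
  In a component with \<open>\<rho> < 1\<close> the growth rate \<open>G\<close> of the source is inherited. The supersolution is a large multiple of
  \<open>u\<^sub>k G(t)\<close>: the component loses the proportion \<open>1 - \<rho>M > 0\<close> of it, which absorbs the source.
\<close>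

lemma subcritical_bound:
  assumes H: "H \<subseteq> V" and u: "\<forall>k\<in>H. 0 < u k" and eig: "\<forall>k\<in>H. (\<Sum>j\<in>H. b k j * u j) = \<rho> * u k"
    and \<rho>: "0 \<le> \<rho>" "\<rho> * M < 1"
    and G0: "\<And>t. -lmax \<le> t \<Longrightarrow> 0 \<le> G t"
    and GM: "\<And>t s. 0 \<le> t \<Longrightarrow> lmin \<le> s \<Longrightarrow> s \<le> lmax \<Longrightarrow> G (t - s) \<le> M * G t"
    and Ginit: "0 < m" "\<And>t. -lmax \<le> t \<Longrightarrow> t < 0 \<Longrightarrow> m \<le> G t"
    and A: "0 \<le> A" "\<And>k t. k \<in> H \<Longrightarrow> 0 \<le> t \<Longrightarrow> exit_sum H k t \<le> A * G t"
  shows "\<exists>K. \<forall>k\<in>H. \<forall>t\<ge>-lmax. f k t \<le> K * G t"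
proof -
  obtain um U where um: "0 < um" "\<And>k. k \<in> H \<Longrightarrow> um \<le> u k" "\<And>k. k \<in> H \<Longrightarrow> u k \<le> U"
    using positive_bounds[OF H u] by blast
  \<comment> \<open>\<open>K1\<close> absorbs the source, \<open>K2\<close> dominates the initial values.\<close>
  define K1 K2 where "K1 = A / ((1 - \<rho> * M) * um)" and "K2 = \<bar>D\<bar> / (m * um)"
  define K where "K = K1 + K2"
  have K12: "0 \<le> K1" "0 \<le> K2" unfolding K1_def K2_def using \<rho> um Ginit A by auto
  have "f k t \<le> u k * (K * G t)" if "k \<in> H" "-lmax \<le> t" for k t
  proof (rule solution_le_supersolution[OF H _ _ that])
    fix k t assume k: "k \<in> H" and t: "0 \<le> (t::real)"
    have Gt: "0 \<le> G t" using G0 t lmin by simp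
    have "(\<Sum>j\<in>H. b k j * (u j * (K * G (t - l k j)))) \<le> u k * (\<rho> * (K * (M * G t)))"
    proof (rule weighted_sum_le[OF H k])
      show "(\<Sum>j\<in>H. b k j * u j) = \<rho> * u k" using eig k by blast
      fix j assume j: "j \<in> H" "0 < b k j"
      then have "G (t - l k j) \<le> M * G t" using l[of k j] GM t H k by blast
      then show "u j * (K * G (t - l k j)) \<le> u j * (K * (M * G t))"
        using K12 u j by (intro mult_left_mono) (auto simp: K_def less_imp_le)
    qed
    moreover have "A * G t \<le> u k * (K * (1 - \<rho> * M)) * G t"
    proof -
      have "A = um * (K1 * (1 - \<rho> * M))" using um \<rho> by (simp add: K1_def)
      also have "\<dots> \<le> u k * (K * (1 - \<rho> * M))"
        using um(1) um(2)[OF k] K12 \<rho> by (intro mult_mono mult_right_mono) (auto simp: K_def)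
      finally show ?thesis using Gt by (rule mult_right_mono)
    qed
    ultimately show "(\<Sum>j\<in>H. b k j * (u j * (K * G (t - l k j)))) + exit_sum H k t \<le> u k * (K * G t)"
      using A(2)[OF k t] by (simp add: algebra_simps)
  next
    fix k t assume k: "k \<in> H" and t: "-lmax \<le> t" "t < (0::real)"
    have "\<bar>D\<bar> = um * (K2 * m)" using um Ginit by (simp add: K2_def)
    also have "\<dots> \<le> u k * (K * G t)"
      using um(1) um(2)[OF k] K12 Ginit(1) Ginit(2)[OF t] by (intro mult_mono) (auto simp: K_def)
    finally show "D \<le> u k * (K * G t)" by simp
  qed
  moreover have "u k * (K * G t) \<le> (U * K) * G t" if "k \<in> H" "-lmax \<le> t" for k t
    using um(3)[OF that(1)] K12 G0[OF that(2)]
    by (simp only: mult.assoc) (auto intro!: mult_right_mono simp: K_def)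
  ultimately show ?thesis by (meson order_trans)
qed

text \<open>
  A critical component with an exponentially decaying source has bounded solutions. A multiple of the Perron
  eigenvector solves the equation without source; subtracting a multiple of the decaying exponential gains
  the factor \<open>exp (\<kappa> * l) - 1 \<ge> exp (\<kappa> * lmin) - 1 > 0\<close> along each edge, which pays for the source.
\<close>

lemma critical_bound_of_exp_exits:
  assumes H: "H \<subseteq> V" and u: "\<forall>k\<in>H. 0 < u k" and eig: "\<forall>k\<in>H. (\<Sum>j\<in>H. b k j * u j) = 1 * u k"
    and \<kappa>: "0 < \<kappa>"
    and A: "0 \<le> A" "\<And>k t. k \<in> H \<Longrightarrow> 0 \<le> t \<Longrightarrow> exit_sum H k t \<le> A * exp (- \<kappa> * (t + lmax))"
  shows "\<exists>K. \<forall>k\<in>H. \<forall>t\<ge>-lmax. f k t \<le> K"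
proof -
  obtain um U where um: "0 < um" "\<And>k. k \<in> H \<Longrightarrow> um \<le> u k" "\<And>k. k \<in> H \<Longrightarrow> u k \<le> U"
    using positive_bounds[OF H u] by blast
  define e where "e = exp (\<kappa> * lmin) - 1"
  have e: "0 < e" using \<kappa> lmin by (simp add: e_def)
  define A' K2 where "A' = A / (e * um)" and "K2 = \<bar>D\<bar> / um"
  define K where "K = A' + K2"
  have nn: "0 \<le> A'" "0 \<le> K2" unfolding A'_def K2_def using um e A by auto
  define w where "w t = exp (- \<kappa> * (t + lmax))" for t
  have w0: "0 \<le> w t" for t by (simp add: w_def)
  have "f k t \<le> u k * (K - A' * w t)" if "k \<in> H" "-lmax \<le> t" for k t
  proof (rule solution_le_supersolution[OF H _ _ that])
    fix k t assume k: "k \<in> H" and t: "0 \<le> (t::real)"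
    have "(\<Sum>j\<in>H. b k j * (u j * (K - A' * w (t - l k j)))) \<le> u k * (1 * (K - A' * ((e + 1) * w t)))"
    proof (rule weighted_sum_le[OF H k])
      show "(\<Sum>j\<in>H. b k j * u j) = 1 * u k" using eig k by blast
      fix j assume j: "j \<in> H" "0 < b k j"
      then have "lmin \<le> l k j" using l[of k j] H k by blast
      have "(e + 1) * w t = exp (\<kappa> * lmin - \<kappa> * (t + lmax))"
        by (simp add: e_def w_def exp_add[symmetric])
      also have "\<dots> \<le> w (t - l k j)"
        using \<open>lmin \<le> l k j\<close> \<kappa> by (simp add: w_def algebra_simps)
      finally show "u j * (K - A' * w (t - l k j)) \<le> u j * (K - A' * ((e + 1) * w t))"
        using nn u j by (intro mult_left_mono diff_left_mono) (auto simp: less_imp_le)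
    qed
    moreover have "A * w t \<le> u k * (A' * e) * w t"
    proof -
      have "A = um * (A' * e)" using um e by (simp add: A'_def)
      also have "\<dots> \<le> u k * (A' * e)"
        using um(1) um(2)[OF k] nn e by (intro mult_right_mono) auto
      finally show ?thesis using w0 by (rule mult_right_mono)
    qed
    ultimately show "(\<Sum>j\<in>H. b k j * (u j * (K - A' * w (t - l k j)))) + exit_sum H k t \<le> u k * (K - A' * w t)"
    proof -
      have "u k * (1 * (K - A' * ((e + 1) * w t))) + u k * (A' * e) * w t = u k * (K - A' * w t)"
        by (simp add: algebra_simps)
      moreover have "exit_sum H k t \<le> A * w t" using A(2)[OF k t] by (simp add: w_def)
      ultimately show ?thesis
        using \<open>(\<Sum>j\<in>H. b k j * (u j * (K - A' * w (t - l k j)))) \<le> u k * (1 * (K - A' * ((e + 1) * w t)))\<close>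
          \<open>A * w t \<le> u k * (A' * e) * w t\<close> by linarith
    qed
  next
    fix k t assume k: "k \<in> H" and t: "-lmax \<le> t" "t < (0::real)"
    have "A' * w t \<le> A' * 1" using nn \<kappa> t by (intro mult_left_mono) (auto simp: w_def)
    have "\<bar>D\<bar> = um * K2" using um by (simp add: K2_def)
    also have "\<dots> \<le> u k * (K - A' * w t)"
      using um(1) um(2)[OF k] nn \<open>A' * w t \<le> A' * 1\<close> by (intro mult_mono) (auto simp: K_def)
    finally show "D \<le> u k * (K - A' * w t)" by simp
  qed
  moreover have "u k * (K - A' * w t) \<le> U * K" if "k \<in> H" "-lmax \<le> t" for k t
  proof -
    have "u k * (K - A' * w t) \<le> u k * K" using u that nn w0[of t] by (intro mult_left_mono) (auto simp: less_imp_le)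
    also have "\<dots> \<le> U * K" using um(3)[OF that(1)] nn by (intro mult_right_mono) (auto simp: K_def)
    finally show ?thesis .
  qed
  ultimately show ?thesis by (meson order_trans)
qed

text \<open>
  With a source of order \<open>x\<^sup>d\<close>, where \<open>x = t + lmax + 1\<close>, the function \<open>u\<^sub>k x\<^bsup>d+1\<^esup>\<close> works: replacing \<open>x\<close> by \<open>x - l\<close> with
  \<open>l \<ge> lmin\<close> loses at least \<open>lmin x\<^sup>d\<close>. The shift keeps \<open>x - l \<ge> 1\<close> at all times that occur.
\<close>

lemma critical_bound_of_poly_exits:
  assumes H: "H \<subseteq> V" and u: "\<forall>k\<in>H. 0 < u k" and eig: "\<forall>k\<in>H. (\<Sum>j\<in>H. b k j * u j) = 1 * u k"
    and A: "0 \<le> A" "\<And>k t. k \<in> H \<Longrightarrow> 0 \<le> t \<Longrightarrow> exit_sum H k t \<le> A * (t + lmax + 1) ^ d"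
  shows "\<exists>K. \<forall>k\<in>H. \<forall>t\<ge>-lmax. f k t \<le> K * (t + lmax + 1) ^ Suc d"
proof -
  obtain um U where um: "0 < um" "\<And>k. k \<in> H \<Longrightarrow> um \<le> u k" "\<And>k. k \<in> H \<Longrightarrow> u k \<le> U"
    using positive_bounds[OF H u] by blast
  define K1 K2 where "K1 = A / (lmin * um)" and "K2 = \<bar>D\<bar> / um"
  define K where "K = K1 + K2"
  have nn: "0 \<le> K1" "0 \<le> K2" unfolding K1_def K2_def using um lmin A by auto
  have "f k t \<le> u k * (K * (t + lmax + 1) ^ Suc d)" if "k \<in> H" "-lmax \<le> t" for k t
  proof (rule solution_le_supersolution[OF H _ _ that])
    fix k t assume k: "k \<in> H" and t: "0 \<le> (t::real)"
    define x where "x = t + lmax + 1"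
    have x: "x \<ge> lmax + 1" using t by (simp add: x_def)
    have "(\<Sum>j\<in>H. b k j * (u j * (K * (t - l k j + lmax + 1) ^ Suc d))) \<le> u k * (1 * (K * ((x - lmin) * x ^ d)))"
    proof (rule weighted_sum_le[OF H k])
      show "(\<Sum>j\<in>H. b k j * u j) = 1 * u k" using eig k by blast
      fix j assume j: "j \<in> H" "0 < b k j"
      then have lb: "lmin \<le> l k j" "l k j \<le> lmax" using l[of k j] H k by blast+
      have "(x - l k j) ^ Suc d \<le> (x - lmin) * x ^ d"
        unfolding power_Suc using lb x lmin by (intro mult_mono power_mono) auto
      moreover have "t - l k j + lmax + 1 = x - l k j" by (simp add: x_def)
      ultimately show "u j * (K * (t - l k j + lmax + 1) ^ Suc d) \<le> u j * (K * ((x - lmin) * x ^ d))"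
        using nn u j by (simp only:) (intro mult_left_mono; auto simp: less_imp_le K_def)
    qed
    moreover have "A * x ^ d \<le> u k * (K * lmin) * x ^ d"
    proof -
      have "A = um * (K1 * lmin)" using um lmin by (simp add: K1_def)
      also have "\<dots> \<le> u k * (K * lmin)"
        using um(1) um(2)[OF k] nn lmin by (intro mult_mono mult_right_mono) (auto simp: K_def)
      finally show ?thesis using x lmin by (intro mult_right_mono) auto
    qed
    ultimately show "(\<Sum>j\<in>H. b k j * (u j * (K * (t - l k j + lmax + 1) ^ Suc d))) + exit_sum H k t
        \<le> u k * (K * (t + lmax + 1) ^ Suc d)"
      using A(2)[OF k t] unfolding x_def[symmetric] by (simp add: algebra_simps)
  next
    fix k t assume k: "k \<in> H" and t: "-lmax \<le> t" "t < (0::real)"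
    have "\<bar>D\<bar> = um * (K2 * 1)" using um by (simp add: K2_def)
    also have "\<dots> \<le> u k * (K * (t + lmax + 1) ^ Suc d)"
      using um(1) um(2)[OF k] nn t by (intro mult_mono one_le_power) (auto simp: K_def)
    finally show "D \<le> u k * (K * (t + lmax + 1) ^ Suc d)" by simp
  qed
  moreover have "u k * (K * (t + lmax + 1) ^ Suc d) \<le> (U * K) * (t + lmax + 1) ^ Suc d"
    if "k \<in> H" "-lmax \<le> t" for k t
    unfolding mult.assoc[of U]
    using um(3)[OF that(1)] nn that by (intro mult_right_mono) (auto simp: K_def)
  ultimately show ?thesis by (meson order_trans)
qed

lemma rtrancl_walk:
  assumes "(i, k) \<in> E\<^sup>*" "i \<in> V"
  shows "\<exists>\<delta>. walk \<delta> \<and> hd \<delta> = i \<and> last \<delta> = k"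
  using assms
proof (induction rule: rtrancl_induct)
  case base
  then show ?case by (intro exI[of _ "[i]"]) (simp add: walk_def)
next
  case (step y z)
  then obtain \<delta> where "walk \<delta>" "hd \<delta> = i" "last \<delta> = y" by blast
  moreover have "z \<in> V" using step by (auto simp: E_def)
  ultimately show ?case using step(2)
    by (intro exI[of _ "\<delta> @ [z]"]) (auto simp: walk_def successively_append_iff)
qed

lemma walk_append:
  assumes "walk \<delta>" "walk \<gamma>" "(last \<delta>, hd \<gamma>) \<in> E"
  shows "walk (\<delta> @ \<gamma>)"
  using assms by (auto simp: walk_def successively_append_iff)

lemma walk_reachable:
  assumes "walk \<gamma>" "x \<in> set \<gamma>"
  shows "(hd \<gamma>, x) \<in> E\<^sup>*"
  using assms
proof (induction \<gamma>)
  case (Cons i \<gamma>)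
  show ?case
  proof (cases "x = i \<or> \<gamma> = []")
    case True then show ?thesis using Cons by auto
  next
    case False
    then obtain j \<gamma>' where g: "\<gamma> = j # \<gamma>'" by (cases \<gamma>) auto
    with False Cons have "(j, x) \<in> E\<^sup>*" "(i, j) \<in> E" by (auto simp: walk_def)
    then show ?thesis by simp
  qed
qed simp

lemma crit_count_mono: "set \<gamma> \<subseteq> set \<gamma>' \<Longrightarrow> crit_count \<gamma> \<le> crit_count \<gamma>'"
  unfolding crit_count_def using finite_critical by (intro card_mono) auto

text \<open>
  A walk starting at a vertex \<open>j\<close> outside the component of \<open>i\<close>, to which an edge leads from this component,
  never returns to the component. Prefixing a walk from \<open>i\<close> to that edge therefore adds the component of \<open>i\<close>,
  if it is critical, to the critical ones that are met.
\<close>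

lemma exit_walk_count:
  assumes i: "i \<in> V" and k: "k \<in> scc i" and j: "j \<in> V - scc i" "0 < b k j"
    and \<gamma>: "walk \<gamma>" "hd \<gamma> = j"
  shows "\<exists>\<gamma>'. walk \<gamma>' \<and> hd \<gamma>' = i \<and> crit_count \<gamma> \<le> crit_count \<gamma>' \<and>
    (rad (scc i) = 1 \<longrightarrow> Suc (crit_count \<gamma>) \<le> crit_count \<gamma>')"
proof -
  have ik: "(i, k) \<in> E\<^sup>*" "(k, i) \<in> E\<^sup>*" using k by (auto simp: scc_def)
  have kj: "(k, j) \<in> E" using k j scc_subset by (auto simp: E_def)
  obtain \<delta> where \<delta>: "walk \<delta>" "hd \<delta> = i" "last \<delta> = k" using rtrancl_walk[OF ik(1) i] by blast
  have w: "walk (\<delta> @ \<gamma>)" using \<delta> \<gamma> kj by (intro walk_append) auto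
  have h: "hd (\<delta> @ \<gamma>) = i" using \<delta> by (auto simp: walk_def)
  have "Suc (crit_count \<gamma>) \<le> crit_count (\<delta> @ \<gamma>)" if r: "rad (scc i) = 1"
  proof -
    have "x \<notin> scc i" if "x \<in> set \<gamma>" for x
    proof
      assume "x \<in> scc i"
      then have "(x, i) \<in> E\<^sup>*" by (simp add: scc_def)
      then have "(j, i) \<in> E\<^sup>*" using walk_reachable[OF \<gamma>(1) that] \<gamma>(2) by simp
      moreover have "(i, j) \<in> E\<^sup>*" using ik(1) kj by simp
      ultimately show False using j by (simp add: scc_def)
    qed
    then have "scc i \<notin> {H \<in> critical. \<exists>x\<in>set \<gamma>. x \<in> H}" by blast
    then have "Suc (crit_count \<gamma>) = card (insert (scc i) {H \<in> critical. \<exists>x\<in>set \<gamma>. x \<in> H})"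
      unfolding crit_count_def using finite_critical by simp
    also have "\<dots> \<le> crit_count (\<delta> @ \<gamma>)"
      unfolding crit_count_def
    proof (rule card_mono)
      show "finite {H \<in> critical. \<exists>x\<in>set (\<delta> @ \<gamma>). x \<in> H}" using finite_critical by simp
      have "scc i \<in> critical" using r i by (simp add: critical_def)
      moreover have "k \<in> set \<delta>" using \<delta> by (auto simp: walk_def)
      ultimately show "insert (scc i) {H \<in> critical. \<exists>x\<in>set \<gamma>. x \<in> H} \<subseteq> {H \<in> critical. \<exists>x\<in>set (\<delta> @ \<gamma>). x \<in> H}"
        using k by auto
    qed
    finally show ?thesis .
  qed
  then show ?thesis using w h crit_count_mono[of \<gamma> "\<delta> @ \<gamma>"] by (intro exI[of _ "\<delta> @ \<gamma>"]) auto
qed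

text \<open>
  The number of reachable vertices decreases strictly when a component is left; it is the induction measure for the
  upper bounds.
\<close>

definition "reach i = {j. (i, j) \<in> E\<^sup>*}"

lemma reach_exit:
  assumes i: "i \<in> V" and k: "k \<in> scc i" and j: "j \<in> V - scc i" "0 < b k j"
  shows "card (reach j) < card (reach i)"
proof (rule psubset_card_mono)
  show "finite (reach i)"
    using E_in_V i fin by (auto simp: reach_def intro: finite_subset[of _ V])
  have "(i, j) \<in> E\<^sup>*" using k j scc_subset by (auto simp: scc_def E_def intro: rtrancl_into_rtrancl)
  then have "reach j \<subseteq> reach i" by (auto simp: reach_def)
  moreover have "i \<notin> reach j" using \<open>(i, j) \<in> E\<^sup>*\<close> j by (auto simp: reach_def scc_def)
  moreover have "i \<in> reach i" by (simp add: reach_def)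
  ultimately show "reach j \<subset> reach i" by blast
qed

definition "crit_at_most m i \<longleftrightarrow> (\<forall>\<gamma>. walk \<gamma> \<and> hd \<gamma> = i \<longrightarrow> crit_count \<gamma> \<le> m)"
definition "successors H = {j \<in> V - H. \<exists>k\<in>H. 0 < b k j}"
definition "decays i \<longleftrightarrow> (\<exists>K \<kappa>. 0 < \<kappa> \<and> (\<forall>t\<ge>-lmax. f i t \<le> K * exp (- \<kappa> * (t + lmax))))"
definition "grows_at_most d i \<longleftrightarrow> (\<exists>K. \<forall>t\<ge>-lmax. f i t \<le> K * (t + lmax + 1) ^ d)"

lemma successor_edge:
  assumes "H \<subseteq> V" "k \<in> H" "j \<in> V - H" "0 < b k j"
  shows "j \<in> successors H" "lmin \<le> l k j" "l k j \<le> lmax"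
  using assms l[of k j] by (auto simp: successors_def)

lemma exit_sum_exp_bound:
  assumes H: "H \<subseteq> V" and dec: "\<forall>j\<in>successors H. decays j"
  shows "\<exists>A\<ge>0. \<exists>\<kappa>>0. \<forall>k\<in>H. \<forall>t\<ge>0. exit_sum H k t \<le> A * exp (- \<kappa> * (t + lmax))"
proof -
  have fs: "finite (successors H)" using fin by (simp add: successors_def)
  obtain K \<kappa> where K: "0 \<le> K" "0 < \<kappa>"
      "\<And>j t. j \<in> successors H \<Longrightarrow> -lmax \<le> t \<Longrightarrow> f j t \<le> K * exp (- \<kappa> * (t + lmax))"
    using finite_uniform_exp_bound[OF fs dec[unfolded decays_def]] by blast
  have "\<exists>A\<ge>0. \<forall>k\<in>H. \<forall>t\<ge>0. exit_sum H k t \<le> A * exp (- \<kappa> * (t + lmax))"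
  proof (rule exit_sum_bound[OF H, where K = "K * exp (\<kappa> * lmax)"])
    fix k j t assume kj: "k \<in> H" "j \<in> V - H" "0 < b k j" and t: "0 \<le> (t::real)"
    note e = successor_edge[OF H kj]
    have "f j (t - l k j) \<le> K * exp (- \<kappa> * (t - l k j + lmax))"
      using e t by (intro K(3)) auto
    also have "\<dots> \<le> K * exp (\<kappa> * lmax + - \<kappa> * (t + lmax))"
      using K e by (intro mult_left_mono) (auto simp: algebra_simps)
    finally show "f j (t - l k j) \<le> K * exp (\<kappa> * lmax) * exp (- \<kappa> * (t + lmax))"
      by (simp only: exp_add mult.assoc)
  qed (use K in auto)
  then show ?thesis using K(2) by blast
qed

lemma exit_sum_poly_bound:
  assumes H: "H \<subseteq> V" and gr: "\<forall>j\<in>successors H. grows_at_most d j"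
  shows "\<exists>A\<ge>0. \<forall>k\<in>H. \<forall>t\<ge>0. exit_sum H k t \<le> A * (t + lmax + 1) ^ d"
proof -
  have "finite (successors H)" using fin by (simp add: successors_def)
  then have "\<exists>K\<ge>0. \<forall>j\<in>successors H. \<forall>t\<in>{-lmax..}. f j t \<le> K * (t + lmax + 1) ^ d"
  proof (rule finite_uniform_bound)
    show "\<forall>j\<in>successors H. \<exists>K. \<forall>t\<in>{-lmax..}. f j t \<le> K * (t + lmax + 1) ^ d"
      using gr unfolding grows_at_most_def Ball_def atLeast_iff .
  qed simp
  then obtain K where K: "0 \<le> K"
      "\<And>j t. j \<in> successors H \<Longrightarrow> -lmax \<le> t \<Longrightarrow> f j t \<le> K * (t + lmax + 1) ^ d"
    by (auto simp: Ball_def)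
  show ?thesis
  proof (rule exit_sum_bound[OF H K(1)])
    fix k j t assume kj: "k \<in> H" "j \<in> V - H" "0 < b k j" and t: "0 \<le> (t::real)"
    note e = successor_edge[OF H kj]
    have "f j (t - l k j) \<le> K * (t - l k j + lmax + 1) ^ d"
      using e t by (intro K(2)) auto
    also have "\<dots> \<le> K * (t + lmax + 1) ^ d"
      using K e lmin t by (intro mult_left_mono power_mono) auto
    finally show "f j (t - l k j) \<le> K * (t + lmax + 1) ^ d" .
  qed (use lmin in auto)
qed

text \<open>
  The rate of the successors is lowered until a delay of \<open>lmax\<close> costs at most a factor \<open>\<eta> > 1\<close> for which the
  component is still subcritical, \<open>\<rho>\<eta> < 1\<close>.
\<close>

lemma subcritical_decays:
  assumes H: "H \<subseteq> V" and u: "\<forall>k\<in>H. 0 < u k" and eig: "\<forall>k\<in>H. (\<Sum>j\<in>H. b k j * u j) = \<rho> * u k"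
    and \<rho>: "0 \<le> \<rho>" "\<rho> < 1" and dec: "\<forall>j\<in>successors H. decays j"
  shows "\<forall>k\<in>H. decays k"
proof -
  obtain A \<kappa> where A: "0 \<le> A" "0 < \<kappa>"
      "\<And>k t. k \<in> H \<Longrightarrow> 0 \<le> t \<Longrightarrow> exit_sum H k t \<le> A * exp (- \<kappa> * (t + lmax))"
    using exit_sum_exp_bound[OF H dec] by blast
  define \<eta> where "\<eta> = 1 + (1 - \<rho>) / 2"
  have "0 < (1 - \<rho>) * (2 - \<rho>)" using \<rho> by (intro mult_pos_pos) auto
  then have \<eta>: "1 < \<eta>" "\<rho> * \<eta> < 1" using \<rho> by (simp_all add: \<eta>_def field_simps)
  have l0: "0 < lmax" using lmin by simp
  define k' where "k' = min \<kappa> (ln \<eta> / lmax)"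
  have k': "0 < k'" "k' \<le> \<kappa>" using A(2) \<eta>(1) l0 by (simp_all add: k'_def)
  have "k' * lmax \<le> ln \<eta> / lmax * lmax" unfolding k'_def using l0 by (intro mult_right_mono) auto
  then have "exp (k' * lmax) \<le> exp (ln \<eta>)" using l0 by simp
  then have "\<rho> * exp (k' * lmax) \<le> \<rho> * \<eta>" using \<rho>(1) \<eta>(1) by (intro mult_left_mono) simp_all
  then have "\<exists>K. \<forall>k\<in>H. \<forall>t\<ge>-lmax. f k t \<le> K * exp (- k' * (t + lmax))"
  proof (intro subcritical_bound[OF H u eig \<rho>(1), where M = "exp (k' * lmax)" and m = "exp (- k' * lmax)" and A = A])
    show "exp (- k' * (t - s + lmax)) \<le> exp (k' * lmax) * exp (- k' * (t + lmax))"
      if "0 \<le> t" "lmin \<le> s" "s \<le> lmax" for t s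
      using that k'(1) by (simp add: exp_add[symmetric] algebra_simps)
    show "exp (- k' * lmax) \<le> exp (- k' * (t + lmax))" if "-lmax \<le> t" "t < 0" for t
      using that k'(1) by simp
    show "exit_sum H k t \<le> A * exp (- k' * (t + lmax))" if "k \<in> H" "0 \<le> t" for k t
    proof -
      have "A * exp (- \<kappa> * (t + lmax)) \<le> A * exp (- k' * (t + lmax))"
        using A(1) k' that lmin by (intro mult_left_mono) (auto intro: mult_right_mono)
      then show ?thesis using A(3)[OF that] by simp
    qed
  qed (use A \<eta> in auto)
  then show ?thesis unfolding decays_def using k'(1) by blast
qed

lemma subcritical_grows_at_most:
  assumes H: "H \<subseteq> V" and u: "\<forall>k\<in>H. 0 < u k" and eig: "\<forall>k\<in>H. (\<Sum>j\<in>H. b k j * u j) = \<rho> * u k"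
    and \<rho>: "0 \<le> \<rho>" "\<rho> < 1" and gr: "\<forall>j\<in>successors H. grows_at_most d j"
  shows "\<forall>k\<in>H. grows_at_most d k"
proof -
  obtain A where A: "0 \<le> A" "\<And>k t. k \<in> H \<Longrightarrow> 0 \<le> t \<Longrightarrow> exit_sum H k t \<le> A * (t + lmax + 1) ^ d"
    using exit_sum_poly_bound[OF H gr] by blast
  have "\<exists>K. \<forall>k\<in>H. \<forall>t\<ge>-lmax. f k t \<le> K * (t + lmax + 1) ^ d"
  proof (rule subcritical_bound[OF H u eig \<rho>(1), where M = 1 and m = 1 and A = A])
    show "(t - s + lmax + 1) ^ d \<le> 1 * (t + lmax + 1) ^ d"
      if "0 \<le> t" "lmin \<le> s" "s \<le> lmax" for t s
      using that lmin by (auto intro: power_mono)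
    show "1 \<le> (t + lmax + 1) ^ d" if "-lmax \<le> t" "t < 0" for t
      using that by (intro one_le_power) simp
  qed (use A \<rho> in auto)
  then show ?thesis unfolding grows_at_most_def by blast
qed

lemma critical_grows_at_most:
  assumes H: "H \<subseteq> V" and u: "\<forall>k\<in>H. 0 < u k" and eig: "\<forall>k\<in>H. (\<Sum>j\<in>H. b k j * u j) = 1 * u k"
  shows "\<forall>j\<in>successors H. decays j \<Longrightarrow> \<forall>k\<in>H. grows_at_most 0 k"
    and "\<forall>j\<in>successors H. grows_at_most d j \<Longrightarrow> \<forall>k\<in>H. grows_at_most (Suc d) k"
proof -
  assume dec: "\<forall>j\<in>successors H. decays j"
  obtain A \<kappa> where A: "0 \<le> A" "0 < \<kappa>"
      "\<And>k t. k \<in> H \<Longrightarrow> 0 \<le> t \<Longrightarrow> exit_sum H k t \<le> A * exp (- \<kappa> * (t + lmax))"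
    using exit_sum_exp_bound[OF H dec] by blast
  obtain K where "\<forall>k\<in>H. \<forall>t\<ge>-lmax. f k t \<le> K"
    using critical_bound_of_exp_exits[OF H u eig A(2,1,3)] by blast
  then show "\<forall>k\<in>H. grows_at_most 0 k"
    unfolding grows_at_most_def by (intro ballI exI[of _ K]) simp
next
  assume gr: "\<forall>j\<in>successors H. grows_at_most d j"
  obtain A where A: "0 \<le> A" "\<And>k t. k \<in> H \<Longrightarrow> 0 \<le> t \<Longrightarrow> exit_sum H k t \<le> A * (t + lmax + 1) ^ d"
    using exit_sum_poly_bound[OF H gr] by blast
  show "\<forall>k\<in>H. grows_at_most (Suc d) k"
    using critical_bound_of_poly_exits[OF H u eig A] unfolding grows_at_most_def by blast
qed

lemma crit_at_most_successor:
  assumes i: "i \<in> V" and j: "j \<in> successors (scc i)" and m: "crit_at_most m i"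
  shows "crit_at_most m j" "rad (scc i) = 1 \<Longrightarrow> crit_at_most (m - 1) j"
proof -
  obtain k where k: "k \<in> scc i" "j \<in> V - scc i" "0 < b k j" using j unfolding successors_def by blast
  have le: "crit_count \<gamma> \<le> m \<and> (rad (scc i) = 1 \<longrightarrow> crit_count \<gamma> \<le> m - 1)" if \<gamma>: "walk \<gamma>" "hd \<gamma> = j" for \<gamma>
  proof -
    obtain \<gamma>' where \<gamma>': "walk \<gamma>'" "hd \<gamma>' = i" "crit_count \<gamma> \<le> crit_count \<gamma>'"
        "rad (scc i) = 1 \<longrightarrow> Suc (crit_count \<gamma>) \<le> crit_count \<gamma>'"
      using exit_walk_count[OF i k \<gamma>] by blast
    then have "crit_count \<gamma>' \<le> m" using m unfolding crit_at_most_def by blast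
    then show ?thesis using \<gamma>' by linarith
  qed
  then show "crit_at_most m j" "rad (scc i) = 1 \<Longrightarrow> crit_at_most (m - 1) j"
    unfolding crit_at_most_def by blast+
qed

lemma not_critical_of_crit_at_most_0:
  assumes i: "i \<in> V" and m: "crit_at_most 0 i"
  shows "rad (scc i) \<noteq> 1"
proof
  assume "rad (scc i) = 1"
  then have "scc i \<in> {H \<in> critical. \<exists>x\<in>set [i]. x \<in> H}"
    using i self_in_scc[OF i] by (auto simp: critical_def)
  then have "crit_count [i] \<noteq> 0" unfolding crit_count_def using finite_critical by auto
  moreover have "walk [i]" using i by (simp add: walk_def)
  ultimately show False using m by (force simp: crit_at_most_def)
qed

text \<open>
  The two statements have to be proved together: a critical component whose successors meet no critical
  component needs their exponential decay, since a merely bounded source would already produce linear growth.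
\<close>

lemma renewal_upper_bounds:
  assumes "i \<in> V"
  shows "(crit_at_most 0 i \<longrightarrow> decays i) \<and> (\<forall>d. crit_at_most (Suc d) i \<longrightarrow> grows_at_most d i)"
  using assms
proof (induction "card (reach i)" arbitrary: i rule: less_induct)
  case less
  note i = \<open>i \<in> V\<close>
  let ?H = "scc i"
  obtain u where u: "\<forall>k\<in>?H. 0 < u k" "\<forall>k\<in>?H. (\<Sum>j\<in>?H. b k j * u j) = rad ?H * u k"
    using perron_scc[OF i] by blast
  note r0 = rad_nonneg[OF i] and r1 = rad_scc_le_1[OF i]
  have iH: "i \<in> ?H" by (rule self_in_scc[OF i])
  have IH: "(crit_at_most 0 j \<longrightarrow> decays j) \<and> (\<forall>d. crit_at_most (Suc d) j \<longrightarrow> grows_at_most d j)"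
    if "j \<in> successors ?H" for j
    using less.hyps[of j] reach_exit[OF i] that unfolding successors_def by blast
  show ?case
  proof (intro conjI impI allI)
    assume z: "crit_at_most 0 i"
    have "\<forall>j\<in>successors ?H. decays j" using IH crit_at_most_successor(1)[OF i _ z] by blast
    moreover have "rad ?H < 1" using not_critical_of_crit_at_most_0[OF i z] r1 by simp
    ultimately show "decays i" using subcritical_decays[OF scc_subset u r0] iH by blast
  next
    fix d assume z: "crit_at_most (Suc d) i"
    show "grows_at_most d i"
    proof (cases "rad ?H = 1")
      case False
      have "\<forall>j\<in>successors ?H. grows_at_most d j" using IH crit_at_most_successor(1)[OF i _ z] by blast
      moreover have "rad ?H < 1" using False r1 by simp
      ultimately show ?thesis using subcritical_grows_at_most[OF scc_subset u r0] iH by blast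
    next
      case True
      have eig: "\<forall>k\<in>?H. (\<Sum>j\<in>?H. b k j * u j) = 1 * u k" using u(2) True by simp
      have ex: "crit_at_most d j" if "j \<in> successors ?H" for j
        using crit_at_most_successor(2)[OF i that z True] by simp
      show ?thesis
      proof (cases d)
        case 0
        then have "\<forall>j\<in>successors ?H. decays j" using IH ex by blast
        then show ?thesis using critical_grows_at_most(1)[OF scc_subset u(1) eig] iH 0 by blast
      next
        case (Suc d')
        then have "\<forall>j\<in>successors ?H. grows_at_most d' j" using IH ex by blast
        then show ?thesis using critical_grows_at_most(2)[OF scc_subset u(1) eig] iH Suc by blast
      qed
    qed
  qed
qed

end

section \<open>Lower bounds for renewal solutions\<close>

lemma power_tangent_le:
  fixes x y :: real
  assumes "0 \<le> x"
  shows "x ^ Suc d + real (Suc d) * x ^ d * (y - x) \<le> (max 0 y) ^ Suc d"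
proof -
  have nn: "x ^ Suc d + real (Suc d) * x ^ d * (y - x) \<le> y ^ Suc d" if "0 \<le> y" for y
  proof (induction d)
    case 0 then show ?case by simp
  next
    case (Suc d)
    have "0 \<le> real (Suc d) * x ^ d * (y - x)\<^sup>2" using assms by simp
    then have "x ^ Suc (Suc d) + real (Suc (Suc d)) * x ^ Suc d * (y - x)
        \<le> y * (x ^ Suc d + real (Suc d) * x ^ d * (y - x))"
      by (simp add: power2_eq_square algebra_simps)
    also have "\<dots> \<le> y * y ^ Suc d" using Suc that by (rule mult_left_mono)
    finally show ?case by simp
  qed
  have "real (Suc d) * x ^ d * (y - x) \<le> real (Suc d) * x ^ d * (max 0 y - x)"
    using assms by (intro mult_left_mono) auto
  then show ?thesis using nn[OF max.cobounded1[of 0 y]] by linarith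
qed

text \<open>
  Jensen's inequality for the convex function \<open>x \<mapsto> (max 0 x)\<^bsup>d+1\<^esup>\<close>, from its tangent at \<open>y0\<close>.
\<close>

lemma jensen_positive_part_power:
  fixes y :: "'a \<Rightarrow> real"
  assumes w: "\<And>j. j \<in> S \<Longrightarrow> 0 \<le> w j" and W: "(\<Sum>j\<in>S. w j) = W"
    and y0: "W * y0 \<le> (\<Sum>j\<in>S. w j * y j)"
  shows "W * (max 0 y0) ^ Suc d \<le> (\<Sum>j\<in>S. w j * (max 0 (y j)) ^ Suc d)"
proof (cases "y0 \<le> 0")
  case True
  then show ?thesis using w by (auto intro!: sum_nonneg)
next
  case False
  then have p: "0 < y0" by simp
  have "W * y0 ^ Suc d \<le> W * y0 ^ Suc d + real (Suc d) * y0 ^ d * ((\<Sum>j\<in>S. w j * y j) - W * y0)"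
    using y0 p by simp
  also have "\<dots> = (\<Sum>j\<in>S. w j * (y0 ^ Suc d + real (Suc d) * y0 ^ d * (y j - y0)))"
  proof -
    have "(\<Sum>j\<in>S. w j * (y0 ^ Suc d + real (Suc d) * y0 ^ d * (y j - y0)))
      = (\<Sum>j\<in>S. w j * y0 ^ Suc d + real (Suc d) * y0 ^ d * (w j * y j) - real (Suc d) * y0 ^ d * (w j * y0))"
      by (intro sum.cong refl) (simp only: algebra_simps)
    also have "\<dots> = W * y0 ^ Suc d + real (Suc d) * y0 ^ d * (\<Sum>j\<in>S. w j * y j)
        - real (Suc d) * y0 ^ d * (W * y0)"
      by (simp only: sum.distrib sum_subtractf sum_distrib_left[symmetric] sum_distrib_right[symmetric] W)
    finally show ?thesis by (simp only: right_diff_distrib add_diff_eq)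
  qed
  also have "\<dots> \<le> (\<Sum>j\<in>S. w j * (max 0 (y j)) ^ Suc d)"
    using w p by (intro sum_mono mult_left_mono power_tangent_le) auto
  finally show ?thesis using p by simp
qed

context renewal begin

text \<open>
  The numbers \<open>b k j * u j / u k\<close> are transition probabilities of an irreducible Markov chain on a critical
  component. The inequality says that \<open>\<psi>\<close> is at least the expected time until this chain hits \<open>i\<close> if each step takes
  time \<open>L\<close>. Any such \<open>\<psi>\<close> will do; the function \<open>K (1 - \<gamma>\<^bsup>dist\<^esup>)\<close> of the graph distance to \<open>i\<close> is one, because it is so concave that a
  step towards \<open>i\<close>, of probability at least \<open>2\<gamma>\<close>, outweighs all other steps.
\<close>

lemma hitting_potential:
  assumes i: "i \<in> V" and u: "\<forall>k\<in>scc i. 0 < u k"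
    and eig: "\<forall>k\<in>scc i. (\<Sum>j\<in>scc i. b k j * u j) = u k" and L: "0 \<le> L"
  shows "\<exists>\<psi>. \<psi> i = 0 \<and> (\<forall>k. 0 \<le> \<psi> k) \<and>
    (\<forall>k\<in>scc i - {i}. (\<Sum>j\<in>scc i. b k j * u j * (L + \<psi> j)) \<le> u k * \<psi> k)"
proof -
  let ?H = "scc i"
  define dist where "dist k = (LEAST n. (k, i) \<in> E ^^ n)" for k
  define \<gamma> where "\<gamma> = Min (insert 1 ((\<lambda>(k, j). b k j * u j / (2 * u k)) ` {(k, j) \<in> ?H \<times> ?H. 0 < b k j}))"
  have fH: "finite ?H" by (rule finite_scc)
  have fS: "finite {(k, j) \<in> ?H \<times> ?H. 0 < b k j}"
    by (rule finite_subset[of _ "?H \<times> ?H"]) (use fH in auto)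
  have \<gamma>: "0 < \<gamma>" "\<gamma> \<le> 1" unfolding \<gamma>_def using fS u by auto
  have \<gamma>le: "2 * \<gamma> * u k \<le> b k j * u j" if "k \<in> ?H" "j \<in> ?H" "0 < b k j" for k j
  proof -
    have "\<gamma> \<le> b k j * u j / (2 * u k)" unfolding \<gamma>_def using fS that by (intro Min_le) auto
    then show ?thesis using u that by (simp add: field_simps)
  qed
  define m where "m = (\<Sum>k\<in>?H. dist k)"
  have m: "dist k \<le> m" if "k \<in> ?H" for k
    unfolding m_def using fH that by (intro member_le_sum) auto
  \<comment> \<open>The gain per step is at least \<open>K \<gamma>\<^bsup>dist\<^esup>\<close>, and no distance exceeds \<open>m\<close>.\<close>
  define K where "K = L / \<gamma> ^ Suc m"
  have K: "0 \<le> K" using L \<gamma> by (simp add: K_def)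
  define \<psi> where "\<psi> k = K * (1 - \<gamma> ^ dist k)" for k
  have "dist i = 0" unfolding dist_def by (rule Least_eq_0) simp
  then have "\<psi> i = 0" by (simp add: \<psi>_def)
  moreover have "0 \<le> \<psi> k" for k
    using K \<gamma> by (simp add: \<psi>_def power_le_one)
  moreover have "(\<Sum>j\<in>?H. b k j * u j * (L + \<psi> j)) \<le> u k * \<psi> k" if k: "k \<in> ?H - {i}" for k
  proof -
    have uk: "0 < u k" using u k by simp
    have bn: "0 \<le> b k j" if "j \<in> ?H" for j using b_nonneg k that scc_subset by blast
    have "(k, i) \<in> E\<^sup>*" using k by (simp add: scc_def)
    then obtain n where "(k, i) \<in> E ^^ n" by (auto simp: rtrancl_power)
    then have dk: "(k, i) \<in> E ^^ dist k" unfolding dist_def by (rule LeastI)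
    then obtain n where n: "dist k = Suc n" using k by (cases "dist k") auto
    obtain j where j: "(k, j) \<in> E" "(j, i) \<in> E ^^ n"
      using relpow_Suc_D2[OF dk[unfolded n]] by blast
    have dj: "dist j \<le> n" unfolding dist_def by (rule Least_le) (rule j(2))
    have "(i, j) \<in> E\<^sup>*" using k j(1) by (auto simp: scc_def intro: rtrancl_into_rtrancl)
    then have jH: "j \<in> ?H" using j by (auto simp: scc_def E_def relpow_imp_rtrancl)
    have bkj: "0 < b k j" using j by (simp add: E_def)
    have "\<gamma> * u k * \<gamma> ^ n \<le> (b k j * u j - \<gamma> * u k) * \<gamma> ^ n"
      using \<gamma>le[of k j] k jH bkj \<gamma> by (intro mult_right_mono) auto
    also have "\<dots> = b k j * u j * \<gamma> ^ n - u k * \<gamma> ^ dist k" by (simp add: n algebra_simps)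
    also have "b k j * u j * \<gamma> ^ n \<le> b k j * u j * \<gamma> ^ dist j"
      using dj \<gamma> bkj u jH by (intro mult_left_mono power_decreasing) (auto simp: less_imp_le)
    also have "b k j * u j * \<gamma> ^ dist j \<le> (\<Sum>j\<in>?H. b k j * u j * \<gamma> ^ dist j)"
      using fH jH bn u \<gamma> by (intro member_le_sum) (auto simp: less_imp_le)
    finally have gain: "\<gamma> * u k * \<gamma> ^ n \<le> (\<Sum>j\<in>?H. b k j * u j * \<gamma> ^ dist j) - u k * \<gamma> ^ dist k"
      by simp
    have "L * u k \<le> K * (\<gamma> * u k * \<gamma> ^ n)"
    proof -
      have "\<gamma> ^ Suc m \<le> \<gamma> ^ Suc n" using m[of k] k n \<gamma> by (intro power_decreasing) auto
      then have "K * \<gamma> ^ Suc m \<le> K * \<gamma> ^ Suc n" using K by (rule mult_left_mono)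
      then have "L \<le> K * \<gamma> ^ Suc n" using \<gamma> by (simp add: K_def)
      then have "L * u k \<le> K * \<gamma> ^ Suc n * u k" using uk by (intro mult_right_mono) auto
      then show ?thesis by (simp add: mult_ac)
    qed
    also have "\<dots> \<le> K * ((\<Sum>j\<in>?H. b k j * u j * \<gamma> ^ dist j) - u k * \<gamma> ^ dist k)"
      using gain K by (rule mult_left_mono)
    finally have main: "L * u k \<le> K * ((\<Sum>j\<in>?H. b k j * u j * \<gamma> ^ dist j) - u k * \<gamma> ^ dist k)" .
    have "(\<Sum>j\<in>?H. b k j * u j * (L + \<psi> j))
      = (\<Sum>j\<in>?H. (L + K) * (b k j * u j) - K * (b k j * u j * \<gamma> ^ dist j))"
      by (intro sum.cong refl) (simp add: \<psi>_def algebra_simps)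
    also have "\<dots> = (L + K) * u k - K * (\<Sum>j\<in>?H. b k j * u j * \<gamma> ^ dist j)"
      using eig k by (simp add: sum_subtractf sum_distrib_left[symmetric])
    also have "\<dots> \<le> u k * \<psi> k" using main by (simp add: \<psi>_def algebra_simps)
    finally show ?thesis .
  qed
  ultimately show ?thesis by (intro exI[of _ \<psi>]) auto
qed

lemma exit_sum_nonneg:
  assumes "H \<subseteq> V" "k \<in> H" "0 \<le> t"
  shows "0 \<le> exit_sum H k t"
  unfolding exit_sum_def by (rule sum_nonneg, rule recurrence_term_nonneg) (use assms in auto)

lemma critical_lower_bound:
  assumes i: "i \<in> V" and r: "rad (scc i) = 1"
  shows "\<exists>c>0. \<forall>t\<ge>-lmax. c \<le> f i t"
proof -
  obtain u where u: "\<forall>k\<in>scc i. 0 < u k" "\<forall>k\<in>scc i. (\<Sum>j\<in>scc i. b k j * u j) = rad (scc i) * u k"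
    using perron_scc[OF i] by blast
  obtain um U where um: "0 < um" "\<And>k. k \<in> scc i \<Longrightarrow> um \<le> u k" "\<And>k. k \<in> scc i \<Longrightarrow> u k \<le> U"
    using positive_bounds[OF scc_subset u(1)] by blast
  have iH: "i \<in> scc i" by (rule self_in_scc[OF i])
  have U: "0 < U" using um(2,3)[OF iH] um(1) by simp
  have "u i / U \<le> f i t" if "-lmax \<le> t" for t
  proof (rule subsolution_le_solution[where g = "\<lambda>k t. u k / U", OF scc_subset _ _ iH that])
    fix k t assume k: "k \<in> scc i" and t: "0 \<le> (t::real)"
    have "(\<Sum>j\<in>scc i. b k j * (u j / U)) = u k / U"
      using u(2) k r by (simp add: sum_divide_distrib[symmetric])
    then show "u k / U \<le> (\<Sum>j\<in>scc i. b k j * (u j / U)) + exit_sum (scc i) k t"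
      using exit_sum_nonneg[OF scc_subset k t] by simp
  qed (use um U in auto)
  then show ?thesis using u(1) iH U by (intro exI[of _ "u i / U"]) auto
qed

text \<open>
  A source of order \<open>t\<^sup>d\<close> at the single vertex \<open>i\<close> of a critical component forces growth of order
  \<open>t\<^bsup>d+1\<^esup>\<close>. The subsolution is a small multiple of \<open>u\<^sub>k (t - C2 - \<psi>\<^sub>k)\<^bsup>d+1\<^esup>\<close>, cut off at 0, with the potential
  \<open>\<psi>\<close> of \<open>hitting_potential\<close>. Away from \<open>i\<close> it is one by Jensen's inequality, as \<open>\<psi>\<close> exceeds the mean of its delayed
  values; at \<open>i\<close> the defect is of order \<open>t\<^sup>d\<close> and is covered by the source.
\<close>

lemma critical_lower_bound_of_exit:
  assumes i: "i \<in> V" and r: "rad (scc i) = 1" and j: "j \<in> V - scc i" "0 < b i j"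
    and c: "0 < c" "0 \<le> C" and lower: "\<And>t. -lmax \<le> t \<Longrightarrow> c * (max 0 (t - C)) ^ d \<le> f j t"
  shows "\<exists>c>0. \<exists>C\<ge>0. \<forall>t\<ge>-lmax. c * (max 0 (t - C)) ^ Suc d \<le> f i t"
proof -
  let ?H = "scc i"
  obtain u where u: "\<forall>k\<in>?H. 0 < u k" "\<forall>k\<in>?H. (\<Sum>j\<in>?H. b k j * u j) = u k"
    using perron_scc[OF i] r by auto
  have l0: "0 \<le> lmax" using lmin by simp
  obtain \<psi> where \<psi>: "\<psi> i = 0" "\<forall>k. 0 \<le> \<psi> k"
      "\<forall>k\<in>?H - {i}. (\<Sum>j\<in>?H. b k j * u j * (lmax + \<psi> j)) \<le> u k * \<psi> k"
    using hitting_potential[OF i u l0] by blast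
  have iH: "i \<in> ?H" by (rule self_in_scc[OF i])
  have ui: "0 < u i" using u(1) iH by blast
  define C2 where "C2 = lmax + C"
  define L where "L = lmax + (\<Sum>k\<in>?H. \<psi> k)"
  have \<psi>L: "lmax + \<psi> k \<le> L" if "k \<in> ?H" for k
    unfolding L_def using finite_scc \<psi>(2) that by (auto intro: member_le_sum)
  have L0: "0 \<le> L" using \<psi>L[OF iH] \<psi> l0 by simp
  \<comment> \<open>The defect at \<open>i\<close> is at most \<open>\<kappa> u\<^sub>i (d + 1) L x\<^sup>d\<close> and must not exceed \<open>b\<^sub>i\<^sub>j c x\<^sup>d\<close>; the summand 1 excludes
    a zero denominator.\<close>
  define \<kappa> where "\<kappa> = b i j * c / (u i * real (Suc d) * (L + 1))"
  have \<kappa>: "0 < \<kappa>" unfolding \<kappa>_def using j(2) c(1) ui L0 by (intro divide_pos_pos mult_pos_pos) auto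
  define g where "g k t = \<kappa> * (u k * (max 0 (t - C2 - \<psi> k)) ^ Suc d)" for k t
  have inner: "\<kappa> * (u k * (max 0 y0) ^ Suc d) \<le> (\<Sum>m\<in>?H. b k m * g m (t - l k m))"
    if k: "k \<in> ?H" and y0: "u k * y0 \<le> (\<Sum>m\<in>?H. b k m * u m * (t - C2 - (lmax + \<psi> m)))" for k y0 t
  proof -
    have bn: "0 \<le> b k m" if "m \<in> ?H" for m using b_nonneg k that scc_subset by blast
    have "u k * (max 0 y0) ^ Suc d \<le> (\<Sum>m\<in>?H. b k m * u m * (max 0 (t - C2 - (lmax + \<psi> m))) ^ Suc d)"
      by (rule jensen_positive_part_power) (use bn u k y0 in \<open>auto simp: less_imp_le\<close>)
    then have "\<kappa> * (u k * (max 0 y0) ^ Suc d)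
        \<le> \<kappa> * (\<Sum>m\<in>?H. b k m * u m * (max 0 (t - C2 - (lmax + \<psi> m))) ^ Suc d)"
      using \<kappa> by (intro mult_left_mono) auto
    also have "\<dots> = (\<Sum>m\<in>?H. b k m * (\<kappa> * (u m * (max 0 (t - C2 - (lmax + \<psi> m))) ^ Suc d)))"
      by (simp add: sum_distrib_left mult_ac)
    also have "\<dots> \<le> (\<Sum>m\<in>?H. b k m * g m (t - l k m))"
    proof (rule sum_mono)
      fix m assume m: "m \<in> ?H"
      show "b k m * (\<kappa> * (u m * (max 0 (t - C2 - (lmax + \<psi> m))) ^ Suc d)) \<le> b k m * g m (t - l k m)"
      proof (cases "b k m = 0")
        case False
        then have "0 < b k m" using bn[OF m] by simp
        then have "l k m \<le> lmax" using l[of k m] k m scc_subset by blast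
        then show ?thesis unfolding g_def
          using bn[OF m] \<kappa> u m by (intro mult_left_mono power_mono) (auto simp: less_imp_le)
      qed simp
    qed
    finally show ?thesis .
  qed
  have "g i t \<le> f i t" if t: "-lmax \<le> t" for t
  proof (rule subsolution_le_solution[OF scc_subset _ _ iH t])
    fix k t assume k: "k \<in> ?H" and t: "0 \<le> (t::real)"
    have split: "(\<Sum>m\<in>?H. b k m * u m * (t - C2 - (lmax + \<psi> m)))
        = u k * (t - C2) - (\<Sum>m\<in>?H. b k m * u m * (lmax + \<psi> m))"
      using u(2) k by (simp only: right_diff_distrib[of _ "t - C2"] sum_subtractf sum_distrib_right[symmetric])
    show "g k t \<le> (\<Sum>m\<in>?H. b k m * g m (t - l k m)) + exit_sum ?H k t"
    proof (cases "k = i")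
      case False
      have "u k * (t - C2 - \<psi> k) \<le> (\<Sum>m\<in>?H. b k m * u m * (t - C2 - (lmax + \<psi> m)))"
        unfolding split using \<psi>(3) k False by (simp add: right_diff_distrib)
      from inner[OF k this] show ?thesis
        using exit_sum_nonneg[OF scc_subset k t] by (simp add: g_def)
    next
      case True
      define x where "x = t - C2"
      have bi: "0 \<le> b i m" if "m \<in> ?H" for m using b_nonneg i that scc_subset by blast
      have "(\<Sum>m\<in>?H. b i m * u m * (lmax + \<psi> m)) \<le> (\<Sum>m\<in>?H. b i m * u m * L)"
        using bi u \<psi>L by (intro sum_mono mult_left_mono) (auto simp: less_imp_le)
      also have "\<dots> = u i * L" using u(2) iH by (simp add: sum_distrib_right[symmetric])
      finally have "u i * (x - L) \<le> (\<Sum>m\<in>?H. b i m * u m * (t - C2 - (lmax + \<psi> m)))"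
        using split True by (simp add: x_def right_diff_distrib)
      from inner[OF iH this]
      have s1: "\<kappa> * (u i * (max 0 (x - L)) ^ Suc d) \<le> (\<Sum>m\<in>?H. b i m * g m (t - l i m))" .
      have lij: "l i j \<le> lmax" using l[of i j] i j by blast
      have "b i j * (c * (max 0 x) ^ d) \<le> b i j * (c * (max 0 (t - l i j - C)) ^ d)"
        using lij c j by (intro mult_left_mono power_mono) (auto simp: x_def C2_def)
      also have "\<dots> \<le> b i j * f j (t - l i j)"
        using lower[of "t - l i j"] lij t j by (intro mult_left_mono) auto
      also have "\<dots> \<le> exit_sum ?H i t"
        unfolding exit_sum_def
      proof (rule member_le_sum)
        show "0 \<le> b i m * f m (t - l i m)" if "m \<in> V - ?H - {j}" for m
          by (rule recurrence_term_nonneg) (use that i t in auto)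
      qed (use j fin in auto)
      finally have s2: "b i j * (c * (max 0 x) ^ d) \<le> exit_sum ?H i t" .
      have "(max 0 x) ^ Suc d + real (Suc d) * (max 0 x) ^ d * (- L) \<le> (max 0 (x - L)) ^ Suc d"
      proof (cases "0 \<le> x")
        case True
        then show ?thesis using power_tangent_le[of x d "x - L"] by simp
      next
        case False
        then have "max 0 x = 0" by simp
        then show ?thesis using L0 by (simp add: mult_nonneg_nonneg)
      qed
      then have "\<kappa> * (u i * ((max 0 x) ^ Suc d + real (Suc d) * (max 0 x) ^ d * (- L)))
          \<le> \<kappa> * (u i * (max 0 (x - L)) ^ Suc d)"
        using \<kappa> ui by (intro mult_left_mono) auto
      moreover have "\<kappa> * (u i * (real (Suc d) * (max 0 x) ^ d * L)) \<le> b i j * (c * (max 0 x) ^ d)"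
      proof -
        have "\<kappa> * (u i * real (Suc d) * L) \<le> \<kappa> * (u i * real (Suc d) * (L + 1))"
          using \<kappa> ui by (intro mult_left_mono) auto
        also have "\<dots> = b i j * c" unfolding \<kappa>_def using ui L0 by simp
        finally have "\<kappa> * (u i * real (Suc d) * L) * (max 0 x) ^ d \<le> b i j * c * (max 0 x) ^ d"
          by (rule mult_right_mono) simp
        then show ?thesis by (simp only: mult_ac)
      qed
      moreover have "\<kappa> * (u i * ((max 0 x) ^ Suc d + real (Suc d) * (max 0 x) ^ d * (- L)))
        = \<kappa> * (u i * (max 0 x) ^ Suc d) - \<kappa> * (u i * (real (Suc d) * (max 0 x) ^ d * L))"
        by (simp only: mult_minus_right add_uminus_conv_diff right_diff_distrib)
      moreover have "g i t = \<kappa> * (u i * (max 0 x) ^ Suc d)" by (simp only: g_def x_def \<psi>(1) diff_zero)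
      ultimately show ?thesis using s1 s2 unfolding True by linarith
    qed
  next
    fix k t assume "k \<in> ?H" and t: "-lmax \<le> t" "t < (0::real)"
    have "max 0 (t - C2 - \<psi> k) = 0" using t \<psi>(2) c(2) l0 by (simp add: C2_def add_nonneg_nonneg max_def) (smt (verit))
    then show "g k t \<le> 1" by (simp add: g_def)
  qed
  then show ?thesis
    using \<kappa> ui c(2) l0 \<psi>(1)
    by (intro exI[of _ "\<kappa> * u i"] conjI exI[of _ C2]) (auto simp: g_def C2_def mult.assoc)
qed

lemma crit_count_Cons:
  assumes "i \<in> V"
  shows "crit_count (i # \<delta>) = crit_count \<delta> \<or>
    (rad (scc i) = 1 \<and> (\<forall>x\<in>set \<delta>. x \<notin> scc i) \<and> crit_count (i # \<delta>) = Suc (crit_count \<delta>))"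
proof -
  let ?S = "{H \<in> critical. \<exists>x\<in>set \<delta>. x \<in> H}"
  have eq: "{H \<in> critical. \<exists>x\<in>set (i # \<delta>). x \<in> H} = (if rad (scc i) = 1 then insert (scc i) ?S else ?S)"
  proof -
    have "H \<in> critical \<and> i \<in> H \<longleftrightarrow> rad (scc i) = 1 \<and> H = scc i" for H
      using mem_critical_eq_scc[of H i] self_in_scc[OF assms] assms by (auto simp: critical_def)
    then show ?thesis by auto
  qed
  have fS: "finite ?S" using finite_critical by simp
  show ?thesis
  proof (cases "rad (scc i) = 1 \<and> scc i \<notin> ?S")
    case True
    then have "scc i \<in> critical" using assms by (simp add: critical_def)
    then have "\<forall>x\<in>set \<delta>. x \<notin> scc i" using True by blast
    then show ?thesis using True fS unfolding crit_count_def eq by simp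
  next
    case False
    then have "{H \<in> critical. \<exists>x\<in>set (i # \<delta>). x \<in> H} = ?S" unfolding eq by auto
    then show ?thesis unfolding crit_count_def by simp
  qed
qed

text \<open>
  Induction along the walk, from its end. On the last critical component a multiple of the Perron eigenvector is
  a subsolution; each earlier critical component raises the exponent by one at its last vertex on the walk.
\<close>

lemma renewal_lower_bounds:
  assumes "walk \<gamma>" "crit_count \<gamma> = Suc d"
  shows "\<exists>c>0. \<exists>C\<ge>0. \<forall>t\<ge>-lmax. c * (max 0 (t - C)) ^ d \<le> f (hd \<gamma>) t"
  using assms
proof (induction \<gamma> arbitrary: d)
  case Nil then show ?case by (simp add: walk_def)
next
  case (Cons i \<delta>)
  have i: "i \<in> V" using Cons.prems by (simp add: walk_def)
  have base: ?case if "rad (scc i) = 1" "d = 0"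
    using critical_lower_bound[OF i that(1)] that(2) by auto
  have edge: "walk \<delta> \<and> (i, hd \<delta>) \<in> E" if "\<delta> \<noteq> []"
    using that Cons.prems by (cases \<delta>) (auto simp: walk_def)
  consider "crit_count (i # \<delta>) = crit_count \<delta>"
    | "rad (scc i) = 1" "\<forall>x\<in>set \<delta>. x \<notin> scc i" "crit_count (i # \<delta>) = Suc (crit_count \<delta>)"
    using crit_count_Cons[OF i] by blast
  then show ?case
  proof cases
    case 1
    then have cd: "crit_count \<delta> = Suc d" using Cons.prems by simp
    then have ne: "\<delta> \<noteq> []" by (auto simp: crit_count_def)
    let ?j = "hd \<delta>"
    have j: "?j \<in> V" "0 < b i ?j" using edge[OF ne] by (auto simp: E_def)
    obtain c C where c: "0 < c" "0 \<le> C" and low: "\<And>t. -lmax \<le> t \<Longrightarrow> c * (max 0 (t - C)) ^ d \<le> f ?j t"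
      using Cons.IH[OF _ cd] edge[OF ne] by blast
    have lij: "l i ?j \<le> lmax" using l[OF i j] by simp
    define c' C' where "c' = min 1 (b i ?j * c)" and "C' = C + lmax"
    have c': "0 < c'" "c' \<le> 1" "c' \<le> b i ?j * c" using c j by (auto simp: c'_def)
    have "c' * (max 0 (t - C')) ^ d \<le> f i t" if t: "-lmax \<le> t" for t
    proof (cases "t < 0")
      case True
      then have "max 0 (t - C') = 0" using c lmin by (simp add: C'_def)
      then have "c' * (max 0 (t - C')) ^ d \<le> 1" using c' by (cases d) auto
      then show ?thesis using init[OF i t True] by simp
    next
      case False
      have "c' * (max 0 (t - C')) ^ d \<le> b i ?j * c * (max 0 (t - l i ?j - C)) ^ d"
        using c' c j lij by (intro mult_mono power_mono) (auto simp: C'_def)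
      also have "\<dots> \<le> b i ?j * f ?j (t - l i ?j)"
        using low[of "t - l i ?j"] lij False j by (simp add: mult.assoc)
      also have "\<dots> \<le> (\<Sum>m\<in>V. b i m * f m (t - l i m))"
      proof (rule member_le_sum)
        show "0 \<le> b i m * f m (t - l i m)" if "m \<in> V - {?j}" for m
          by (rule recurrence_term_nonneg) (use that i False in auto)
      qed (use j fin in auto)
      also have "\<dots> = f i t" using recurrence[OF i] False by simp
      finally show ?thesis .
    qed
    then show ?thesis using c' c lmin by (intro exI[of _ c'] conjI exI[of _ C']) (auto simp: C'_def)
  next
    case 2
    show ?thesis
    proof (cases d)
      case 0
      then show ?thesis using base 2 by simp
    next
      case (Suc d')
      then have cd: "crit_count \<delta> = Suc d'" using 2 Cons.prems by simp
      then have ne: "\<delta> \<noteq> []" by (auto simp: crit_count_def)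
      let ?j = "hd \<delta>"
      have j: "?j \<in> V - scc i" "0 < b i ?j" using edge[OF ne] 2 ne by (auto simp: E_def)
      obtain c C where c: "0 < c" "0 \<le> C" and low: "\<And>t. -lmax \<le> t \<Longrightarrow> c * (max 0 (t - C)) ^ d' \<le> f ?j t"
        using Cons.IH[OF _ cd] edge[OF ne] by blast
      show ?thesis using critical_lower_bound_of_exit[OF i 2(1) j c low] Suc by simp
    qed
  qed
qed

text \<open>
  Otherwise all solutions would decay exponentially. But the whole matrix has spectral radius 1, so there is a nonzero
  vector \<open>z \<ge> 0\<close> with \<open>Bz \<ge> z\<close>, which is a subsolution that does not depend on time.
\<close>

lemma exists_critical_walk:
  assumes ne: "V \<noteq> {}"
  shows "\<exists>\<gamma>. walk \<gamma> \<and> 1 \<le> crit_count \<gamma>"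
proof (rule ccontr)
  assume "\<not> ?thesis"
  then have z: "\<forall>\<gamma>. walk \<gamma> \<longrightarrow> crit_count \<gamma> = 0" by auto
  obtain z where z1: "\<forall>i. 0 \<le> z i" "\<exists>i\<in>V. 0 < z i" "\<forall>i\<in>V. z i \<le> (\<Sum>j\<in>V. b i j * z j)"
    using nonneg_subeigenvector[where b = b, OF fin ne b_nonneg] unfolding radius by auto
  then obtain i where i: "i \<in> V" "0 < z i" by blast
  define Z where "Z = (\<Sum>i\<in>V. z i)"
  have zZ: "z k \<le> Z" if "k \<in> V" for k unfolding Z_def using fin z1 that by (intro member_le_sum) auto
  have Z: "0 < Z" using zZ[OF i(1)] i by simp
  have low: "z i / Z \<le> f i t" if "-lmax \<le> t" for t
  proof (rule subsolution_le_solution[where g = "\<lambda>k t. z k / Z", OF subset_refl _ _ i(1) that])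
    fix k t assume k: "k \<in> V" and t: "0 \<le> (t::real)"
    have "z k / Z \<le> (\<Sum>j\<in>V. b k j * z j) / Z" using z1 k Z by (simp add: divide_right_mono)
    then show "z k / Z \<le> (\<Sum>j\<in>V. b k j * (z j / Z)) + exit_sum V k t"
      using exit_sum_nonneg[OF subset_refl k t] by (simp add: sum_divide_distrib)
  qed (use zZ Z in auto)
  obtain K \<kappa> where K: "0 < \<kappa>" "\<And>t. -lmax \<le> t \<Longrightarrow> f i t \<le> K * exp (- \<kappa> * (t + lmax))"
  proof -
    have "crit_at_most 0 i" using z by (simp add: crit_at_most_def)
    then have "decays i" using renewal_upper_bounds[OF i(1)] by blast
    then show ?thesis using that unfolding decays_def by blast
  qed
  define y where "y = z i / Z"
  have y: "0 < y" using i Z by (simp add: y_def)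
  have K': "y * exp (\<kappa> * x) \<le> K" if "0 \<le> x" for x
  proof -
    have "y \<le> K * exp (- \<kappa> * x)" using low[of "x - lmax"] K(2)[of "x - lmax"] that by (simp add: y_def)
    then have "y * exp (\<kappa> * x) \<le> K * exp (- \<kappa> * x) * exp (\<kappa> * x)" by (rule mult_right_mono) simp
    then show ?thesis by (simp add: mult.assoc exp_add[symmetric])
  qed
  have K0: "0 < K" using K'[of 0] y by simp
  \<comment> \<open>At this time \<open>exp z \<ge> 1 + z\<close> turns \<open>K'\<close> into \<open>y + K \<le> K\<close>.\<close>
  define x where "x = K / (y * \<kappa>)"
  have x: "0 \<le> x" "\<kappa> * x = K / y" using K0 y K(1) by (simp_all add: x_def)
  have "y + K = y * (1 + \<kappa> * x)" using y by (simp add: x(2) field_simps)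
  also have "\<dots> \<le> y * exp (\<kappa> * x)" using y exp_ge_add_one_self[of "\<kappa> * x"] by (intro mult_left_mono) auto
  also have "\<dots> \<le> K" by (rule K'[OF x(1)])
  finally show False using y by simp
qed

end

section \<open>Words and cut sets\<close>

fun path_prod :: "(nat \<Rightarrow> nat \<Rightarrow> real) \<Rightarrow> nat list \<Rightarrow> real" where
  "path_prod a [] = 1"
| "path_prod a [i] = 1"
| "path_prod a (i # j # w) = a i j * path_prod a (j # w)"

lemma path_prod_conv_prod: "path_prod a w = (\<Prod>h<length w - 1. a (w ! h) (w ! Suc h))"
proof (induction a w rule: path_prod.induct)
  case (3 a i j w)
  then show ?case by (simp add: prod.lessThan_Suc_shift del: prod.lessThan_Suc)
qed simp_all

lemma path_prod_snoc: "w \<noteq> [] \<Longrightarrow> path_prod a (w @ [j]) = path_prod a w * a (last w) j"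
proof (induction a w rule: path_prod.induct)
  case (3 a i j' w)
  then show ?case by (simp split: if_splits)
qed simp_all

locale markov_words =
  fixes N :: nat and p c :: "nat \<Rightarrow> nat \<Rightarrow> real" and r :: real
  assumes r: "0 < r"
    and N: "0 < N"
    and p_nonneg: "\<And>i j. i \<in> {1..N} \<Longrightarrow> j \<in> {1..N} \<Longrightarrow> 0 \<le> p i j"
    and p_stoch: "\<And>i. i \<in> {1..N} \<Longrightarrow> (\<Sum>j=1..N. p i j) = 1"
    and c_range: "\<And>i j. i \<in> {1..N} \<Longrightarrow> j \<in> {1..N} \<Longrightarrow> 0 \<le> c i j \<and> c i j < 1"
    and c_pos: "\<And>i j. i \<in> {1..N} \<Longrightarrow> j \<in> {1..N} \<Longrightarrow> 0 < c i j \<longleftrightarrow> 0 < p i j"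
    and out_deg: "\<And>i. i \<in> {1..N} \<Longrightarrow> 2 \<le> card {j \<in> {1..N}. 0 < p i j}"
begin

definition "is_word w \<longleftrightarrow> set w \<subseteq> {1..N} \<and> successively (\<lambda>i j. 0 < p i j) w"
definition "a i j = p i j * c i j powr r"
definition "edges = {(i, j). i \<in> {1..N} \<and> j \<in> {1..N} \<and> 0 < p i j}"
definition "len i j = - ln (a i j)"
definition "lmin = Min ((\<lambda>(i, j). len i j) ` edges)"
definition "lmax = Max ((\<lambda>(i, j). len i j) ` edges)"

lemma path_prod_pos_iff:
  assumes "set w \<subseteq> {1..N}"
  shows "0 \<le> path_prod p w \<and> (0 < path_prod p w \<longleftrightarrow> successively (\<lambda>i j. 0 < p i j) w)"
  using assms
proof (induction w rule: induct_list012)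
  case (3 i j w)
  then have "0 \<le> path_prod p (j # w) \<and> (0 < path_prod p (j # w) \<longleftrightarrow> successively (\<lambda>i j. 0 < p i j) (j # w))"
    by simp
  then show ?case using p_nonneg[of i j] 3(3) by (auto simp: zero_less_mult_iff)
qed simp_all

lemma words_iff: "w \<in> words N p k \<longleftrightarrow> length w = k \<and> is_word w"
  using path_prod_pos_iff[of w] by (auto simp: words_def is_word_def path_prod_conv_prod)

lemma all_words_iff: "w \<in> all_words N p \<longleftrightarrow> is_word w"
  by (simp add: all_words_def words_iff)

lemma edgeD:
  assumes "(i, j) \<in> edges"
  shows "0 < p i j" "p i j \<le> 1" "0 < c i j" "c i j < 1" "0 < a i j" "a i j < 1" "0 < len i j"
proof -
  have ij: "i \<in> {1..N}" "j \<in> {1..N}" and p: "0 < p i j" using assms by (auto simp: edges_def)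
  show "0 < p i j" by fact
  have "p i j \<le> (\<Sum>j=1..N. p i j)" using ij p_nonneg by (intro member_le_sum) auto
  then show p1: "p i j \<le> 1" using p_stoch ij by simp
  show c0: "0 < c i j" using c_pos[OF ij] p by simp
  show c1: "c i j < 1" using c_range[OF ij] by simp
  show a0: "0 < a i j" using p c0 by (simp add: a_def)
  have "c i j powr r < 1" using powr_less_mono2[OF r, of "c i j" 1] c0 c1 by simp
  moreover have "p i j * c i j powr r \<le> 1 * c i j powr r" using p1 by (intro mult_right_mono) auto
  ultimately show a1: "a i j < 1" unfolding a_def by simp
  then show "0 < len i j" using a0 by (simp add: len_def)
qed

lemma a_eq_0: "i \<in> {1..N} \<Longrightarrow> j \<in> {1..N} \<Longrightarrow> (i, j) \<notin> edges \<Longrightarrow> a i j = 0"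
  using p_nonneg[of i j] by (auto simp: edges_def a_def)

lemma exp_len: "(i, j) \<in> edges \<Longrightarrow> exp (- len i j) = a i j"
  using edgeD(5) by (simp add: len_def)

lemma finite_edges: "finite edges"
  by (rule finite_subset[of _ "{1..N} \<times> {1..N}"]) (auto simp: edges_def)

lemma ex_edge: "i \<in> {1..N} \<Longrightarrow> \<exists>j. (i, j) \<in> edges"
proof -
  assume i: "i \<in> {1..N}"
  have "{j \<in> {1..N}. 0 < p i j} \<noteq> {}" using out_deg[OF i] by (metis card.empty not_numeral_le_zero)
  then show ?thesis using i by (auto simp: edges_def)
qed

lemma edges_nonempty: "edges \<noteq> {}"
proof -
  have "(1::nat) \<in> {1..N}" using N by simp
  then show ?thesis using ex_edge by blast
qed

lemma lmin_pos: "0 < lmin"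
  unfolding lmin_def using finite_edges edges_nonempty edgeD(7) by (subst Min_gr_iff) auto

lemma len_bounds: "(i, j) \<in> edges \<Longrightarrow> lmin \<le> len i j \<and> len i j \<le> lmax"
  unfolding lmin_def lmax_def using finite_edges
  by (intro conjI Min_le Max_ge) (auto intro!: image_eqI[of _ _ "(i, j)"])

lemma lmin_le_lmax: "lmin \<le> lmax"
  using edges_nonempty len_bounds by force

lemma is_word_Cons: "is_word (i # j # w) \<longleftrightarrow> (i, j) \<in> edges \<and> is_word (j # w)"
  by (auto simp: is_word_def edges_def)

lemma is_word_append: "is_word (v @ w) \<Longrightarrow> is_word v \<and> is_word w"
  by (auto simp: is_word_def successively_append_iff)

lemma is_word_snocD:
  assumes "is_word (v @ [j])" "v \<noteq> []"
  shows "(last v, j) \<in> edges"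
proof -
  have "set v \<subseteq> {1..N}" using assms(1) by (simp add: is_word_def)
  then have "last v \<in> {1..N}" using last_in_set[OF assms(2)] by blast
  then show ?thesis using assms by (simp add: is_word_def edges_def successively_append_iff)
qed

lemma path_prod_bounds: "is_word w \<Longrightarrow> 0 < path_prod a w \<and> path_prod a w \<le> 1"
proof (induction w rule: induct_list012)
  case (3 i j w)
  then have "(i, j) \<in> edges" "is_word (j # w)" by (auto simp: is_word_Cons)
  then have "0 < a i j" "a i j \<le> 1" "0 < path_prod a (j # w)" "path_prod a (j # w) \<le> 1"
    using 3 edgeD(5,6)[of i j] by auto
  then show ?case using mult_mono[of "a i j" 1 "path_prod a (j # w)" 1] by simp
qed simp_all

lemma path_prod_le_exp: "is_word w \<Longrightarrow> path_prod a w \<le> exp (- lmin * real (length w - 1))"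
proof (induction w rule: induct_list012)
  case (3 i j w)
  then have e: "(i, j) \<in> edges" and w: "is_word (j # w)" by (auto simp: is_word_Cons)
  have "a i j \<le> exp (- lmin)" using exp_len[OF e] len_bounds[OF e] by (metis exp_le_cancel_iff neg_le_iff_le)
  then have "a i j * path_prod a (j # w) \<le> exp (- lmin) * exp (- lmin * real (length (j # w) - 1))"
    using 3(2)[OF w] path_prod_bounds[OF w] by (intro mult_mono) auto
  also have "\<dots> = exp (- lmin * real (length (i # j # w) - 1))"
    by (simp add: exp_add[symmetric] algebra_simps)
  finally show ?case by simp
qed simp_all

lemma path_prod_prefix_le:
  assumes "is_word (v @ w)" "v \<noteq> []"
  shows "path_prod a (v @ w) \<le> path_prod a v"
  using assms
proof (induction w rule: rev_induct)
  case (snoc j w)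
  have w: "is_word (v @ w)" using is_word_append[of "v @ w" "[j]"] snoc.prems by simp
  have e: "(last (v @ w), j) \<in> edges"
    by (rule is_word_snocD) (use snoc.prems in simp_all)
  have "path_prod a ((v @ w) @ [j]) = path_prod a (v @ w) * a (last (v @ w)) j"
    using snoc.prems by (intro path_prod_snoc) simp
  also have "\<dots> \<le> path_prod a (v @ w) * 1"
    using edgeD(6)[OF e] path_prod_bounds[OF w] by (intro mult_left_mono) auto
  finally show ?case using snoc.IH[OF w snoc.prems(2)] by simp
qed simp

text \<open>
  The words with first letter \<open>i\<close> whose weight falls below \<open>e\<^bsup>-t\<^esup>\<close> at the last letter. One-letter words have weight 1;
  the disjunct \<open>butlast w = []\<close> makes the set equal to \<open>{[i]}\<close> for \<open>t < 0\<close>, which supplies the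
  initial values of the recursion.
\<close>

definition "cuts i t = {w. is_word w \<and> w \<noteq> [] \<and> hd w = i \<and> path_prod a w < exp (- t) \<and>
    (butlast w = [] \<or> exp (- t) \<le> path_prod a (butlast w))}"

lemma cut_neg:
  assumes "i \<in> {1..N}" "t < 0"
  shows "cuts i t = {[i]}"
proof -
  have e: "1 < exp (- t)" using assms by simp
  have bl: "butlast w = []" if "w \<in> cuts i t" for w
  proof (rule ccontr)
    assume "butlast w \<noteq> []"
    then have "exp (- t) \<le> path_prod a (butlast w)" "is_word w" "w \<noteq> []" using that by (auto simp: cuts_def)
    moreover have "is_word (butlast w)" using is_word_append[of "butlast w" "[last w]"] calculation by simp
    ultimately show False using path_prod_bounds[of "butlast w"] e by simp
  qed
  have "w = [i]" if w: "w \<in> cuts i t" for w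
  proof -
    have "w \<noteq> []" "hd w = i" using w by (simp_all add: cuts_def)
    then show ?thesis using bl[OF w] by (cases w) (simp_all split: if_splits)
  qed
  moreover have "[i] \<in> cuts i t" using assms e by (simp add: cuts_def is_word_def)
  ultimately show ?thesis by blast
qed

lemma cut_rec:
  assumes i: "i \<in> {1..N}" and t: "0 \<le> t"
  shows "cuts i t = (\<Union>j\<in>{j. (i, j) \<in> edges}. (#) i ` cuts j (t - len i j))"
proof -
  have key: "i # j # w \<in> cuts i t \<longleftrightarrow> (i, j) \<in> edges \<and> j # w \<in> cuts j (t - len i j)" for j w
  proof (cases "(i, j) \<in> edges")
    case True
    have ap: "0 < a i j" by (rule edgeD(5)[OF True])
    have "exp (- (t - len i j)) = exp (- t) * exp (len i j)" by (simp add: exp_add[symmetric])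
    also have "\<dots> = exp (- t) / a i j"
      using ap by (simp add: len_def exp_minus inverse_eq_divide)
    finally have ex: "exp (- (t - len i j)) = exp (- t) / a i j" .
    have 1: "a i j * x < exp (- t) \<longleftrightarrow> x < exp (- (t - len i j))" for x
      unfolding ex using ap by (simp add: field_simps)
    have 2: "exp (- t) \<le> a i j * x \<longleftrightarrow> exp (- (t - len i j)) \<le> x" for x
      unfolding ex using ap by (simp add: field_simps)
    show ?thesis
    proof (cases w)
      case Nil
      then show ?thesis using True t 1[of 1] by (simp add: cuts_def is_word_Cons)
    next
      case (Cons k v)
      then show ?thesis using True 1[of "path_prod a (j # w)"] 2[of "path_prod a (j # butlast w)"]
        by (cases "butlast w") (auto simp: cuts_def is_word_Cons)
    qed
  qed (simp add: cuts_def is_word_Cons)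
  show ?thesis
  proof (intro equalityI subsetI)
    fix w assume w: "w \<in> cuts i t"
    obtain v where v: "w = i # v" using w by (cases w) (auto simp: cuts_def)
    have "v \<noteq> []" using w v t by (auto simp: cuts_def)
    then obtain j u where "v = j # u" by (cases v) auto
    then show "w \<in> (\<Union>j\<in>{j. (i, j) \<in> edges}. (#) i ` cuts j (t - len i j))"
      using key[of j u] w v by auto
  next
    fix w assume "w \<in> (\<Union>j\<in>{j. (i, j) \<in> edges}. (#) i ` cuts j (t - len i j))"
    then obtain j v where jv: "(i, j) \<in> edges" "v \<in> cuts j (t - len i j)" "w = i # v" by blast
    then obtain u where "v = j # u" by (cases v) (auto simp: cuts_def)
    then show "w \<in> cuts i t" using key[of j u] jv by simp
  qed
qed

lemma finite_out: "finite {j. (i, j) \<in> edges}"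
  by (rule finite_subset[of _ "{1..N}"]) (auto simp: edges_def)

lemma finite_cut:
  assumes "i \<in> {1..N}"
  shows "finite (cuts i t)"
proof -
  have "\<forall>i\<in>{1..N}. \<forall>t < real n * lmin. finite (cuts i t)" for n
  proof (induction n)
    case 0 then show ?case using cut_neg by simp
  next
    case (Suc n)
    show ?case
    proof (intro ballI allI impI)
      fix i t assume i: "i \<in> {1..N}" and t: "t < real (Suc n) * lmin"
      show "finite (cuts i t)"
      proof (cases "t < 0")
        case False
        have "finite (cuts j (t - len i j))" if "(i, j) \<in> edges" for j
        proof -
          have "t - len i j < real n * lmin" using t len_bounds[OF that] by (simp add: algebra_simps)
          then show ?thesis using Suc that by (auto simp: edges_def)
        qed
        then show ?thesis using cut_rec[OF i] False finite_out by simp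
      qed (use cut_neg i in simp)
    qed
  qed
  moreover obtain n where "t / lmin < real n" using reals_Archimedean2 by blast
  ultimately show ?thesis using assms lmin_pos by (simp add: pos_divide_less_eq)
qed

lemma card_cut_rec:
  assumes i: "i \<in> {1..N}" and t: "0 \<le> t"
  shows "card (cuts i t) = (\<Sum>j | (i, j) \<in> edges. card (cuts j (t - len i j)))"
proof -
  have "card (cuts i t) = (\<Sum>j | (i, j) \<in> edges. card ((#) i ` cuts j (t - len i j)))"
    unfolding cut_rec[OF assms]
  proof (rule card_UN_disjoint)
    show "finite {j. (i, j) \<in> edges}" by (rule finite_out)
    show "\<forall>j\<in>{j. (i, j) \<in> edges}. finite ((#) i ` cuts j (t - len i j))"
      using finite_cut by (auto simp: edges_def)
    show "\<forall>j\<in>{j. (i, j) \<in> edges}. \<forall>k\<in>{j. (i, j) \<in> edges}. j \<noteq> k \<longrightarrow>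
        (#) i ` cuts j (t - len i j) \<inter> (#) i ` cuts k (t - len i k) = {}"
      by (auto simp: cuts_def)
  qed
  also have "\<dots> = (\<Sum>j | (i, j) \<in> edges. card (cuts j (t - len i j)))"
    by (intro sum.cong refl card_image) simp
  finally show ?thesis .
qed

definition "cutset t = (\<Union>i\<in>{1..N}. cuts i t)"

lemma finite_cutset: "finite (cutset t)"
  unfolding cutset_def using finite_cut by simp

lemma card_cutset: "card (cutset t) = (\<Sum>i=1..N. card (cuts i t))"
  unfolding cutset_def by (rule card_UN_disjoint) (use finite_cut in \<open>auto simp: cuts_def\<close>)

lemma cutset_word: "w \<in> cutset t \<Longrightarrow> is_word w \<and> w \<noteq> []"
  by (auto simp: cutset_def cuts_def)

lemma cutset_weight:
  assumes "w \<in> cutset t" "0 \<le> t"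
  shows "exp (- lmax) * exp (- t) \<le> path_prod a w" "path_prod a w < exp (- t)"
proof -
  show lt: "path_prod a w < exp (- t)" using assms by (auto simp: cutset_def cuts_def)
  have w: "is_word w" "w \<noteq> []" using cutset_word assms by auto
  have "butlast w \<noteq> []"
  proof
    assume "butlast w = []"
    then have "path_prod a w = 1" using w by (cases w) (auto split: if_splits)
    then show False using lt assms by simp
  qed
  then have ge: "exp (- t) \<le> path_prod a (butlast w)" using assms by (auto simp: cutset_def cuts_def)
  have sp: "w = butlast w @ [last w]" using w by simp
  have e: "(last (butlast w), last w) \<in> edges"
    by (rule is_word_snocD) (use w \<open>butlast w \<noteq> []\<close> in simp_all)
  have "exp (- lmax) * exp (- t) \<le> a (last (butlast w)) (last w) * path_prod a (butlast w)"
    using ge len_bounds[OF e] edgeD(5)[OF e] unfolding exp_len[OF e, symmetric] by (intro mult_mono) auto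
  also have "\<dots> = path_prod a w"
    using path_prod_snoc[OF \<open>butlast w \<noteq> []\<close>, of a "last w"] w(2) by (simp add: mult.commute)
  finally show "exp (- lmax) * exp (- t) \<le> path_prod a w" .
qed

text \<open>
  A word of the cut set extending another one properly would have a proper initial segment of weight
  below the threshold.
\<close>

lemma cutset_prefix_free:
  assumes "v \<in> cutset t" "w \<in> cutset t" "prefix v w"
  shows "v = w"
proof (rule ccontr)
  assume "v \<noteq> w"
  then have "strict_prefix v w" using assms(3) by simp
  then obtain z zs where "w = v @ z # zs" by (rule strict_prefixE')
  then have pv: "prefix v (butlast w)" by (simp add: butlast_append)
  have v: "is_word v" "v \<noteq> []" and w: "is_word w" "w \<noteq> []" using cutset_word assms by auto
  then have ne: "butlast w \<noteq> []" using pv by (auto simp: prefix_def)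
  have "exp (- t) \<le> path_prod a (butlast w)" using assms(2) ne by (auto simp: cutset_def cuts_def)
  also have "\<dots> \<le> path_prod a v"
  proof -
    obtain u where u: "butlast w = v @ u" using pv by (auto simp: prefix_def)
    have "is_word (butlast w)" using is_word_append[of "butlast w" "[last w]"] w by simp
    then show ?thesis using path_prod_prefix_le[of v u] v(2) u by simp
  qed
  also have "\<dots> < exp (- t)" using assms(1) by (auto simp: cutset_def cuts_def)
  finally show False by simp
qed

lemma is_word_prefix_word:
  assumes "\<omega> \<in> inf_words N p"
  shows "is_word (prefix_word \<omega> k)"
  using assms unfolding is_word_def prefix_word_def inf_words_def
  by (auto simp: successively_conv_nth)

lemma cutset_cover:
  assumes \<omega>: "\<omega> \<in> inf_words N p" and t: "0 \<le> t"
  shows "\<exists>k\<ge>1. prefix_word \<omega> k \<in> cutset t"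
proof -
  let ?P = "\<lambda>k. 1 \<le> k \<and> path_prod a (prefix_word \<omega> k) < exp (- t)"
  have "\<exists>k. ?P k"
  proof -
    obtain n where n: "t / lmin < real n" using reals_Archimedean2 by blast
    have "path_prod a (prefix_word \<omega> (Suc n)) \<le> exp (- lmin * real n)"
      using path_prod_le_exp[OF is_word_prefix_word[OF \<omega>, of "Suc n"]] by (simp add: prefix_word_def)
    also have "\<dots> < exp (- t)" using n lmin_pos by (simp add: field_simps)
    finally show ?thesis by (intro exI[of _ "Suc n"]) simp
  qed
  then obtain k where k: "?P k" and least: "\<And>m. m < k \<Longrightarrow> \<not> ?P m" using exists_least_iff[of ?P] by blast
  define w where "w = prefix_word \<omega> k"
  have bl: "butlast w = prefix_word \<omega> (k - 1)"
    using k by (cases k) (auto simp: w_def prefix_word_def)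
  have "butlast w = [] \<or> exp (- t) \<le> path_prod a (butlast w)"
  proof (cases "k - 1 = 0")
    case True then show ?thesis unfolding bl True by (simp add: prefix_word_def)
  next
    case False
    then show ?thesis unfolding bl using least[of "k - 1"] k by auto
  qed
  moreover have "w \<noteq> []" using k by (auto simp: w_def prefix_word_def)
  moreover have "hd w \<in> {1..N}"
    using is_word_prefix_word[OF \<omega>, of k] \<open>w \<noteq> []\<close> unfolding w_def is_word_def by (meson hd_in_set subsetD)
  ultimately have "w \<in> cuts (hd w) t"
    using k is_word_prefix_word[OF \<omega>, of k] by (simp add: cuts_def w_def)
  then show ?thesis using k \<open>hd w \<in> {1..N}\<close> unfolding cutset_def w_def by blast
qed

end

section \<open>Cylinder sets and the quantization error\<close>

locale norm_on =
  fixes nrm :: "real^'t \<Rightarrow> real"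
  assumes nrm: "is_norm nrm"
begin

lemma nrm_nonneg: "0 \<le> nrm x" and nrm_eq_0: "nrm x = 0 \<longleftrightarrow> x = 0"
  and nrm_scale: "nrm (k *\<^sub>R x) = \<bar>k\<bar> * nrm x" and nrm_triangle: "nrm (x + y) \<le> nrm x + nrm y"
  using nrm unfolding is_norm_def by blast+

lemma nrm_minus_commute: "nrm (x - y) = nrm (y - x)"
  using nrm_scale[of "-1" "x - y"] by simp

lemma nrm_dist_triangle: "nrm (x - z) \<le> nrm (x - y) + nrm (y - z)"
  using nrm_triangle[of "x - y" "y - z"] by simp

lemma nrm_sum_le: "finite S \<Longrightarrow> nrm (sum g S) \<le> (\<Sum>i\<in>S. nrm (g i))"
proof (induction S rule: finite_induct)
  case empty then show ?case using nrm_eq_0[of 0] by simp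
next
  case (insert i S)
  then show ?case using nrm_triangle[of "g i" "sum g S"] by simp
qed

lemma nrm_le_norm: "\<exists>C>0. \<forall>x. nrm x \<le> C * norm x"
proof -
  define C where "C = (\<Sum>b\<in>Basis. nrm (b :: real^'t)) + 1"
  have "nrm x \<le> C * norm x" for x
  proof -
    have "nrm x = nrm (\<Sum>b\<in>Basis. (x \<bullet> b) *\<^sub>R b)" by (simp only: euclidean_representation)
    also have "\<dots> \<le> (\<Sum>b\<in>Basis. nrm ((x \<bullet> b) *\<^sub>R b))" by (rule nrm_sum_le) simp
    also have "\<dots> \<le> (\<Sum>b\<in>Basis. norm x * nrm b)"
      unfolding nrm_scale using Basis_le_norm nrm_nonneg by (intro sum_mono mult_right_mono) auto
    also have "\<dots> = norm x * (\<Sum>b\<in>Basis. nrm b)" by (simp add: sum_distrib_left)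
    also have "\<dots> \<le> norm x * C" unfolding C_def by (intro mult_left_mono) auto
    finally show ?thesis by (simp add: mult.commute)
  qed
  moreover have "0 < C" unfolding C_def using nrm_nonneg by (simp add: add_nonneg_pos sum_nonneg)
  ultimately show ?thesis by blast
qed

lemma continuous_nrm: "continuous_on S nrm"
proof -
  obtain C where C: "0 < C" "\<forall>x. nrm x \<le> C * norm x" using nrm_le_norm by blast
  have "C-lipschitz_on S nrm"
  proof (rule lipschitz_onI)
    fix x y
    have "nrm x \<le> nrm y + nrm (x - y)" using nrm_triangle[of y "x - y"] by simp
    moreover have "nrm y \<le> nrm x + nrm (x - y)"
      using nrm_triangle[of x "y - x"] nrm_minus_commute[of x y] by simp
    ultimately have "\<bar>nrm x - nrm y\<bar> \<le> nrm (x - y)" by simp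
    also have "\<dots> \<le> C * norm (x - y)" using C by blast
    finally show "dist (nrm x) (nrm y) \<le> C * dist x y" by (simp add: dist_real_def dist_norm)
  qed (use C in simp)
  then show ?thesis by (rule lipschitz_on_continuous_on)
qed

lemma norm_le_nrm: "\<exists>k>0. \<forall>x. k * norm x \<le> nrm x"
proof -
  have "sphere (0::real^'t) 1 \<noteq> {}" by simp
  then obtain z where z: "z \<in> sphere (0::real^'t) 1" "\<forall>y\<in>sphere 0 1. nrm z \<le> nrm y"
    using continuous_attains_inf[OF compact_sphere _ continuous_nrm] by metis
  have k: "0 < nrm z" using z(1) nrm_nonneg[of z] nrm_eq_0[of z] by (auto simp: less_le)
  have "nrm z * norm x \<le> nrm x" for x
  proof (cases "x = 0")
    case False
    then have "nrm z \<le> nrm ((1 / norm x) *\<^sub>R x)" using z(2) by simp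
    then show ?thesis using False unfolding nrm_scale by (simp add: field_simps)
  qed (simp add: nrm_nonneg)
  then show ?thesis using k by blast
qed

lemma borel_measurable_nrm [measurable]: "nrm \<in> borel_measurable borel"
  using continuous_nrm by (rule borel_measurable_continuous_onI)

lemma bounded_nrm:
  assumes "compact A"
  shows "\<exists>B. \<forall>x\<in>A. \<forall>y\<in>A. nrm (x - y) \<le> B"
proof -
  obtain C where C: "0 < C" "\<forall>x. nrm x \<le> C * norm x" using nrm_le_norm by blast
  obtain B where B: "\<forall>x\<in>A. norm x \<le> B" using compact_imp_bounded[OF assms] by (auto simp: bounded_iff)
  have "nrm (x - y) \<le> C * (B + B)" if "x \<in> A" "y \<in> A" for x y
  proof -
    have "norm x \<le> B" "norm y \<le> B" using B that by blast+
    then have "norm (x - y) \<le> B + B" using norm_triangle_ineq4[of x y] by linarith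
    then have "C * norm (x - y) \<le> C * (B + B)" using C by (intro mult_left_mono) auto
    then show ?thesis using C(2) order_trans by blast
  qed
  then show ?thesis by blast
qed

lemma bdd_above_diam:
  assumes "compact A"
  shows "bdd_above ((\<lambda>(x, y). nrm (x - y)) ` (A \<times> A))"
proof -
  obtain B where "\<forall>x\<in>A. \<forall>y\<in>A. nrm (x - y) \<le> B" using bounded_nrm[OF assms] by blast
  then show ?thesis by (intro bdd_aboveI2[of _ _ B]) auto
qed

lemma nrm_le_diam:
  assumes "compact A" "x \<in> A" "y \<in> A"
  shows "nrm (x - y) \<le> norm_diam nrm A"
proof -
  have "(\<lambda>(x, y). nrm (x - y)) (x, y) \<le> norm_diam nrm A"
    unfolding norm_diam_def using assms bdd_above_diam by (intro cSUP_upper) auto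
  then show ?thesis by simp
qed

lemma norm_diam_mono:
  assumes "compact A" "B \<subseteq> A" "B \<noteq> {}"
  shows "norm_diam nrm B \<le> norm_diam nrm A"
  unfolding norm_diam_def using assms bdd_above_diam by (intro cSUP_subset_mono) auto

lemma setdist_le:
  assumes "x \<in> A" "y \<in> B"
  shows "norm_setdist nrm A B \<le> nrm (x - y)"
proof -
  have "norm_setdist nrm A B \<le> (\<lambda>(x, y). nrm (x - y)) (x, y)"
    unfolding norm_setdist_def
    by (rule cINF_lower) (use assms nrm_nonneg in \<open>auto intro!: bdd_belowI2[of _ 0]\<close>)
  then show ?thesis by simp
qed

lemma infdist_le: "x \<in> \<alpha> \<Longrightarrow> norm_infdist nrm y \<alpha> \<le> nrm (y - x)"
  unfolding norm_infdist_def
  by (rule cINF_lower) (use nrm_nonneg in \<open>auto intro!: bdd_belowI2[of _ 0]\<close>)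

lemma infdist_ge: "\<alpha> \<noteq> {} \<Longrightarrow> (\<And>x. x \<in> \<alpha> \<Longrightarrow> B \<le> nrm (y - x)) \<Longrightarrow> B \<le> norm_infdist nrm y \<alpha>"
  unfolding norm_infdist_def by (rule cINF_greatest)

lemma measurable_infdist:
  assumes "finite \<alpha>" "\<alpha> \<noteq> {}"
  shows "(\<lambda>y. norm_infdist nrm y \<alpha>) \<in> borel_measurable borel"
proof -
  have "norm_infdist nrm y \<alpha> = Min ((\<lambda>x. nrm (y - x)) ` \<alpha>)" for y
    unfolding norm_infdist_def using assms by (intro cInf_eq_Min) auto
  moreover have "(\<lambda>y. Min ((\<lambda>x. nrm (y - x)) ` \<alpha>)) \<in> borel_measurable borel"
    by (rule borel_measurable_Min[OF assms(1)]) measurable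
  ultimately show ?thesis by simp
qed

text \<open>
  A similarity for \<open>nrm\<close> is Lipschitz for the Euclidean norm, hence continuous.
\<close>

lemma compact_similar:
  assumes "geom_similar nrm A B" "compact B"
  shows "compact A"
proof -
  obtain f \<rho> where f: "\<rho> > 0" "\<forall>x y. nrm (f x - f y) = \<rho> * nrm (x - y)" "A = f ` B"
    using assms(1) unfolding geom_similar_def by blast
  obtain C where C: "0 < C" "\<forall>x. nrm x \<le> C * norm x" using nrm_le_norm by blast
  obtain k where k: "0 < k" "\<forall>x. k * norm x \<le> nrm x" using norm_le_nrm by blast
  have "(\<rho> * C / k)-lipschitz_on B f"
  proof (rule lipschitz_onI)
    fix x y
    have "k * norm (f x - f y) \<le> nrm (f x - f y)" using k by blast
    also have "\<dots> = \<rho> * nrm (x - y)" using f by blast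
    also have "\<dots> \<le> \<rho> * (C * norm (x - y))" using f(1) C(2) by (intro mult_left_mono) auto
    finally show "dist (f x) (f y) \<le> \<rho> * C / k * dist x y"
      using k(1) by (simp add: dist_norm field_simps)
  qed (use f C k in auto)
  then have "continuous_on B f" by (rule lipschitz_on_continuous_on)
  then show ?thesis unfolding f(3) using assms(2) by (rule compact_continuous_image)
qed

end

locale cylinder_system = markov_words N p c r + norm_on nrm
  for N p c r and nrm :: "real^'t \<Rightarrow> real" +
  fixes q :: "nat \<Rightarrow> real" and J :: "nat list \<Rightarrow> (real^'t) set" and M :: "(nat \<Rightarrow> nat) measure" and t0 :: real
  assumes q_pos: "\<And>i. i \<in> {1..N} \<Longrightarrow> 0 < q i"
    and q_sum: "(\<Sum>i=1..N. q i) = 1"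
    and J: "is_cylinder_system nrm N p c J"
    and t0: "0 < t0"
    and separation:
      "\<And>\<sigma> i1 i2. \<sigma> \<in> all_words N p \<Longrightarrow> i1 \<noteq> i2 \<Longrightarrow>
         \<sigma> @ [i1] \<in> all_words N p \<Longrightarrow> \<sigma> @ [i2] \<in> all_words N p \<Longrightarrow>
         norm_setdist nrm (J (\<sigma> @ [i1])) (J (\<sigma> @ [i2]))
           \<ge> t0 * max (norm_diam nrm (J (\<sigma> @ [i1]))) (norm_diam nrm (J (\<sigma> @ [i2])))"
    and M: "is_markov_measure N p q M"
begin

lemma J_single: "i \<in> {1..N} \<Longrightarrow> J [i] \<noteq> {} \<and> compact (J [i]) \<and> norm_diam nrm (J [i]) = 1"
  using J unfolding is_cylinder_system_def by blast

lemma J_snoc: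
  assumes "is_word (w @ [i])" "w \<noteq> []"
  shows "J (w @ [i]) \<subseteq> J w" "geom_similar nrm (J (w @ [i])) (J [i])"
    "norm_diam nrm (J (w @ [i])) / norm_diam nrm (J w) = c (last w) i"
proof -
  have w: "w \<in> words N p (length w)" "w @ [i] \<in> words N p (length w + 1)" "1 \<le> length w"
    using assms is_word_append[of w "[i]"] by (auto simp: words_iff Suc_le_eq)
  show "J (w @ [i]) \<subseteq> J w" "geom_similar nrm (J (w @ [i])) (J [i])"
    "norm_diam nrm (J (w @ [i])) / norm_diam nrm (J w) = c (last w) i"
    using J w unfolding is_cylinder_system_def by blast+
qed

lemma path_prod_c_pos: "is_word w \<Longrightarrow> 0 < path_prod c w"
proof (induction w rule: induct_list012)
  case (3 i j w)
  then show ?case using edgeD(3)[of i j] by (simp add: is_word_Cons)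
qed simp_all

lemma J_word:
  assumes "is_word w" "w \<noteq> []"
  shows "compact (J w) \<and> J w \<noteq> {} \<and> norm_diam nrm (J w) = path_prod c w"
  using assms
proof (induction w rule: rev_induct)
  case (snoc i w)
  have i: "i \<in> {1..N}" using snoc.prems by (simp add: is_word_def)
  show ?case
  proof (cases "w = []")
    case True
    then show ?thesis using J_single[OF i] by simp
  next
    case False
    have w: "is_word w" using is_word_append[of w "[i]"] snoc.prems by simp
    note IH = snoc.IH[OF w False]
    note Js = J_snoc[OF snoc.prems(1) False]
    have "compact (J (w @ [i]))" using compact_similar[OF Js(2)] J_single[OF i] by blast
    moreover have "J (w @ [i]) \<noteq> {}" using Js(2) J_single[OF i] by (auto simp: geom_similar_def)
    moreover have "norm_diam nrm (J (w @ [i])) = path_prod c (w @ [i])"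
      using Js(3) IH path_prod_c_pos[OF w] path_prod_snoc[OF False, of c i] by (simp add: field_simps)
    ultimately show ?thesis by blast
  qed
qed simp

lemma J_diam: "is_word w \<Longrightarrow> w \<noteq> [] \<Longrightarrow> x \<in> J w \<Longrightarrow> y \<in> J w \<Longrightarrow> nrm (x - y) \<le> norm_diam nrm (J w)"
  by (rule nrm_le_diam) (simp_all add: J_word)

lemma J_prefix: "is_word (v @ w) \<Longrightarrow> v \<noteq> [] \<Longrightarrow> J (v @ w) \<subseteq> J v"
proof (induction w rule: rev_induct)
  case (snoc i w)
  have "is_word (v @ w)" using is_word_append[of "v @ w" "[i]"] snoc.prems by simp
  then show ?case using snoc J_snoc(1)[of "v @ w" i] by auto
qed simp

definition "cmax = Max ((\<lambda>(i, j). c i j) ` edges)"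

lemma cmax: "0 < cmax" "cmax < 1" "(i, j) \<in> edges \<Longrightarrow> c i j \<le> cmax"
proof -
  have ne: "(\<lambda>(i, j). c i j) ` edges \<noteq> {}" using edges_nonempty by simp
  have fe: "finite ((\<lambda>(i, j). c i j) ` edges)" using finite_edges by simp
  show le: "c i j \<le> cmax" if "(i, j) \<in> edges" for i j
    unfolding cmax_def by (rule Max_ge[OF fe]) (use that in \<open>auto intro!: image_eqI[of _ _ "(i, j)"]\<close>)
  show "cmax < 1" unfolding cmax_def using fe ne edgeD(4) by (subst Max_less_iff) auto
  obtain i j where "(i, j) \<in> edges" using edges_nonempty by auto
  then show "0 < cmax" using le[of i j] edgeD(3)[of i j] by simp
qed

lemma path_prod_c_le: "is_word w \<Longrightarrow> path_prod c w \<le> cmax ^ (length w - 1)"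
proof (induction w rule: induct_list012)
  case (3 i j w)
  then have e: "(i, j) \<in> edges" "is_word (j # w)" by (auto simp: is_word_Cons)
  have "c i j * path_prod c (j # w) \<le> cmax * cmax ^ (length (j # w) - 1)"
    using cmax(1) cmax(3)[OF e(1)] 3(2)[OF e(2)] path_prod_c_pos[OF e(2)] by (intro mult_mono) auto
  then show ?case by simp
qed simp_all

lemma prefix_word_append: "m \<le> n \<Longrightarrow> \<exists>u. prefix_word \<omega> n = prefix_word \<omega> m @ u"
  unfolding prefix_word_def using upt_add_eq_append[of 0 m "n - m"] by auto

lemma length_prefix_word [simp]: "length (prefix_word \<omega> k) = k"
  by (simp add: prefix_word_def)

lemma prefix_word_nonempty: "1 \<le> k \<Longrightarrow> prefix_word \<omega> k \<noteq> []"
  by (metis length_prefix_word list.size(3) not_one_le_zero)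

text \<open>
  The intersection that defines the coding map is a singleton: the sets are nested, compact and nonempty, and their diameters
  tend to 0.
\<close>

lemma coding_map_in:
  assumes \<omega>: "\<omega> \<in> inf_words N p" and k: "1 \<le> k"
  shows "coding_map J \<omega> \<in> J (prefix_word \<omega> k)"
proof -
  let ?F = "\<lambda>n. J (prefix_word \<omega> (Suc n))"
  have w: "is_word (prefix_word \<omega> n)" for n by (rule is_word_prefix_word[OF \<omega>])
  have ne: "prefix_word \<omega> (Suc n) \<noteq> []" for n by (rule prefix_word_nonempty) simp
  have "\<Inter>(range ?F) \<noteq> {}"
  proof (rule compact_nest)
    show "compact (?F n)" "?F n \<noteq> {}" for n using J_word[OF w ne] by auto
    show "?F n \<subseteq> ?F m" if mn: "m \<le> n" for m n
    proof -
      obtain u where "prefix_word \<omega> (Suc n) = prefix_word \<omega> (Suc m) @ u"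
        using prefix_word_append[of "Suc m" "Suc n" \<omega>] mn by auto
      then show ?thesis using J_prefix[of "prefix_word \<omega> (Suc m)" u] w[of "Suc n"] ne by simp
    qed
  qed
  then obtain x where x: "\<And>n. x \<in> ?F n" by blast
  have "y = x" if y: "\<And>n. y \<in> ?F n" for y
  proof -
    have "nrm (y - x) \<le> cmax ^ n" for n
    proof -
      have "nrm (y - x) \<le> norm_diam nrm (?F n)"
        using nrm_le_diam[of "?F n" y x] J_word[OF w ne] x y by blast
      also have "\<dots> = path_prod c (prefix_word \<omega> (Suc n))" using J_word[OF w ne] by blast
      also have "\<dots> \<le> cmax ^ n" using path_prod_c_le[OF w, of "Suc n"] by simp
      finally show ?thesis .
    qed
    moreover have "(\<lambda>n. cmax ^ n) \<longlonglongrightarrow> 0" using cmax by (intro LIMSEQ_power_zero) simp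
    ultimately have "nrm (y - x) \<le> 0" by (intro LIMSEQ_le_const) auto
    then show ?thesis using nrm_nonneg[of "y - x"] nrm_eq_0[of "y - x"] by simp
  qed
  then have "(\<Inter>k\<in>{1..}. J (prefix_word \<omega> k)) = {x}"
  proof -
    assume uniq: "\<And>y. (\<And>n. y \<in> ?F n) \<Longrightarrow> y = x"
    have eq: "(\<Inter>k\<in>{1..}. J (prefix_word \<omega> k)) = (\<Inter>n. ?F n)"
    proof (intro equalityI subsetI INT_I)
      fix y n assume "y \<in> (\<Inter>k\<in>{1..}. J (prefix_word \<omega> k))"
      then show "y \<in> ?F n" by simp
    next
      fix y k assume y: "y \<in> (\<Inter>n. ?F n)" and "k \<in> {1::nat..}"
      then obtain n where "k = Suc n" by (cases k) auto
      then show "y \<in> J (prefix_word \<omega> k)" using y by blast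
    qed
    show ?thesis unfolding eq using uniq x by blast
  qed
  then have "coding_map J \<omega> = x" unfolding coding_map_def by simp
  moreover obtain n where "k = Suc n" using k by (cases k) auto
  ultimately show ?thesis using x by simp
qed

lemma space_M: "space M = inf_words N p" and prob_M: "prob_space M"
  using M by (auto simp: is_markov_measure_def)

lemma cylinder_sets:
  assumes "is_word w" "w \<noteq> []"
  shows "cylinder N p w \<in> sets M"
proof -
  have S: "sets M = sigma_sets (inf_words N p) {cylinder N p \<sigma> | k \<sigma>. 1 \<le> k \<and> \<sigma> \<in> words N p k}"
    using M by (simp add: is_markov_measure_def)
  have "1 \<le> length w \<and> w \<in> words N p (length w)" using assms by (simp add: words_iff Suc_le_eq)
  then show ?thesis unfolding S by (intro sigma_sets.Basic) blast
qed

lemma path_prod_a: "is_word w \<Longrightarrow> path_prod a w = path_prod p w * path_prod c w powr r"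
proof (induction w rule: induct_list012)
  case (3 i j w)
  then have e: "(i, j) \<in> edges" "is_word (j # w)" by (auto simp: is_word_Cons)
  show ?case using 3(2)[OF e(2)] edgeD(3)[OF e(1)] path_prod_c_pos[OF e(2)]
    by (simp add: a_def powr_mult)
qed simp_all

lemma measure_cylinder:
  assumes "is_word w" "w \<noteq> []"
  shows "measure M (cylinder N p w) = q (hd w) * path_prod p w"
proof -
  have "1 \<le> length w" "w \<in> words N p (length w)" using assms by (auto simp: words_iff Suc_le_eq)
  then show ?thesis using M assms(2)
    by (simp add: is_markov_measure_def path_prod_conv_prod hd_conv_nth)
qed

lemma cylinder_weight:
  assumes "is_word w" "w \<noteq> []"
  shows "measure M (cylinder N p w) * norm_diam nrm (J w) powr r = q (hd w) * path_prod a w"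
  using assms J_word[OF assms] by (simp add: measure_cylinder path_prod_a)

text \<open>
  The coding map is the pointwise limit of maps that pick a point of \<open>J\<^sub>\<sigma>\<close> for the initial segment \<open>\<sigma>\<close> of length
  \<open>n + 1\<close>. These are measurable since they depend only on a prefix.
\<close>

lemma measurable_coding_map: "coding_map J \<in> borel_measurable M"
proof -
  define pt where "pt w = (SOME x. x \<in> J w)" for w
  have pt: "pt w \<in> J w" if "is_word w" "w \<noteq> []" for w
    unfolding pt_def using J_word[OF that] by (simp add: some_in_eq)
  obtain k where k: "0 < k" "\<forall>x. k * norm x \<le> nrm x" using norm_le_nrm by blast
  show ?thesis
  proof (rule borel_measurable_LIMSEQ_metric)
    fix n
    have "(\<lambda>\<omega>. prefix_word \<omega> (Suc n)) \<in> measurable M (count_space UNIV)"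
    proof (subst measurable_count_space_eq2_countable, safe)
      fix w
      show "(\<lambda>\<omega>. prefix_word \<omega> (Suc n)) -` {w} \<inter> space M \<in> sets M"
      proof (cases "is_word w \<and> length w = Suc n")
        case True
        then have "(\<lambda>\<omega>. prefix_word \<omega> (Suc n)) -` {w} \<inter> space M = cylinder N p w"
          unfolding space_M by (auto simp: cylinder_def)
        moreover have "w \<noteq> []" using True by auto
        ultimately show ?thesis using cylinder_sets True by simp
      next
        case False
        then have "(\<lambda>\<omega>. prefix_word \<omega> (Suc n)) -` {w} \<inter> space M = {}"
          unfolding space_M using is_word_prefix_word by auto
        then show ?thesis by simp
      qed
    qed simp_all
    then show "(\<lambda>\<omega>. pt (prefix_word \<omega> (Suc n))) \<in> borel_measurable M"
      by (rule measurable_compose) simp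
  next
    fix \<omega> assume "\<omega> \<in> space M"
    then have \<omega>: "\<omega> \<in> inf_words N p" by (simp add: space_M)
    have bound: "norm (pt (prefix_word \<omega> (Suc n)) - coding_map J \<omega>) \<le> cmax ^ n / k" for n
    proof -
      let ?w = "prefix_word \<omega> (Suc n)"
      have w: "is_word ?w" "?w \<noteq> []" using is_word_prefix_word[OF \<omega>] prefix_word_nonempty by auto
      have "k * norm (pt ?w - coding_map J \<omega>) \<le> nrm (pt ?w - coding_map J \<omega>)" using k by blast
      also have "\<dots> \<le> norm_diam nrm (J ?w)"
        using pt[OF w] coding_map_in[OF \<omega>, of "Suc n"] by (intro J_diam[OF w]) simp_all
      also have "\<dots> \<le> cmax ^ n" using J_word[OF w] path_prod_c_le[OF w(1)] by simp
      finally show ?thesis using k(1) by (simp add: field_simps)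
    qed
    have lim: "(\<lambda>n. cmax ^ n / k) \<longlonglongrightarrow> 0"
      using cmax by (intro tendsto_divide_zero LIMSEQ_power_zero) simp
    have "(\<lambda>n. pt (prefix_word \<omega> (Suc n)) - coding_map J \<omega>) \<longlonglongrightarrow> 0"
      by (rule Lim_null_comparison[OF _ lim]) (rule always_eventually, rule allI, rule bound)
    then show "(\<lambda>n. pt (prefix_word \<omega> (Suc n))) \<longlonglongrightarrow> coding_map J \<omega>"
      by (rule LIM_zero_cancel)
  qed
qed

definition "cost \<alpha> = (\<integral>x. norm_infdist nrm x \<alpha> powr r \<partial>(markov_type_measure J M))"
definition "codebooks n = {\<alpha> :: (real^'t) set. finite \<alpha> \<and> 1 \<le> card \<alpha> \<and> card \<alpha> \<le> n}"
definition "opt n = (INF \<alpha>\<in>codebooks n. cost \<alpha>)"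

lemma codebookD: "\<alpha> \<in> codebooks n \<Longrightarrow> finite \<alpha> \<and> \<alpha> \<noteq> {}"
  by (auto simp: codebooks_def)

lemma codebooks_nonempty: "1 \<le> n \<Longrightarrow> codebooks n \<noteq> {}"
  by (auto simp: codebooks_def intro!: exI[of _ "{0}"])

lemma cost_eq:
  assumes "\<alpha> \<in> codebooks n"
  shows "cost \<alpha> = (\<integral>\<omega>. norm_infdist nrm (coding_map J \<omega>) \<alpha> powr r \<partial>M)"
proof -
  have [measurable]: "(\<lambda>y. norm_infdist nrm y \<alpha>) \<in> borel_measurable borel"
    using measurable_infdist codebookD[OF assms] by blast
  show ?thesis unfolding cost_def markov_type_measure_def
    by (rule integral_distr[OF measurable_coding_map]) measurable
qed

lemma cost_nonneg: "0 \<le> cost \<alpha>"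
  unfolding cost_def by (rule Bochner_Integration.integral_nonneg) simp

lemma quantization_error_eq: "1 \<le> n \<Longrightarrow> quantization_error nrm (markov_type_measure J M) n r powr r = opt n"
proof -
  assume n: "1 \<le> n"
  have "0 \<le> opt n" unfolding opt_def using codebooks_nonempty[OF n] cost_nonneg by (intro cINF_greatest)
  moreover have "quantization_error nrm (markov_type_measure J M) n r = opt n powr (1 / r)"
    unfolding quantization_error_def opt_def codebooks_def cost_def ..
  ultimately show ?thesis using r by (simp add: powr_powr)
qed

lemma opt_le: "\<alpha> \<in> codebooks n \<Longrightarrow> opt n \<le> cost \<alpha>"
  unfolding opt_def by (rule cINF_lower) (use cost_nonneg in \<open>auto intro!: bdd_belowI2[of _ 0]\<close>)

lemma opt_antimono: "1 \<le> m \<Longrightarrow> m \<le> n \<Longrightarrow> opt n \<le> opt m"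
  unfolding opt_def using codebooks_nonempty
  by (intro cINF_superset_mono) (auto simp: codebooks_def intro!: bdd_belowI2[of _ 0] cost_nonneg)

lemma integrable_infdist:
  assumes \<alpha>: "\<alpha> \<in> codebooks n"
  shows "integrable M (\<lambda>\<omega>. norm_infdist nrm (coding_map J \<omega>) \<alpha> powr r)"
proof -
  interpret prob_space M by (rule prob_M)
  obtain z where z: "z \<in> \<alpha>" using codebookD[OF \<alpha>] by blast
  define K where "K = (\<Union>i\<in>{1..N}. J [i])"
  have "compact (insert z K)"
    unfolding K_def using J_single by (intro compact_insert compact_UN) auto
  then obtain B where B: "\<forall>x\<in>insert z K. \<forall>y\<in>insert z K. nrm (x - y) \<le> B" using bounded_nrm by blast
  have [measurable]: "(\<lambda>y. norm_infdist nrm y \<alpha>) \<in> borel_measurable borel"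
    using measurable_infdist codebookD[OF \<alpha>] by blast
  note measurable_coding_map [measurable]
  show ?thesis
  proof (rule integrable_const_bound[where B = "B powr r"])
    show "AE \<omega> in M. norm (norm_infdist nrm (coding_map J \<omega>) \<alpha> powr r) \<le> B powr r"
    proof (rule AE_I2)
      fix \<omega> assume "\<omega> \<in> space M"
      then have \<omega>: "\<omega> \<in> inf_words N p" by (simp add: space_M)
      have "coding_map J \<omega> \<in> J [\<omega> 0]" using coding_map_in[OF \<omega>, of 1] by (simp add: prefix_word_def)
      moreover have "\<omega> 0 \<in> {1..N}" using \<omega> by (auto simp: inf_words_def)
      ultimately have "coding_map J \<omega> \<in> K" unfolding K_def by blast
      then have "nrm (coding_map J \<omega> - z) \<le> B" using B by blast
      then have "norm_infdist nrm (coding_map J \<omega>) \<alpha> \<le> B" using infdist_le[OF z] order_trans by blast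
      moreover have "0 \<le> norm_infdist nrm (coding_map J \<omega>) \<alpha>"
        using codebookD[OF \<alpha>] nrm_nonneg by (intro infdist_ge) auto
      ultimately show "norm (norm_infdist nrm (coding_map J \<omega>) \<alpha> powr r) \<le> B powr r"
        using r by (simp add: powr_mono2)
    qed
  qed measurable
qed

lemma in_cylinder: "\<omega> \<in> cylinder N p w \<longleftrightarrow> \<omega> \<in> inf_words N p \<and> prefix_word \<omega> (length w) = w"
  by (auto simp: cylinder_def)

lemma integral_cylinder_sum:
  assumes "finite S" "\<forall>w\<in>S. is_word w \<and> w \<noteq> []"
  shows "integrable M (\<lambda>\<omega>. \<Sum>w\<in>S. indicat_real (cylinder N p w) \<omega> * g w)"
    "(\<integral>\<omega>. (\<Sum>w\<in>S. indicat_real (cylinder N p w) \<omega> * g w) \<partial>M) = (\<Sum>w\<in>S. measure M (cylinder N p w) * g w)"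
proof -
  interpret prob_space M by (rule prob_M)
  have i: "integrable M (\<lambda>\<omega>. indicat_real (cylinder N p w) \<omega> * g w)" if "w \<in> S" for w
    using cylinder_sets assms(2) that by (intro integrable_mult_left integrable_real_indicator) (auto simp: emeasure_eq_measure)
  then show "integrable M (\<lambda>\<omega>. \<Sum>w\<in>S. indicat_real (cylinder N p w) \<omega> * g w)" by simp
  have m: "(\<integral>\<omega>. indicat_real (cylinder N p w) \<omega> * g w \<partial>M) = measure M (cylinder N p w) * g w" if "w \<in> S" for w
  proof -
    have "cylinder N p w \<inter> space M = cylinder N p w" unfolding space_M by (auto simp: cylinder_def)
    then show ?thesis by simp
  qed
  have "(\<integral>\<omega>. (\<Sum>w\<in>S. indicat_real (cylinder N p w) \<omega> * g w) \<partial>M)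
      = (\<Sum>w\<in>S. \<integral>\<omega>. indicat_real (cylinder N p w) \<omega> * g w \<partial>M)"
    by (rule Bochner_Integration.integral_sum) (rule i)
  also have "\<dots> = (\<Sum>w\<in>S. measure M (cylinder N p w) * g w)" using m by (rule sum.cong[OF refl])
  finally show "(\<integral>\<omega>. (\<Sum>w\<in>S. indicat_real (cylinder N p w) \<omega> * g w) \<partial>M) = (\<Sum>w\<in>S. measure M (cylinder N p w) * g w)" .
qed

lemma q_le_1: "i \<in> {1..N} \<Longrightarrow> q i \<le> 1"
  using member_le_sum[of i "{1..N}" q] q_sum q_pos by (force intro: less_imp_le)

lemma hd_word: "is_word w \<Longrightarrow> w \<noteq> [] \<Longrightarrow> hd w \<in> {1..N}"
  unfolding is_word_def by (meson hd_in_set subsetD)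

text \<open>
  One point in each cylinder of the cut set.
\<close>

lemma opt_upper:
  assumes t: "0 \<le> t" and n: "card (cutset t) \<le> n"
  shows "opt n \<le> real n * exp (- t)"
proof -
  interpret prob_space M by (rule prob_M)
  define pt where "pt w = (SOME x. x \<in> J w)" for w
  have pt: "pt w \<in> J w" if "w \<in> cutset t" for w
    unfolding pt_def using J_word cutset_word[OF that] by (simp add: some_in_eq)
  define \<alpha> where "\<alpha> = pt ` cutset t"
  obtain \<omega>0 where "\<omega>0 \<in> inf_words N p" using not_empty space_M by blast
  then have "cutset t \<noteq> {}" using cutset_cover[OF _ t] by blast
  then have \<alpha>: "\<alpha> \<in> codebooks n"
    unfolding codebooks_def \<alpha>_def using finite_cutset n card_image_le[OF finite_cutset, of pt t]
    by (auto simp: Suc_le_eq card_gt_0_iff)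
  let ?g = "\<lambda>\<omega>. \<Sum>w\<in>cutset t. indicat_real (cylinder N p w) \<omega> * norm_diam nrm (J w) powr r"
  have cw: "is_word w \<and> w \<noteq> []" if "w \<in> cutset t" for w by (rule cutset_word[OF that])
  then have cwB: "\<forall>w\<in>cutset t. is_word w \<and> w \<noteq> []" by blast
  have "cost \<alpha> \<le> (\<integral>\<omega>. ?g \<omega> \<partial>M)"
    unfolding cost_eq[OF \<alpha>]
  proof (rule integral_mono[OF integrable_infdist[OF \<alpha>] integral_cylinder_sum(1)[OF finite_cutset cwB]])
    fix \<omega> assume "\<omega> \<in> space M"
    then have \<omega>: "\<omega> \<in> inf_words N p" by (simp add: space_M)
    obtain k where k: "1 \<le> k" "prefix_word \<omega> k \<in> cutset t" using cutset_cover[OF \<omega> t] by blast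
    let ?w = "prefix_word \<omega> k"
    have "norm_infdist nrm (coding_map J \<omega>) \<alpha> \<le> nrm (coding_map J \<omega> - pt ?w)"
      using k by (intro infdist_le) (auto simp: \<alpha>_def)
    also have "\<dots> \<le> norm_diam nrm (J ?w)"
      using cw[OF k(2)] coding_map_in[OF \<omega> k(1)] pt[OF k(2)] by (intro J_diam) simp_all
    finally have "norm_infdist nrm (coding_map J \<omega>) \<alpha> powr r \<le> norm_diam nrm (J ?w) powr r"
      using r codebookD[OF \<alpha>] nrm_nonneg by (intro powr_mono2 infdist_ge) auto
    also have "\<dots> = indicat_real (cylinder N p ?w) \<omega> * norm_diam nrm (J ?w) powr r"
      using \<omega> by (simp add: in_cylinder)
    also have "\<dots> \<le> ?g \<omega>"
      using k(2) finite_cutset by (intro member_le_sum) auto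
    finally show "norm_infdist nrm (coding_map J \<omega>) \<alpha> powr r \<le> ?g \<omega>" .
  qed
  also have "\<dots> = (\<Sum>w\<in>cutset t. q (hd w) * path_prod a w)"
    unfolding integral_cylinder_sum(2)[OF finite_cutset cwB] using cylinder_weight cw by (intro sum.cong) auto
  also have "\<dots> \<le> (\<Sum>w\<in>cutset t. 1 * exp (- t))"
    using cutset_weight(2)[OF _ t] q_le_1 hd_word cw q_pos path_prod_bounds
    by (intro sum_mono mult_mono) (auto intro: less_imp_le)
  also have "\<dots> = real (card (cutset t)) * exp (- t)" by simp
  also have "\<dots> \<le> real n * exp (- t)" using n by (intro mult_right_mono) auto
  finally show ?thesis using opt_le[OF \<alpha>] by simp
qed

text \<open>
  Two words of the cut set branch at some letter; the separation condition applies to the two cylinders at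
  the branching, which contain the given ones and are at least as large.
\<close>

lemma cutset_separated:
  assumes v: "v \<in> cutset t" and w: "w \<in> cutset t" and ne: "v \<noteq> w" and x: "x \<in> J v" and y: "y \<in> J w"
  shows "t0 * max (norm_diam nrm (J v)) (norm_diam nrm (J w)) \<le> nrm (x - y)"
proof -
  have "v \<parallel> w" using cutset_prefix_free[OF v w] cutset_prefix_free[OF w v] ne by auto
  then obtain u i v' j w' where d: "i \<noteq> j" "v = u @ i # v'" "w = u @ j # w'"
    using parallel_decomp by blast
  have vw: "is_word ((u @ [i]) @ v')" "is_word ((u @ [j]) @ w')"
    using cutset_word[OF v] cutset_word[OF w] d by auto
  have ui: "is_word (u @ [i])" "is_word (u @ [j])" "is_word u"
    using is_word_append[OF vw(1)] is_word_append[OF vw(2)] is_word_append[of u "[i]"] by auto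
  have sub: "J v \<subseteq> J (u @ [i])" "J w \<subseteq> J (u @ [j])"
    using J_prefix[OF vw(1)] J_prefix[OF vw(2)] d by auto
  have dm: "norm_diam nrm (J v) \<le> norm_diam nrm (J (u @ [i]))"
    "norm_diam nrm (J w) \<le> norm_diam nrm (J (u @ [j]))"
    by (rule norm_diam_mono[OF _ sub(1)], use J_word[OF ui(1)] x in simp, use x in blast)
      (rule norm_diam_mono[OF _ sub(2)], use J_word[OF ui(2)] y in simp, use y in blast)
  have "t0 * max (norm_diam nrm (J v)) (norm_diam nrm (J w))
      \<le> t0 * max (norm_diam nrm (J (u @ [i]))) (norm_diam nrm (J (u @ [j])))"
    using dm t0 by (intro mult_left_mono) (auto simp: max.coboundedI1 max.coboundedI2)
  also have "\<dots> \<le> norm_setdist nrm (J (u @ [i])) (J (u @ [j]))"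
    using separation[of u i j] ui d(1) by (simp add: all_words_iff)
  also have "\<dots> \<le> nrm (x - y)" using sub x y by (intro setdist_le) auto
  finally show ?thesis .
qed

text \<open>
  A word is bad if the codebook has a point within half the separation distance of its cylinder. Different bad
  words use different points, so at most \<open>n\<close> words are bad, and each of the at least \<open>n\<close> others
  contributes a fixed multiple of \<open>e\<^bsup>-t\<^esup>\<close>.
\<close>

lemma opt_lower: "\<exists>k>0. \<forall>t n. 0 \<le> t \<longrightarrow> 1 \<le> n \<longrightarrow> 2 * n \<le> card (cutset t) \<longrightarrow> k * (real n * exp (- t)) \<le> opt n"
proof -
  interpret prob_space M by (rule prob_M)
  define qmin where "qmin = Min (q ` {1..N})"
  have qmin: "0 < qmin" "\<And>i. i \<in> {1..N} \<Longrightarrow> qmin \<le> q i"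
    unfolding qmin_def using N q_pos by (auto simp: Min_gr_iff)
  define k where "k = (t0 / 2) powr r * (qmin * exp (- lmax))"
  have k: "0 < k" using t0 qmin by (simp add: k_def)
  have "k * (real n * exp (- t)) \<le> opt n" if t: "0 \<le> t" and n: "1 \<le> n" and card: "2 * n \<le> card (cutset t)" for t n
    unfolding opt_def
  proof (rule cINF_greatest[OF codebooks_nonempty[OF n]])
    fix \<alpha> assume \<alpha>: "\<alpha> \<in> codebooks n"
    define bad where "bad = {w \<in> cutset t. \<exists>x\<in>J w. \<exists>y\<in>\<alpha>. nrm (x - y) < t0 / 2 * norm_diam nrm (J w)}"
    define good where "good = cutset t - bad"
    have "card bad \<le> card \<alpha>"
    proof -
      have "\<forall>w\<in>bad. \<exists>y. y \<in> \<alpha> \<and> (\<exists>x\<in>J w. nrm (x - y) < t0 / 2 * norm_diam nrm (J w))"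
        unfolding bad_def by blast
      then obtain h where h: "\<forall>w\<in>bad. h w \<in> \<alpha> \<and> (\<exists>x\<in>J w. nrm (x - h w) < t0 / 2 * norm_diam nrm (J w))"
        by metis
      have "inj_on h bad"
      proof (rule inj_onI, rule ccontr)
        fix v w assume vw: "v \<in> bad" "w \<in> bad" "h v = h w" "v \<noteq> w"
        obtain x where x: "x \<in> J v" "nrm (x - h v) < t0 / 2 * norm_diam nrm (J v)" using h vw by blast
        obtain y where y: "y \<in> J w" "nrm (y - h w) < t0 / 2 * norm_diam nrm (J w)" using h vw by blast
        have "t0 * max (norm_diam nrm (J v)) (norm_diam nrm (J w)) \<le> nrm (x - y)"
          using cutset_separated[of v t w] vw x y unfolding bad_def by blast
        also have "\<dots> \<le> nrm (x - h v) + nrm (h v - y)" by (rule nrm_dist_triangle)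
        also have "\<dots> < t0 / 2 * norm_diam nrm (J v) + t0 / 2 * norm_diam nrm (J w)"
          using x(2) y(2) nrm_minus_commute[of "h w" y] vw(3) by simp
        also have "\<dots> \<le> t0 / 2 * max (norm_diam nrm (J v)) (norm_diam nrm (J w))
            + t0 / 2 * max (norm_diam nrm (J v)) (norm_diam nrm (J w))"
          using t0 by (intro add_mono mult_left_mono) auto
        finally show False by simp
      qed
      moreover have "h ` bad \<subseteq> \<alpha>" using h by blast
      ultimately show ?thesis using codebookD[OF \<alpha>] by (meson card_inj_on_le)
    qed
    also have "card \<alpha> \<le> n" using \<alpha> by (simp add: codebooks_def)
    finally have "n \<le> card good"
      using card card_Diff_subset[of bad "cutset t"] finite_cutset finite_subset[of bad "cutset t"]
      unfolding good_def bad_def by fastforce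
    let ?D = "\<lambda>w. (t0 / 2 * norm_diam nrm (J w)) powr r"
    let ?g = "\<lambda>\<omega>. \<Sum>w\<in>good. indicat_real (cylinder N p w) \<omega> * ?D w"
    have gw: "is_word w \<and> w \<noteq> []" if "w \<in> good" for w using cutset_word[of w t] that by (simp add: good_def)
    then have gwB: "\<forall>w\<in>good. is_word w \<and> w \<noteq> []" by blast
    have fg: "finite good" using finite_cutset by (simp add: good_def)
    have "k * (real n * exp (- t)) \<le> real (card good) * (k * exp (- t))"
      using \<open>n \<le> card good\<close> k by (simp add: mult_right_mono)
    also have "\<dots> = (\<Sum>w\<in>good. k * exp (- t))" by simp
    also have "\<dots> \<le> (\<Sum>w\<in>good. measure M (cylinder N p w) * ?D w)"
    proof (rule sum_mono)
      fix w assume w: "w \<in> good"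
      have wc: "w \<in> cutset t" using w by (simp add: good_def)
      have pos: "0 < norm_diam nrm (J w)" using J_word path_prod_c_pos gw[OF w] by simp
      have "exp (- lmax) * exp (- t) \<le> path_prod a w" by (rule cutset_weight(1)[OF wc t])
      then have "qmin * (exp (- lmax) * exp (- t)) \<le> q (hd w) * path_prod a w"
        using qmin(1) qmin(2)[OF hd_word, of w] q_pos[OF hd_word, of w] gw[OF w]
        by (intro mult_mono) (auto intro: less_imp_le)
      then have "(t0 / 2) powr r * (qmin * (exp (- lmax) * exp (- t))) \<le> (t0 / 2) powr r * (q (hd w) * path_prod a w)"
        by (intro mult_left_mono) auto
      also have "q (hd w) * path_prod a w = measure M (cylinder N p w) * norm_diam nrm (J w) powr r"
        using cylinder_weight gw[OF w] by simp
      finally show "k * exp (- t) \<le> measure M (cylinder N p w) * ?D w"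
        using t0 pos powr_mult[of "t0 / 2" "norm_diam nrm (J w)" r] by (simp add: k_def mult_ac)
    qed
    also have "\<dots> = (\<integral>\<omega>. ?g \<omega> \<partial>M)" by (rule integral_cylinder_sum(2)[OF fg gwB, symmetric])
    also have "\<dots> \<le> cost \<alpha>"
      unfolding cost_eq[OF \<alpha>]
    proof (rule integral_mono[OF integral_cylinder_sum(1)[OF fg gwB] integrable_infdist[OF \<alpha>]])
      fix \<omega> assume "\<omega> \<in> space M"
      then have \<omega>: "\<omega> \<in> inf_words N p" by (simp add: space_M)
      show "?g \<omega> \<le> norm_infdist nrm (coding_map J \<omega>) \<alpha> powr r"
      proof (cases "\<exists>w\<in>good. \<omega> \<in> cylinder N p w")
        case False
        then have "?g \<omega> = 0" by (intro sum.neutral) auto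
        then show ?thesis by simp
      next
        case True
        then obtain w where w: "w \<in> good" "\<omega> \<in> cylinder N p w" by blast
        have wc: "w \<in> cutset t" using w by (simp add: good_def)
        have pw: "prefix_word \<omega> (length w) = w" using w(2) by (simp add: in_cylinder)
        have uniq: "v = w" if v: "v \<in> good" "\<omega> \<in> cylinder N p v" for v
        proof -
          have vc: "v \<in> cutset t" using v by (simp add: good_def)
          have pv: "prefix_word \<omega> (length v) = v" using v(2) by (simp add: in_cylinder)
          have "prefix v w \<or> prefix w v"
            using prefix_word_append[of "length v" "length w" \<omega>] prefix_word_append[of "length w" "length v" \<omega>]
              le_cases[of "length v" "length w"] unfolding pv pw by (auto simp: prefix_def)
          then show ?thesis using cutset_prefix_free[OF vc wc] cutset_prefix_free[OF wc vc] by blast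
        qed
        have "?g \<omega> = (\<Sum>v\<in>{w}. indicat_real (cylinder N p v) \<omega> * ?D v)"
        proof (rule sum.mono_neutral_right[OF fg])
          show "{w} \<subseteq> good" using w by blast
          show "\<forall>v\<in>good - {w}. indicat_real (cylinder N p v) \<omega> * ?D v = 0"
          proof
            fix v assume "v \<in> good - {w}"
            then have "\<omega> \<notin> cylinder N p v" using uniq by blast
            then show "indicat_real (cylinder N p v) \<omega> * ?D v = 0" by simp
          qed
        qed
        also have "\<dots> = ?D w" using w by simp
        also have "\<dots> \<le> norm_infdist nrm (coding_map J \<omega>) \<alpha> powr r"
        proof (rule powr_mono2)
          have "1 \<le> length w" using gw[OF w(1)] by (simp add: Suc_le_eq)
          then have "coding_map J \<omega> \<in> J w" using coding_map_in[OF \<omega>, of "length w"] pw by simp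
          then show "t0 / 2 * norm_diam nrm (J w) \<le> norm_infdist nrm (coding_map J \<omega>) \<alpha>"
            using w(1) codebookD[OF \<alpha>] unfolding good_def bad_def by (intro infdist_ge) (auto simp: not_less)
          show "0 \<le> t0 / 2 * norm_diam nrm (J w)"
            using t0 J_word path_prod_c_pos gw[OF w(1)] by (simp add: less_imp_le)
        qed (use r in simp)
        finally show ?thesis .
      qed
    qed
    finally show "k * (real n * exp (- t)) \<le> cost \<alpha>" .
  qed
  then show ?thesis using k by blast
qed

end

section \<open>The critical exponent and the size of cut sets\<close>

lemma spectral_radius_mono_scale:
  assumes fin: "finite V" and ne: "V \<noteq> {}"
    and b: "\<And>i j. i \<in> V \<Longrightarrow> j \<in> V \<Longrightarrow> 0 \<le> b i j" "\<And>i j. i \<in> V \<Longrightarrow> j \<in> V \<Longrightarrow> 0 \<le> b' i j"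
    and le: "\<And>i j. i \<in> V \<Longrightarrow> j \<in> V \<Longrightarrow> b' i j \<le> \<kappa> * b i j" and \<kappa>: "0 < \<kappa>"
  shows "spectral_radius (index_mat V b') \<le> \<kappa> * spectral_radius (index_mat V b)"
proof -
  let ?\<rho> = "spectral_radius (index_mat V b')"
  obtain z where z: "\<forall>i. 0 \<le> z i" "\<exists>i\<in>V. 0 < z i" "\<forall>i\<in>V. ?\<rho> * z i \<le> (\<Sum>j\<in>V. b' i j * z j)"
    using nonneg_subeigenvector[where b = b', OF fin ne b(2)] by metis
  obtain i0 where i0: "i0 \<in> V" "0 < z i0" using z(2) by blast
  have z0: "0 \<le> z i" for i using z by simp
  have "?\<rho> / \<kappa> * z i \<le> (\<Sum>j\<in>V. b i j * z j)" if i: "i \<in> V" for i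
  proof -
    have "?\<rho> * z i \<le> (\<Sum>j\<in>V. b' i j * z j)" using z(3) i by blast
    also have "\<dots> \<le> (\<Sum>j\<in>V. \<kappa> * b i j * z j)"
      using le i z0 by (intro sum_mono mult_right_mono) auto
    also have "\<dots> = \<kappa> * (\<Sum>j\<in>V. b i j * z j)" by (simp add: sum_distrib_left mult.assoc)
    finally show ?thesis using \<kappa> by (simp add: field_simps)
  qed
  then have "?\<rho> / \<kappa> \<le> spectral_radius (index_mat V b)"
    by (intro le_spectral_radius_of_subsolution[where b = b and w = z, OF fin b(1) z0 i0])
  then show ?thesis using \<kappa> by (simp add: field_simps)
qed

context markov_words begin

definition "rho x = spectral_radius (index_mat {1..N} (\<lambda>i j. a i j powr x))"

text \<open>
  For \<open>x \<le> y\<close>, passing from exponent \<open>x\<close> to \<open>y\<close> multiplies each nonzero entry by \<open>a\<^bsup>y-x\<^esup>\<close>, a number between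
  \<open>exp (- lmax * (y - x))\<close> and \<open>exp (- lmin * (y - x))\<close>. This gives continuity and strict monotonicity of the
  spectral radius at once.
\<close>

lemma rho_compare:
  assumes "x \<le> y"
  shows "rho y \<le> exp (- lmin * (y - x)) * rho x" "exp (- lmax * (y - x)) * rho x \<le> rho y"
proof -
  have ne: "{1..N} \<noteq> {}" using N by simp
  have pw: "a i j powr y = a i j powr x * exp (- len i j * (y - x))" if "(i, j) \<in> edges" for i j
    using edgeD(5)[OF that] by (simp add: powr_def len_def exp_add[symmetric] algebra_simps)
  have "a i j powr y \<le> exp (- lmin * (y - x)) * a i j powr x" if "i \<in> {1..N}" "j \<in> {1..N}" for i j
  proof (cases "(i, j) \<in> edges")
    case True
    have "lmin * (y - x) \<le> len i j * (y - x)"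
      using len_bounds[OF True] assms by (intro mult_right_mono) auto
    then show ?thesis unfolding pw[OF True] by (simp add: mult.commute[of "exp _"] mult_left_mono)
  qed (use a_eq_0[OF that] in simp)
  then show "rho y \<le> exp (- lmin * (y - x)) * rho x"
    unfolding rho_def by (intro spectral_radius_mono_scale) (use ne in auto)
  have "a i j powr x \<le> exp (lmax * (y - x)) * a i j powr y" if "i \<in> {1..N}" "j \<in> {1..N}" for i j
  proof (cases "(i, j) \<in> edges")
    case True
    have "len i j * (y - x) \<le> lmax * (y - x)"
      using len_bounds[OF True] assms by (intro mult_right_mono) auto
    then have "1 \<le> exp (lmax * (y - x)) * exp (- len i j * (y - x))"
      by (simp add: exp_add[symmetric])
    then have "a i j powr x * 1 \<le> a i j powr x * (exp (lmax * (y - x)) * exp (- len i j * (y - x)))"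
      by (intro mult_left_mono) auto
    then show ?thesis unfolding pw[OF True] by (simp add: mult_ac)
  qed (use a_eq_0[OF that] in simp)
  then have "rho x \<le> exp (lmax * (y - x)) * rho y"
    unfolding rho_def by (intro spectral_radius_mono_scale) (use ne in auto)
  then have "exp (- lmax * (y - x)) * rho x \<le> exp (- lmax * (y - x)) * (exp (lmax * (y - x)) * rho y)"
    by (intro mult_left_mono) auto
  then show "exp (- lmax * (y - x)) * rho x \<le> rho y"
    by (simp add: mult.assoc[symmetric] exp_add[symmetric])
qed

lemma rho_nonneg: "0 \<le> rho x"
  unfolding rho_def by (rule spectral_radius_nonneg) (use N in auto)

lemma rho_antimono: "x \<le> y \<Longrightarrow> rho y \<le> rho x"
proof -
  assume "x \<le> y"
  have "exp (- lmin * (y - x)) \<le> 1" using lmin_pos \<open>x \<le> y\<close> by simp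
  then have "exp (- lmin * (y - x)) * rho x \<le> 1 * rho x" using rho_nonneg by (intro mult_right_mono)
  then show ?thesis using rho_compare(1)[OF \<open>x \<le> y\<close>] by simp
qed

lemma continuous_rho: "continuous_on {0..1} rho"
proof -
  have diff: "\<bar>rho x - rho y\<bar> \<le> rho 0 * lmax * (y - x)" if "0 \<le> x" "x \<le> y" for x y
  proof -
    have "(1 - lmax * (y - x)) * rho x \<le> exp (- lmax * (y - x)) * rho x"
      using exp_ge_add_one_self[of "- lmax * (y - x)"] rho_nonneg by (intro mult_right_mono) auto
    then have "rho x - rho y \<le> lmax * (y - x) * rho x"
      using rho_compare(2)[OF that(2)] by (simp add: algebra_simps)
    also have "\<dots> \<le> lmax * (y - x) * rho 0"
      using rho_antimono[OF that(1)] that lmin_pos lmin_le_lmax by (intro mult_left_mono) auto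
    finally show ?thesis using rho_antimono[OF that(2)] by (simp add: mult_ac)
  qed
  have "(rho 0 * lmax)-lipschitz_on {0..1} rho"
  proof (rule lipschitz_onI)
    fix x y :: real assume xy: "x \<in> {0..1}" "y \<in> {0..1}"
    show "dist (rho x) (rho y) \<le> rho 0 * lmax * dist x y"
    proof (cases "x \<le> y")
      case True
      then show ?thesis using diff[of x y] xy by (simp add: dist_real_def)
    next
      case False
      then show ?thesis using diff[of y x] xy by (simp add: dist_real_def abs_minus_commute)
    qed
  qed (use rho_nonneg lmin_pos lmin_le_lmax in auto)
  then show ?thesis by (rule lipschitz_on_continuous_on)
qed

text \<open>
  At exponent 0 every row sum is the out-degree of a vertex.
\<close>

lemma rho_0: "2 \<le> rho 0"
  unfolding rho_def
proof (rule le_spectral_radius_of_subsolution[of "{1..N}" _ "\<lambda>_. 1" 1])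
  fix i assume i: "i \<in> {1..N}"
  have "a i j powr 0 = of_bool (0 < p i j)" if "j \<in> {1..N}" for j
    using that i edgeD(5)[of i j] a_eq_0[of i j] by (auto simp: edges_def)
  then have "(\<Sum>j=1..N. a i j powr 0 * 1) = (\<Sum>j\<in>{j \<in> {1..N}. 0 < p i j}. 1)"
    by (intro sum.mono_neutral_cong_right) auto
  then show "2 * 1 \<le> (\<Sum>j=1..N. a i j powr 0 * 1)" using out_deg[OF i] by simp
qed (use N in auto)

text \<open>
  At exponent 1 the row sums are below those of the stochastic matrix \<open>p\<close>.
\<close>

lemma rho_1: "rho 1 < 1"
proof -
  define \<theta> where "\<theta> = Max ((\<lambda>i. \<Sum>j=1..N. a i j) ` {1..N})"
  have ann: "0 \<le> a i j" if "i \<in> {1..N}" "j \<in> {1..N}" for i j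
    using that p_nonneg by (simp add: a_def)
  have "(\<Sum>j=1..N. a i j) < 1" if i: "i \<in> {1..N}" for i
  proof -
    obtain k where k: "(i, k) \<in> edges" using ex_edge[OF i] by blast
    have cr: "0 \<le> c i j" "c i j < 1" "c i j powr r < 1" if "j \<in> {1..N}" for j
    proof -
      show "0 \<le> c i j" "c i j < 1" using c_range[OF i that] by auto
      then show "c i j powr r < 1" using powr_less_mono2[OF r, of "c i j" 1] by simp
    qed
    have "(\<Sum>j=1..N. a i j) < (\<Sum>j=1..N. p i j)"
    proof (rule sum_strict_mono_ex1)
      show "\<forall>j\<in>{1..N}. a i j \<le> p i j"
        unfolding a_def using p_nonneg[OF i] less_imp_le[OF cr(3)] by (intro ballI mult_left_le) auto
      have "a i k < p i k"
        unfolding a_def using edgeD(1)[OF k] cr[of k] k by (simp add: edges_def)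
      then show "\<exists>j\<in>{1..N}. a i j < p i j" using k by (auto simp: edges_def)
    qed simp
    then show ?thesis using p_stoch[OF i] by simp
  qed
  then have "\<theta> < 1" unfolding \<theta>_def using N by (subst Max_less_iff) auto
  moreover have "rho 1 \<le> \<theta>"
    unfolding rho_def
  proof (rule spectral_radius_le_of_supersolution[where v = "\<lambda>_. 1"])
    fix i assume i: "i \<in> {1..N}"
    have "(\<Sum>j=1..N. a i j powr 1 * 1) = (\<Sum>j=1..N. a i j)"
      using ann[OF i] by (intro sum.cong) auto
    also have "\<dots> \<le> \<theta>" unfolding \<theta>_def using i by (intro Max_ge) auto
    finally show "(\<Sum>j=1..N. a i j powr 1 * 1) \<le> \<theta> * 1" by simp
  qed (use N in auto)
  ultimately show ?thesis by simp
qed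

lemma b_entry_eq: "b_entry p c r s = (\<lambda>i j. a i j powr (s / (s + r)))"
  by (intro ext) (simp add: b_entry_def a_def)

lemma Psi_eq_rho: "Psi p c r (trans_graph N p) s = rho (s / (s + r))"
  by (simp add: Psi_def trans_graph_def rho_def b_entry_eq)

abbreviation "s \<equiv> s_crit N p c r"
definition "\<delta> = s / (s + r)"

text \<open>
  The substitution \<open>x = s / (s + r)\<close> maps \<open>s > 0\<close> increasingly onto \<open>(0, 1)\<close>, so it suffices to solve
  \<open>rho x = 1\<close> there.
\<close>

lemma s_crit_solves: "0 < s" "rho \<delta> = 1"
proof -
  have "\<exists>x\<ge>0. x \<le> 1 \<and> rho x = 1"
    using rho_0 rho_1 continuous_rho by (intro IVT2') auto
  then obtain x where x: "0 \<le> x" "x \<le> 1" "rho x = 1" by blast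
  have x01: "0 < x" "x < 1" using x rho_0 rho_1 by (auto simp: less_le)
  define s0 where "s0 = r * x / (1 - x)"
  have s0: "0 < s0" unfolding s0_def using x01 r by (intro divide_pos_pos mult_pos_pos) auto
  have "s0 + r = r / (1 - x)" unfolding s0_def using x01 by (simp add: field_simps)
  then have "s0 / (s0 + r) = x" unfolding s0_def using x01 r by simp
  then have P0: "0 < s0 \<and> Psi p c r (trans_graph N p) s0 = 1" using x s0 by (simp add: Psi_eq_rho)
  have strict: "rho y < 1" if "rho x = 1" "x < y" for x y
  proof -
    have "exp (- lmin * (y - x)) < 1" using lmin_pos that by simp
    moreover have "rho y \<le> exp (- lmin * (y - x)) * rho x" using that by (intro rho_compare) simp
    ultimately show ?thesis unfolding that(1) mult_1_right by linarith
  qed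
  have mono: "u / (u + r) < v / (v + r)" if "0 < u" "u < v" for u v
    using that r by (simp add: field_simps)
  have uniq: "v = s0" if "0 < v \<and> Psi p c r (trans_graph N p) v = 1" for v
  proof -
    have v: "0 < v" "rho (v / (v + r)) = 1" using that by (auto simp: Psi_eq_rho)
    have w: "rho (s0 / (s0 + r)) = 1" using P0 by (simp add: Psi_eq_rho)
    show ?thesis
    proof (cases v s0 rule: linorder_cases)
      case less
      then show ?thesis using strict[OF v(2) mono[OF v(1) less]] w by simp
    next
      case greater
      then show ?thesis using strict[OF w mono[OF s0 greater]] v(2) by simp
    qed
  qed
  have "0 < s \<and> Psi p c r (trans_graph N p) s = 1"
    unfolding s_crit_def by (rule theI[where a = s0]) (use P0 uniq in blast)+
  then show "0 < s" "rho \<delta> = 1" by (auto simp: Psi_eq_rho \<delta>_def)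
qed

lemma delta_bounds: "0 < \<delta>" "\<delta> < 1"
  using s_crit_solves(1) r by (auto simp: \<delta>_def field_simps)

definition "scaled_count i t = exp (- \<delta> * t) * real (card (cuts i t))"

text \<open>
  The scaling turns the recursion for the number of words into a renewal equation with the matrix
  \<open>A\<^sub>G(s\<^sub>r)\<close>.
\<close>

sublocale renewal "{1..N}" "\<lambda>i j. a i j powr \<delta>" len scaled_count lmin lmax "exp (\<delta> * lmax)"
proof
  fix i t assume i: "i \<in> {1..N}" and t: "0 \<le> (t::real)"
  have out: "{j. (i, j) \<in> edges} = {j \<in> {1..N}. (i, j) \<in> edges}" by (auto simp: edges_def)
  have "scaled_count i t = (\<Sum>j | (i, j) \<in> edges. exp (- \<delta> * t) * real (card (cuts j (t - len i j))))"
    unfolding scaled_count_def card_cut_rec[OF i t] by (simp add: sum_distrib_left)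
  also have "\<dots> = (\<Sum>j | (i, j) \<in> edges. a i j powr \<delta> * scaled_count j (t - len i j))"
  proof (rule sum.cong)
    fix j assume "j \<in> {j. (i, j) \<in> edges}"
    then have e: "(i, j) \<in> edges" by simp
    have "a i j powr \<delta> * exp (- \<delta> * (t - len i j)) = exp (- \<delta> * t)"
      using edgeD(5)[OF e] by (simp add: powr_def len_def exp_add[symmetric] algebra_simps)
    then show "exp (- \<delta> * t) * real (card (cuts j (t - len i j))) = a i j powr \<delta> * scaled_count j (t - len i j)"
      by (simp add: scaled_count_def mult.assoc[symmetric])
  qed simp
  also have "\<dots> = (\<Sum>j\<in>{1..N}. a i j powr \<delta> * scaled_count j (t - len i j))"
    unfolding out by (rule sum.mono_neutral_left) (use i a_eq_0 in auto)
  finally show "scaled_count i t = (\<Sum>j\<in>{1..N}. a i j powr \<delta> * scaled_count j (t - len i j))" .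
next
  fix i t assume i: "i \<in> {1..N}" and t: "- lmax \<le> t" "t < (0::real)"
  have "scaled_count i t = exp (- \<delta> * t)" using cut_neg[OF i t(2)] by (simp add: scaled_count_def)
  moreover have "\<delta> * (- t) \<le> \<delta> * lmax" using t delta_bounds by (intro mult_left_mono) auto
  moreover have "0 \<le> \<delta> * (- t)" using t delta_bounds by (intro mult_nonneg_nonneg) auto
  ultimately show "1 \<le> scaled_count i t \<and> scaled_count i t \<le> exp (\<delta> * lmax)" by simp
next
  fix i j assume "i \<in> {1..N}" "j \<in> {1..N}" "0 < a i j powr \<delta>"
  then have "(i, j) \<in> edges" using a_eq_0[of i j] by fastforce
  then show "lmin \<le> len i j \<and> len i j \<le> lmax" by (rule len_bounds)
qed (use lmin_pos lmin_le_lmax s_crit_solves(2) in \<open>auto simp: rho_def\<close>)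

lemma E_eq_edges: "E = edges"
proof -
  have "0 < a i j powr \<delta> \<longleftrightarrow> (i, j) \<in> edges" if "i \<in> {1..N}" "j \<in> {1..N}" for i j
    using a_eq_0[OF that] edgeD(5)[of i j] by fastforce
  then show ?thesis unfolding E_def by (auto simp: edges_def)
qed

lemma walk_iff: "walk w \<longleftrightarrow> w \<noteq> [] \<and> is_word w"
proof -
  have "successively (\<lambda>i j. (i, j) \<in> edges) w \<longleftrightarrow> successively (\<lambda>i j. 0 < p i j) w"
    if "set w \<subseteq> {1..N}"
    using that by (auto simp: edges_def intro!: successively_cong)
  then show ?thesis unfolding walk_def is_word_def E_eq_edges by auto
qed

text \<open>
  Components as subgraphs and components as vertex sets correspond, because a strongly connected
  component is the subgraph induced by its vertices.
\<close>

lemma verts_crit_sccs: "verts ` crit_sccs N p c r = critical" "inj_on verts (crit_sccs N p c r)"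
proof -
  let ?G = "trans_graph N p"
  interpret G: wf_digraph ?G by standard (auto simp: trans_graph_def)
  have V: "verts ?G = {1..N}" by (simp add: trans_graph_def)
  have ends: "arcs_ends ?G = edges"
    by (auto simp: arcs_ends_def arc_to_ends_def trans_graph_def edges_def)
  have reach: "reachable ?G u v \<longleftrightarrow> v \<in> {1..N} \<and> (u, v) \<in> edges\<^sup>*" if "u \<in> {1..N}" for u v
  proof
    assume h: "reachable ?G u v"
    then show "v \<in> {1..N} \<and> (u, v) \<in> edges\<^sup>*"
      using G.reachable_in_verts(2)[OF h] unfolding reachable_def ends V
      by (auto dest: rtrancl_on_rtranclI)
  next
    assume h: "v \<in> {1..N} \<and> (u, v) \<in> edges\<^sup>*"
    show "reachable ?G u v"
      unfolding reachable_def ends V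
      by (rule rtrancl_consistent_rtrancl_on) (use h that in \<open>auto simp: edges_def\<close>)
  qed
  have scc: "G.scc_of u = scc u" if "u \<in> {1..N}" for u
    unfolding G.scc_of_def scc_def E_eq_edges using reach that G.reachable_in_verts(1) V by blast
  have sccs: "verts ` G.sccs = scc ` {1..N}"
    using scc unfolding G.sccs_verts_conv[symmetric] G.sccs_verts_conv_scc_of V by simp
  have Psi: "Psi p c r H s = rad (verts H)" for H
    by (simp only: Psi_def rad_def b_entry_eq \<delta>_def[symmetric])
  show "verts ` crit_sccs N p c r = critical"
  proof -
    have "verts ` crit_sccs N p c r = {S \<in> verts ` G.sccs. rad S = 1}"
      unfolding crit_sccs_def Psi by blast
    then show ?thesis unfolding sccs critical_def by simp
  qed
  show "inj_on verts (crit_sccs N p c r)"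
    by (rule inj_on_subset[OF G.inj_on_verts_sccs]) (auto simp: crit_sccs_def)
qed

lemma T_path_eq: "T_path N p c r w = crit_count w"
proof -
  let ?Q = "\<lambda>S. \<exists>x\<in>set w. x \<in> S"
  have "T_path N p c r w = card {H \<in> crit_sccs N p c r. ?Q (verts H)}"
  proof -
    have "(\<exists>i<length w. w ! i \<in> S) \<longleftrightarrow> ?Q S" for S by (auto simp: set_conv_nth)
    then show ?thesis unfolding T_path_def by simp
  qed
  also have "\<dots> = card (verts ` {H \<in> crit_sccs N p c r. ?Q (verts H)})"
    by (rule card_image[symmetric], rule inj_on_subset[OF verts_crit_sccs(2)]) auto
  also have "verts ` {H \<in> crit_sccs N p c r. ?Q (verts H)} = {S \<in> critical. ?Q S}"
    unfolding verts_crit_sccs(1)[symmetric] by blast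
  finally show ?thesis unfolding crit_count_def .
qed

text \<open>
  The maximum defining \<^const>\<open>T_max\<close> ranges over infinitely many words, but the counts are bounded by the number of critical
  components. It is positive, so \<open>T_max N p c r - 1\<close> does not truncate.
\<close>

lemma T_max_props:
  shows "\<And>w. is_word w \<Longrightarrow> crit_count w \<le> T_max N p c r"
    and "\<exists>w. walk w \<and> crit_count w = T_max N p c r" and "1 \<le> T_max N p c r"
proof -
  let ?S = "T_path N p c r ` all_words N p"
  have S: "?S = crit_count ` {w. is_word w}" by (auto simp: T_path_eq all_words_iff)
  have cc: "crit_count w \<le> card critical" for w
    unfolding crit_count_def by (rule card_mono[OF finite_critical]) blast
  have "?S \<subseteq> {..card critical}" unfolding S using cc by blast
  then have fS: "finite ?S" by (rule finite_subset) simp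
  show le: "crit_count w \<le> T_max N p c r" if w: "is_word w" for w
  proof -
    have "crit_count w \<in> ?S" unfolding S using w by blast
    then show ?thesis unfolding T_max_def by (rule Max_ge[OF fS])
  qed
  have "{1..N} \<noteq> {}" using N by simp
  then obtain w1 where w1: "walk w1" "1 \<le> crit_count w1" using exists_critical_walk by blast
  then have "is_word w1" unfolding walk_iff by blast
  then show T1: "1 \<le> T_max N p c r" using le w1(2) le_trans by blast
  have "?S \<noteq> {}" using w1 unfolding S walk_iff by blast
  then have "T_max N p c r \<in> ?S" unfolding T_max_def using fS by (intro Max_in)
  then obtain w where w: "is_word w" "crit_count w = T_max N p c r" unfolding S by force
  have "crit_count [] = 0" unfolding crit_count_def by simp
  then have "w \<noteq> []" using T1 w(2) by (metis not_one_le_zero)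
  then show "\<exists>w. walk w \<and> crit_count w = T_max N p c r" using w walk_iff by blast
qed

text \<open>
  The lower bound comes from the first letter of a walk that meets \<open>T\<^sub>r\<close> critical components, the upper bound from
  the sum over all first letters.
\<close>

theorem card_cutset_bounds:
  shows "\<exists>A>0. \<exists>C\<ge>0. \<forall>t\<ge>0. A * exp (\<delta> * t) * (max 0 (t - C)) ^ (T_max N p c r - 1) \<le> real (card (cutset t))"
    and "\<exists>A>0. \<exists>C\<ge>0. \<forall>t\<ge>0. real (card (cutset t)) \<le> A * exp (\<delta> * t) * (t + C) ^ (T_max N p c r - 1)"
proof -
  define d where "d = T_max N p c r - 1"
  have T: "T_max N p c r = Suc d" using T_max_props(3) by (simp add: d_def)
  have count: "real (card (cutset t)) = exp (\<delta> * t) * (\<Sum>i=1..N. scaled_count i t)" for t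
    by (simp add: card_cutset scaled_count_def sum_distrib_left mult.assoc[symmetric] exp_add[symmetric])
  obtain w where w: "walk w" "crit_count w = Suc d" using T_max_props(2) T by metis
  obtain A C where A: "0 < A" "0 \<le> C" "\<forall>t\<ge>-lmax. A * (max 0 (t - C)) ^ d \<le> scaled_count (hd w) t"
    using renewal_lower_bounds[OF w] by blast
  have hw: "hd w \<in> {1..N}" using w(1) unfolding walk_def by (meson hd_in_set subsetD)
  have "A * exp (\<delta> * t) * (max 0 (t - C)) ^ d \<le> real (card (cutset t))" if t: "0 \<le> t" for t
  proof -
    have tl: "-lmax \<le> t" using t lmin_pos lmin_le_lmax by simp
    have "A * (max 0 (t - C)) ^ d \<le> scaled_count (hd w) t" using A tl by blast
    also have "\<dots> \<le> (\<Sum>i=1..N. scaled_count i t)"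
      using hw by (intro member_le_sum) (auto simp: scaled_count_def)
    finally have "exp (\<delta> * t) * (A * (max 0 (t - C)) ^ d) \<le> exp (\<delta> * t) * (\<Sum>i=1..N. scaled_count i t)"
      by (intro mult_left_mono) auto
    then show ?thesis unfolding count by (simp add: mult_ac)
  qed
  then show "\<exists>A>0. \<exists>C\<ge>0. \<forall>t\<ge>0. A * exp (\<delta> * t) * (max 0 (t - C)) ^ (T_max N p c r - 1) \<le> real (card (cutset t))"
    using A unfolding d_def by blast
  have "\<exists>K. \<forall>t\<in>{0..}. scaled_count i t \<le> K * (t + lmax + 1) ^ d" if i: "i \<in> {1..N}" for i
  proof -
    have "crit_at_most (Suc d) i"
      unfolding crit_at_most_def
    proof (intro allI impI)
      fix \<gamma> assume "walk \<gamma> \<and> hd \<gamma> = i"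
      then have "is_word \<gamma>" unfolding walk_iff by blast
      then show "crit_count \<gamma> \<le> Suc d" using T_max_props(1) unfolding T by blast
    qed
    then obtain K where K: "\<forall>t\<ge>-lmax. scaled_count i t \<le> K * (t + lmax + 1) ^ d"
      using renewal_upper_bounds[OF i] unfolding grows_at_most_def by blast
    have "scaled_count i t \<le> K * (t + lmax + 1) ^ d" if "t \<in> {0..}" for t
      using K that lmin_pos lmin_le_lmax by simp
    then show ?thesis by blast
  qed
  then have "\<exists>K\<ge>0. \<forall>i\<in>{1..N}. \<forall>t\<in>{0..}. scaled_count i t \<le> K * (t + lmax + 1) ^ d"
    using lmin_pos lmin_le_lmax by (intro finite_uniform_bound) auto
  then obtain K where K: "0 \<le> K" "\<And>i t. i \<in> {1..N} \<Longrightarrow> 0 \<le> t \<Longrightarrow> scaled_count i t \<le> K * (t + lmax + 1) ^ d"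
    by (auto simp: Ball_def)
  define A2 where "A2 = real N * K + 1"
  have "real (card (cutset t)) \<le> A2 * exp (\<delta> * t) * (t + (lmax + 1)) ^ d" if t: "0 \<le> t" for t
  proof -
    have "(\<Sum>i=1..N. scaled_count i t) \<le> (\<Sum>i=1..N. K * (t + lmax + 1) ^ d)" using K(2) t by (intro sum_mono)
    also have "\<dots> = real N * K * (t + lmax + 1) ^ d" by simp
    also have "\<dots> \<le> A2 * (t + lmax + 1) ^ d"
      using t lmin_pos lmin_le_lmax by (intro mult_right_mono) (auto simp: A2_def)
    finally have "exp (\<delta> * t) * (\<Sum>i=1..N. scaled_count i t) \<le> exp (\<delta> * t) * (A2 * (t + lmax + 1) ^ d)"
      by (intro mult_left_mono) auto
    then show ?thesis unfolding count by (simp add: mult_ac add_ac)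
  qed
  moreover have "0 < A2" using K(1) by (simp add: A2_def add_nonneg_pos)
  moreover have "0 \<le> lmax + 1" using lmin_pos lmin_le_lmax by simp
  ultimately show "\<exists>A>0. \<exists>C\<ge>0. \<forall>t\<ge>0. real (card (cutset t)) \<le> A * exp (\<delta> * t) * (t + C) ^ (T_max N p c r - 1)"
    unfolding d_def by blast
qed

end

section \<open>The asymptotics of the quantization error\<close>

lemma two_sided_bound_from_eventual:
  fixes e g :: "nat \<Rightarrow> real"
  assumes pos: "\<And>n. 2 \<le> n \<Longrightarrow> 0 < g n" "\<And>n. 2 \<le> n \<Longrightarrow> 0 < e n"
    and ev: "\<And>n. n0 \<le> n \<Longrightarrow> 2 \<le> n \<Longrightarrow> k * g n \<le> e n \<and> e n \<le> K * g n" and k: "0 < k" "0 < K"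
  shows "\<exists>B\<ge>1. \<forall>n\<ge>2. inverse B * g n \<le> e n \<and> e n \<le> B * g n"
proof -
  define S where "S = (\<Sum>n\<in>{2..<n0}. e n / g n + g n / e n)"
  have nn: "0 \<le> e n / g n + g n / e n" if "2 \<le> n" for n
    using pos[OF that] by (simp add: add_nonneg_nonneg less_imp_le)
  have S0: "0 \<le> S" unfolding S_def by (rule sum_nonneg) (use nn in simp)
  define B where "B = 1 + K + 1 / k + S"
  have B: "1 \<le> B" "K \<le> B" "1 / k \<le> B" "S \<le> B" using k S0 by (simp_all add: B_def)
  have "e n / g n \<le> B \<and> g n / e n \<le> B" if n: "2 \<le> n" for n
  proof (cases "n0 \<le> n")
    case True
    then have "k * g n \<le> e n" "e n \<le> K * g n" using ev n by auto
    then have "e n / g n \<le> K" "g n / e n \<le> 1 / k" using pos[OF n] k by (simp_all add: field_simps)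
    then show ?thesis using B by linarith
  next
    case False
    then have "e n / g n + g n / e n \<le> S"
      unfolding S_def using n nn by (intro member_le_sum[where f = "\<lambda>n. e n / g n + g n / e n"]) auto
    moreover have "0 \<le> e n / g n" "0 \<le> g n / e n" using pos[OF n] by (auto intro: less_imp_le)
    ultimately show ?thesis using B by linarith
  qed
  then have "inverse B * g n \<le> e n \<and> e n \<le> B * g n" if n: "2 \<le> n" for n
  proof -
    assume h: "\<And>n. 2 \<le> n \<Longrightarrow> e n / g n \<le> B \<and> g n / e n \<le> B"
    have "e n \<le> B * g n" using h[OF n] pos(1)[OF n] by (simp add: pos_divide_le_eq)
    moreover have "g n \<le> B * e n" using h[OF n] pos(2)[OF n] by (simp add: pos_divide_le_eq)
    ultimately show ?thesis using B(1) by (simp add: field_simps)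
  qed
  then show ?thesis using B(1) by blast
qed

text \<open>
  If \<open>Nc t \<asymp> e\<^bsup>\<delta>t\<^esup> t\<^sup>d\<close>, then \<open>Nc t\<close> is of order \<open>n\<close> at \<open>t = (ln n - d ln (ln n)) / \<delta>\<close>, and \<open>n e\<^bsup>-t\<^esup>\<close> is then the
  asserted order of \<open>e n\<close>. Shifting \<open>t\<close> down by a constant makes \<open>Nc t \<le> n\<close>, shifting it up makes \<open>Nc t \<ge> 2n\<close>.
  Finitely many \<open>n\<close> are covered by monotonicity and positivity.
\<close>

lemma invert_counting_bounds:
  fixes e :: "nat \<Rightarrow> real" and Nc :: "real \<Rightarrow> nat" and \<delta> A1 A2 C1 C2 k :: real and d :: nat
  assumes pos: "0 < \<delta>" "0 < A1" "0 < A2" "0 \<le> C1" "0 \<le> C2" "0 < k"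
    and lower: "\<And>t. 0 \<le> t \<Longrightarrow> A1 * exp (\<delta> * t) * (max 0 (t - C1)) ^ d \<le> real (Nc t)"
    and upper: "\<And>t. 0 \<le> t \<Longrightarrow> real (Nc t) \<le> A2 * exp (\<delta> * t) * (t + C2) ^ d"
    and U: "\<And>t n. 0 \<le> t \<Longrightarrow> Nc t \<le> n \<Longrightarrow> e n \<le> real n * exp (- t)"
    and L: "\<And>t n. 0 \<le> t \<Longrightarrow> 1 \<le> n \<Longrightarrow> 2 * n \<le> Nc t \<Longrightarrow> k * (real n * exp (- t)) \<le> e n"
    and mono: "\<And>m n. 1 \<le> m \<Longrightarrow> m \<le> n \<Longrightarrow> e n \<le> e m"
  shows "\<exists>B\<ge>1. \<forall>n\<ge>2.
    inverse B * (real n powr (1 - 1 / \<delta>) * ln (real n) powr (real d / \<delta>)) \<le> e n \<and>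
    e n \<le> B * (real n powr (1 - 1 / \<delta>) * ln (real n) powr (real d / \<delta>))"
proof -
  define g where "g n = real n powr (1 - 1 / \<delta>) * ln (real n) powr (real d / \<delta>)" for n
  define P where "P = A2 * (1 / \<delta> + C2) ^ d"
  define Q where "Q = 2 * (2 * \<delta>) ^ d / A1"
  define K1 where "K1 = max 0 (ln P / \<delta>)"
  define K2 where "K2 = max C1 (ln Q / \<delta>)"
  have P: "0 < P" and Q: "0 < Q" unfolding P_def Q_def using pos by (auto intro!: mult_pos_pos divide_pos_pos zero_less_power add_pos_nonneg)
  have K1: "0 \<le> K1" "P \<le> exp (\<delta> * K1)"
  proof -
    show "0 \<le> K1" by (simp add: K1_def)
    have "ln P \<le> \<delta> * K1" using pos(1) by (simp add: K1_def max_def field_simps)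
    then have "exp (ln P) \<le> exp (\<delta> * K1)" by simp
    then show "P \<le> exp (\<delta> * K1)" using P by simp
  qed
  have K2: "C1 \<le> K2" "Q \<le> exp (\<delta> * K2)"
  proof -
    show "C1 \<le> K2" by (simp add: K2_def)
    have "\<delta> * (ln Q / \<delta>) \<le> \<delta> * K2" using pos(1) by (intro mult_left_mono) (auto simp: K2_def)
    then have "exp (ln Q) \<le> exp (\<delta> * K2)" using pos(1) by simp
    then show "Q \<le> exp (\<delta> * K2)" using Q by simp
  qed
  have "\<forall>\<^sub>F n in sequentially. real d * ln (ln (real n)) \<le> ln (real n) / 2" by real_asymp
  moreover have "\<forall>\<^sub>F n in sequentially. \<delta> * K1 \<le> ln (real n) / 2" by real_asymp
  moreover have "\<forall>\<^sub>F n in sequentially. 1 \<le> ln (real n)" by real_asymp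
  ultimately have "\<forall>\<^sub>F n in sequentially. real d * ln (ln (real n)) \<le> ln (real n) / 2 \<and>
      \<delta> * K1 \<le> ln (real n) / 2 \<and> 1 \<le> ln (real n)" by eventually_elim auto
  then obtain n0 where n0: "\<And>n. n0 \<le> n \<Longrightarrow> real d * ln (ln (real n)) \<le> ln (real n) / 2 \<and>
      \<delta> * K1 \<le> ln (real n) / 2 \<and> 1 \<le> ln (real n)"
    unfolding eventually_sequentially by blast
  have main: "k * exp (- K2) * g n \<le> e n \<and> e n \<le> exp K1 * g n" if n: "n0 \<le> n" "2 \<le> n" for n
  proof -
    define l where "l = ln (real n)"
    define w where "w = ln l"
    have l: "real d * w \<le> l / 2" "\<delta> * K1 \<le> l / 2" "1 \<le> l" using n0[OF n(1)] by (auto simp: l_def w_def)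
    have w0: "0 \<le> w" using l(3) by (simp add: w_def)
    have nl: "exp l = real n" using n(2) by (simp add: l_def)
    have lw: "exp (real d * w) = l ^ d" using l(3) by (simp add: w_def exp_of_nat_mult)
    define T where "T K = (l - real d * w) / \<delta> + K" for K
    have eT: "exp (\<delta> * T K) = real n * exp (\<delta> * K) / l ^ d" for K
    proof -
      have "\<delta> * T K = l + \<delta> * K - real d * w" using pos(1) by (simp add: T_def field_simps)
      then show ?thesis by (simp add: exp_diff exp_add nl lw)
    qed
    have en: "real n * exp (- T K) = exp (- K) * g n" for K
    proof -
      have mT: "- T K = - K + (- (1 / \<delta>)) * l + (real d / \<delta>) * w" by (simp add: T_def diff_divide_distrib)
      have "exp (- T K) = exp (- K) * (exp ((- (1 / \<delta>)) * l) * exp ((real d / \<delta>) * w))"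
        unfolding mT exp_add by (rule mult.assoc)
      also have "exp ((- (1 / \<delta>)) * l) = real n powr (- (1 / \<delta>))" using n(2) by (simp add: powr_def l_def)
      also have "exp ((real d / \<delta>) * w) = l powr (real d / \<delta>)" using l(3) by (simp add: powr_def w_def)
      finally have "real n * exp (- T K) = exp (- K) * (real n powr 1 * real n powr (- (1 / \<delta>)) * l powr (real d / \<delta>))"
        using n(2) by (simp add: mult_ac)
      also have "real n powr 1 * real n powr (- (1 / \<delta>)) = real n powr (1 - 1 / \<delta>)"
        by (simp only: powr_add[symmetric] add_uminus_conv_diff)
      finally show ?thesis by (simp add: g_def l_def)
    qed
    have T0: "l / (2 * \<delta>) + K \<le> T K" for K
    proof -
      have "l / 2 / \<delta> \<le> (l - real d * w) / \<delta>" using l(1) pos(1) by (intro divide_right_mono) auto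
      then show ?thesis by (simp add: T_def)
    qed
    have up: "e n \<le> exp K1 * g n"
    proof -
      have t0: "0 \<le> T (- K1)"
      proof -
        have "K1 \<le> l / (2 * \<delta>)" using l(2) pos(1) by (simp add: field_simps)
        then show ?thesis using T0[of "- K1"] by simp
      qed
      have "T (- K1) \<le> l / \<delta>"
      proof -
        have "(l - real d * w) / \<delta> \<le> l / \<delta>" using w0 pos(1) by (intro divide_right_mono) auto
        then show ?thesis using K1(1) by (simp add: T_def)
      qed
      then have "T (- K1) + C2 \<le> l / \<delta> + C2 * l" using l(3) pos(5) mult_left_mono[of 1 l C2] by simp
      also have "\<dots> = (1 / \<delta> + C2) * l" by (simp add: algebra_simps)
      finally have "(T (- K1) + C2) ^ d \<le> ((1 / \<delta> + C2) * l) ^ d" using t0 pos(5) by (intro power_mono) auto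
      then have "A2 * exp (\<delta> * T (- K1)) * (T (- K1) + C2) ^ d
          \<le> A2 * exp (\<delta> * T (- K1)) * ((1 / \<delta> + C2) * l) ^ d" using pos(3) by (intro mult_left_mono) auto
      also have "\<dots> = P * exp (- (\<delta> * K1)) * real n"
        unfolding eT P_def using l(3) by (simp add: power_mult_distrib)
      also have "\<dots> \<le> exp (\<delta> * K1) * exp (- (\<delta> * K1)) * real n"
        using K1(2) by (intro mult_right_mono) auto
      also have "\<dots> = real n" by (simp add: exp_minus)
      finally have "real (Nc (T (- K1))) \<le> real n" using upper[OF t0] by linarith
      then have "e n \<le> real n * exp (- T (- K1))" using U[OF t0, of n] by simp
      then show ?thesis unfolding en by simp
    qed
    have "k * exp (- K2) * g n \<le> e n"
    proof -
      have tl: "l / (2 * \<delta>) \<le> T K2 - C1" using T0[of K2] K2(1) by simp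
      have l0: "0 \<le> l / (2 * \<delta>)" using l(3) pos(1) by simp
      have t0: "0 \<le> T K2" using tl l0 pos(4) by linarith
      have "2 * real n \<le> A1 * exp (\<delta> * T K2) * (l / (2 * \<delta>)) ^ d"
      proof -
        have "2 * real n = A1 * (real n * Q / l ^ d) * (l / (2 * \<delta>)) ^ d"
          unfolding Q_def using pos l(3) by (simp add: power_divide power_mult_distrib field_simps)
        also have "\<dots> \<le> A1 * (real n * exp (\<delta> * K2) / l ^ d) * (l / (2 * \<delta>)) ^ d"
          using K2(2) pos l(3) l0 by (intro mult_right_mono mult_left_mono divide_right_mono) auto
        finally show ?thesis unfolding eT .
      qed
      also have "\<dots> \<le> A1 * exp (\<delta> * T K2) * (max 0 (T K2 - C1)) ^ d"
        using pos(2) tl l0 by (intro mult_left_mono power_mono) auto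
      also have "\<dots> \<le> real (Nc (T K2))" by (rule lower[OF t0])
      finally have "2 * n \<le> Nc (T K2)" by linarith
      then have "k * (real n * exp (- T K2)) \<le> e n" using L[OF t0, of n] n(2) by simp
      then show ?thesis unfolding en by (simp add: mult.assoc)
    qed
    with up show ?thesis by blast
  qed
  have g: "0 < g n" if "2 \<le> n" for n using that by (simp add: g_def)
  have e: "0 < e n" if n: "2 \<le> n" for n
  proof -
    define m where "m = max n n0"
    have m: "n0 \<le> m" "2 \<le> m" "n \<le> m" using n by (auto simp: m_def)
    have "0 < k * exp (- K2) * g m" using g[OF m(2)] pos(6) by simp
    also have "\<dots> \<le> e m" using main[OF m(1,2)] by blast
    also have "\<dots> \<le> e n" using m(3) n by (intro mono) auto
    finally show ?thesis .
  qed
  show ?thesis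
    using two_sided_bound_from_eventual[OF g e main] pos(6) unfolding g_def by simp
qed

theorem theorem1p1:
  fixes nrm :: "real^'t \<Rightarrow> real"
    and N :: nat
    and p c :: "nat \<Rightarrow> nat \<Rightarrow> real"
    and q :: "nat \<Rightarrow> real"
    and J :: "nat list \<Rightarrow> (real^'t) set"
    and M :: "(nat \<Rightarrow> nat) measure"
    and r t\<^sub>0 :: real
  assumes r: "0 < r"
    and nrm: "is_norm nrm"
    and p_nonneg: "\<And>i j. i \<in> {1..N} \<Longrightarrow> j \<in> {1..N} \<Longrightarrow> 0 \<le> p i j"
    and p_stoch: "\<And>i. i \<in> {1..N} \<Longrightarrow> (\<Sum>j=1..N. p i j) = 1"
    and c_range: "\<And>i j. i \<in> {1..N} \<Longrightarrow> j \<in> {1..N} \<Longrightarrow> 0 \<le> c i j \<and> c i j < 1"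
    and c_pos: "\<And>i j. i \<in> {1..N} \<Longrightarrow> j \<in> {1..N} \<Longrightarrow> 0 < c i j \<longleftrightarrow> 0 < p i j"
    and out_deg: "\<And>i. i \<in> {1..N} \<Longrightarrow> 2 \<le> card {j \<in> {1..N}. 0 < p i j}"
    and q_pos: "\<And>i. i \<in> {1..N} \<Longrightarrow> 0 < q i"
    and q_sum: "(\<Sum>i=1..N. q i) = 1"
    and J: "is_cylinder_system nrm N p c J"
    and t0: "0 < t\<^sub>0" "t\<^sub>0 < 1"
    and separation:
      "\<And>\<sigma> i\<^sub>1 i\<^sub>2. \<sigma> \<in> all_words N p \<Longrightarrow> i\<^sub>1 \<noteq> i\<^sub>2 \<Longrightarrow>
         \<sigma> @ [i\<^sub>1] \<in> all_words N p \<Longrightarrow> \<sigma> @ [i\<^sub>2] \<in> all_words N p \<Longrightarrow>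
         norm_setdist nrm (J (\<sigma> @ [i\<^sub>1])) (J (\<sigma> @ [i\<^sub>2]))
           \<ge> t\<^sub>0 * max (norm_diam nrm (J (\<sigma> @ [i\<^sub>1]))) (norm_diam nrm (J (\<sigma> @ [i\<^sub>2])))"
    and M: "is_markov_measure N p q M"
  shows "\<exists>B\<ge>1. \<forall>n\<ge>2.
    inverse B * (real n powr (- (r / s_crit N p c r)) *
        ln (real n) powr ((real (T_max N p c r) - 1) * (1 + r / s_crit N p c r)))
      \<le> quantization_error nrm (markov_type_measure J M) n r powr r \<and>
    quantization_error nrm (markov_type_measure J M) n r powr r
      \<le> B * (real n powr (- (r / s_crit N p c r)) *
        ln (real n) powr ((real (T_max N p c r) - 1) * (1 + r / s_crit N p c r)))"
proof -
  have "0 < N"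
  proof (rule ccontr)
    assume "\<not> 0 < N"
    then show False using q_sum by simp
  qed
  interpret S: cylinder_system N p c r nrm q J M t\<^sub>0
    by unfold_locales (use assms \<open>0 < N\<close> in \<open>blast+\<close>)
  define d where "d = T_max N p c r - 1"
  have d: "real (T_max N p c r) - 1 = real d" using S.T_max_props(3) by (simp add: d_def of_nat_diff)
  have s: "0 < s_crit N p c r" by (rule S.s_crit_solves(1))
  obtain A1 C1 where lower: "0 < A1" "0 \<le> C1"
      "\<And>t. 0 \<le> t \<Longrightarrow> A1 * exp (S.\<delta> * t) * (max 0 (t - C1)) ^ d \<le> real (card (S.cutset t))"
    using S.card_cutset_bounds(1) unfolding d_def by blast
  obtain A2 C2 where upper: "0 < A2" "0 \<le> C2"
      "\<And>t. 0 \<le> t \<Longrightarrow> real (card (S.cutset t)) \<le> A2 * exp (S.\<delta> * t) * (t + C2) ^ d"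
    using S.card_cutset_bounds(2) unfolding d_def by blast
  obtain k where k: "0 < k"
      "\<And>t n. 0 \<le> t \<Longrightarrow> 1 \<le> n \<Longrightarrow> 2 * n \<le> card (S.cutset t) \<Longrightarrow> k * (real n * exp (- t)) \<le> S.opt n"
    using S.opt_lower by blast
  have "\<exists>B\<ge>1. \<forall>n\<ge>2.
    inverse B * (real n powr (1 - 1 / S.\<delta>) * ln (real n) powr (real d / S.\<delta>)) \<le> S.opt n \<and>
    S.opt n \<le> B * (real n powr (1 - 1 / S.\<delta>) * ln (real n) powr (real d / S.\<delta>))"
    by (rule invert_counting_bounds[where Nc = "\<lambda>t. card (S.cutset t)",
          OF S.delta_bounds(1) lower(1) upper(1) lower(2) upper(2) k(1) lower(3) upper(3)
            S.opt_upper k(2) S.opt_antimono])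
  moreover have "1 - 1 / S.\<delta> = - (r / s_crit N p c r)"
    using s r by (simp add: S.\<delta>_def field_simps)
  moreover have "real d / S.\<delta> = (real (T_max N p c r) - 1) * (1 + r / s_crit N p c r)"
    unfolding d using s r by (simp add: S.\<delta>_def field_simps)
  moreover have "quantization_error nrm (markov_type_measure J M) n r powr r = S.opt n" if "2 \<le> n" for n
    using that by (intro S.quantization_error_eq) simp
  ultimately show ?thesis by simp
qed

end
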